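(* There exists a split exact sequence $$1 \to \operatorname{Aut}_{pc}(PVT_4) \to \operatorname{Aut}(PVT_4) \to \big\langle \operatorname{Aut}_{gr}(PVT_4), \operatorname{Aut}_{inv}(PVT_4), \operatorname{Aut}_{tr}(PVT_4) \big\rangle \to 1.$$ In particular, $$\operatorname{Aut}(PVT_4) = \operatorname{Aut}_{pc}(PVT_4) \rtimes \big\langle \operatorname{Aut}_{gr}(PVT_4), \operatorname{Aut}_{inv}(PVT_4), \operatorname{Aut}_{tr}(PVT_4) \big\rangle$$ $$\cong \big((\mathbb{Z}^2 * \mathbb{Z}^2 * \mathbb{Z}^2) \rtimes (\mathbb{Z}^2 * \mathbb{Z}^2 * \mathbb{Z}^2)\big) \rtimes \big( (\operatorname{GL}_2(\mathbb{Z}) \times \operatorname{GL}_2(\mathbb{Z}) \times \operatorname{GL}_2(\mathbb{Z})) \rtimes S_3 \big).$$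
   Context: The virtual twin group $VT_n$ has generators $s_1,\dots,s_{n-1},\rho_1,\dots,\rho_{n-1}$ and defining relations: $s_i^2=\rho_i^2=1$; $s_is_j=s_js_i$, $\rho_i\rho_j=\rho_j\rho_i$, $\rho_is_j=s_j\rho_i$ for $|i-j|\ge 2$; $\rho_i\rho_{i+1}\rho_i=\rho_{i+1}\rho_i\rho_{i+1}$ and $\rho_i\rho_{i+1}s_i=s_{i+1}\rho_i\rho_{i+1}$ for $1\le i\le n-2$. The pure virtual twin group $PVT_n$ is the kernel of $VT_n\to S_n$, $s_i,\rho_i\mapsto(i,i+1)$. It has the presentation with generators $\lambda_{i,j}$ ($1\le i<j\le n$), where $\lambda_{i,i+1}=s_i\rho_i$ and $\lambda_{i,j}=\rho_{j-1}\cdots\rho_{i+1}\lambda_{i,i+1}\rho_{i+1}\cdots\rho_{j-1}$ for $j\ne i+1$, and relations $\lambda_{i,j}\lambda_{k,l}=\lambda_{k,l}\lambda_{i,j}$ for pairwise distinct $i,j,k,l$. Thus $PVT_4=H_1*H_2*H_3$ with $H_i=\langle x_i,y_i\mid [x_i,y_i]=1\rangle\cong\mathbb Z^2$, where $\{x_1,y_1\}=\{\lambda_{1,2},\lambda_{3,4}\}$, $\{x_2,y_2\}=\{\lambda_{1,3},\lambda_{2,4}\}$, $\{x_3,y_3\}=\{\lambda_{1,4},\lambda_{2,3}\}$. Its graph has vertices $x_1,y_1,x_2,y_2,x_3,y_3$ and edges $x_iy_i$ ($i=1,2,3$); let $C_i$ be the connected component with vertex set $\{x_i,y_i\}$. Subgroups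 of $\operatorname{Aut}(PVT_4)$: $\operatorname{Aut}_{gr}$ is generated by the automorphisms induced by graph automorphisms; $\operatorname{Aut}_{inv}$ by the inversions (sending one of the six generators to its inverse and fixing the others); $\operatorname{Aut}_{tr}$ by the transvections $\tau_{x_iy_i}$ ($x_i\mapsto x_iy_i$, other generators fixed) and $\tau_{y_ix_i}$ ($y_i\mapsto y_ix_i$, other generators fixed), $i=1,2,3$; $\operatorname{Aut}_{pc}$ by the partial conjugations $p_{b,C}$, where $b\in\{x_i,y_i\}$, $C$ is a union of components $C_j$ with $j\neq i$, and $p_{b,C}$ sends each generator $a\in C$ to $b^{-1}ab$ and fixes the other generators. In the exact sequence the injection is the inclusion. *)

theory Defs
  imports "HOL-Algebra.Algebra" "HOL-Analysis.Cartesian_Space"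
begin

text \<open>The letter \<open>(a, True)\<close> stands for the generator \<open>a\<close> and \<open>(a, False)\<close> for its inverse.\<close>

type_synonym 'a word = "('a \<times> bool) list"

definition words :: "'a set \<Rightarrow> 'a word set" where
  "words S = lists (S \<times> UNIV)"

text \<open>The congruence on words generated by free cancellation and by a set \<open>R\<close> of relations,
  a pair \<open>(l, r)\<close> standing for the relation \<open>l = r\<close>.\<close>

inductive pres_eq :: "'a set \<Rightarrow> ('a word \<times> 'a word) set \<Rightarrow> 'a word \<Rightarrow> 'a word \<Rightarrow> bool"
  for S R where
  refl: "w \<in> words S \<Longrightarrow> pres_eq S R w w"
| sym: "pres_eq S R v w \<Longrightarrow> pres_eq S R w v"
| trans: "pres_eq S R u v \<Longrightarrow> pres_eq S R v w \<Longrightarrow> pres_eq S R u w"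
| cancel: "u \<in> words S \<Longrightarrow> v \<in> words S \<Longrightarrow> a \<in> S \<Longrightarrow>
    pres_eq S R (u @ [(a, e), (a, \<not> e)] @ v) (u @ v)"
| rel: "u \<in> words S \<Longrightarrow> v \<in> words S \<Longrightarrow> l \<in> words S \<Longrightarrow> r \<in> words S \<Longrightarrow> (l, r) \<in> R \<Longrightarrow>
    pres_eq S R (u @ l @ v) (u @ r @ v)"

definition pres_rel :: "'a set \<Rightarrow> ('a word \<times> 'a word) set \<Rightarrow> ('a word \<times> 'a word) set" where
  "pres_rel S R = {(u, v). pres_eq S R u v}"

definition presented_group :: "'a set \<Rightarrow> ('a word \<times> 'a word) set \<Rightarrow> 'a word set monoid" where
  "presented_group S R =
     \<lparr>carrier = words S // pres_rel S R,
      monoid.mult = \<lambda>A B. \<Union>u\<in>A. \<Union>v\<in>B. pres_rel S R `` {u @ v},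
      one = pres_rel S R `` {[]}\<rparr>"

definition free_product ::
  "'i set \<Rightarrow> ('i \<Rightarrow> 'a monoid) \<Rightarrow> ('i \<times> 'a) word set monoid" where
  "free_product I G = presented_group (SIGMA i:I. carrier (G i))
     {([((i, g), True), ((i, h), True)], [((i, g \<otimes>\<^bsub>G i\<^esub> h), True)]) | i g h.
        i \<in> I \<and> g \<in> carrier (G i) \<and> h \<in> carrier (G i)}"

text \<open>The external semidirect product \<open>N \<rtimes> H\<close>; it is a group when
  \<open>\<phi> \<in> hom H (AutoGroup N)\<close>.\<close>

definition semidirect :: "'a monoid \<Rightarrow> 'b monoid \<Rightarrow> ('b \<Rightarrow> 'a \<Rightarrow> 'a) \<Rightarrow> ('a \<times> 'b) monoid" where
  "semidirect N H \<phi> =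
     \<lparr>carrier = carrier N \<times> carrier H,
      monoid.mult = \<lambda>(a, b) (c, d). (a \<otimes>\<^bsub>N\<^esub> \<phi> b c, b \<otimes>\<^bsub>H\<^esub> d),
      one = (\<one>\<^bsub>N\<^esub>, \<one>\<^bsub>H\<^esub>)\<rparr>"

definition is_internal_semidirect :: "'a monoid \<Rightarrow> 'a set \<Rightarrow> 'a set \<Rightarrow> bool" where
  "is_internal_semidirect G N H \<longleftrightarrow>
     N \<lhd> G \<and> subgroup H G \<and> N \<inter> H = {\<one>\<^bsub>G\<^esub>} \<and> N <#>\<^bsub>G\<^esub> H = carrier G"

text \<open>A short exact sequence \<open>1 \<rightarrow> N \<rightarrow> G \<rightarrow> Q \<rightarrow> 1\<close> with maps \<open>\<iota>\<close>, \<open>\<pi>\<close> and with a section of \<open>\<pi>\<close>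
  that is a homomorphism. The library predicate lists the groups from right to left.\<close>

definition split_exact ::
  "'a monoid \<Rightarrow> 'a monoid \<Rightarrow> 'a monoid \<Rightarrow> ('a \<Rightarrow> 'a) \<Rightarrow> ('a \<Rightarrow> 'a) \<Rightarrow> bool" where
  "split_exact N G Q \<iota> \<pi> \<longleftrightarrow> short_exact_sequence Q G N \<pi> \<iota> \<and>
     (\<exists>\<sigma> \<in> hom Q G. \<forall>q \<in> carrier Q. \<pi> (\<sigma> q) = q)"

datatype vt_gen = TwinGen nat | RhoGen nat

abbreviation s_let :: "nat \<Rightarrow> vt_gen \<times> bool" where "s_let i \<equiv> (TwinGen i, True)"
abbreviation \<rho>_let :: "nat \<Rightarrow> vt_gen \<times> bool" where "\<rho>_let i \<equiv> (RhoGen i, True)"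

definition VT_gens :: "nat \<Rightarrow> vt_gen set" where
  "VT_gens n = TwinGen ` {1..<n} \<union> RhoGen ` {1..<n}"

text \<open>For natural numbers, \<open>i + 2 \<le> j \<or> j + 2 \<le> i\<close> is \<open>\<bar>i - j\<bar> \<ge> 2\<close>, and the last two families
  of relations range over \<open>1 \<le> i \<le> n - 2\<close>.\<close>

definition VT_rels :: "nat \<Rightarrow> (vt_gen word \<times> vt_gen word) set" where
  "VT_rels n =
     {([s_let i, s_let i], []) | i. i \<in> {1..<n}} \<union>
     {([\<rho>_let i, \<rho>_let i], []) | i. i \<in> {1..<n}} \<union>
     {([s_let i, s_let j], [s_let j, s_let i]) | i j.
        i \<in> {1..<n} \<and> j \<in> {1..<n} \<and> (i + 2 \<le> j \<or> j + 2 \<le> i)} \<union>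
     {([\<rho>_let i, \<rho>_let j], [\<rho>_let j, \<rho>_let i]) | i j.
        i \<in> {1..<n} \<and> j \<in> {1..<n} \<and> (i + 2 \<le> j \<or> j + 2 \<le> i)} \<union>
     {([\<rho>_let i, s_let j], [s_let j, \<rho>_let i]) | i j.
        i \<in> {1..<n} \<and> j \<in> {1..<n} \<and> (i + 2 \<le> j \<or> j + 2 \<le> i)} \<union>
     {([\<rho>_let i, \<rho>_let (i + 1), \<rho>_let i], [\<rho>_let (i + 1), \<rho>_let i, \<rho>_let (i + 1)]) | i.
        1 \<le> i \<and> i + 2 \<le> n} \<union>
     {([\<rho>_let i, \<rho>_let (i + 1), s_let i], [s_let (i + 1), \<rho>_let i, \<rho>_let (i + 1)]) | i.
        1 \<le> i \<and> i + 2 \<le> n}"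

definition VT :: "nat \<Rightarrow> vt_gen word set monoid" where
  "VT n = presented_group (VT_gens n) (VT_rels n)"

definition VT_elem :: "nat \<Rightarrow> vt_gen word \<Rightarrow> vt_gen word set" where
  "VT_elem n w = pres_rel (VT_gens n) (VT_rels n) `` {w}"

text \<open>The homomorphism \<open>VT n \<rightarrow> sym_group n\<close> sending \<open>s\<^sub>i\<close> and \<open>\<rho>\<^sub>i\<close> to the transposition
  \<open>(i, i + 1)\<close>. A transposition is its own inverse, so the exponent of a letter is irrelevant.\<close>

fun gen_perm :: "vt_gen \<Rightarrow> nat \<Rightarrow> nat" where
  "gen_perm (TwinGen i) = Transposition.transpose i (i + 1)"
| "gen_perm (RhoGen i) = Transposition.transpose i (i + 1)"

definition word_perm :: "vt_gen word \<Rightarrow> nat \<Rightarrow> nat" where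
  "word_perm w = foldr (\<lambda>(a, e) p. gen_perm a \<circ> p) w id"

definition VT_to_sym :: "vt_gen word set \<Rightarrow> nat \<Rightarrow> nat" where
  "VT_to_sym A = the_elem (word_perm ` A)"

definition PVT :: "nat \<Rightarrow> vt_gen word set monoid" where
  "PVT n = (VT n)\<lparr>carrier := kernel (VT n) (sym_group n) VT_to_sym\<rparr>"

text \<open>The element \<open>\<lambda>\<^sub>i\<^sub>,\<^sub>j\<close> of \<open>PVT n\<close>, for \<open>1 \<le> i < j \<le> n\<close>.\<close>

definition lam :: "nat \<Rightarrow> nat \<times> nat \<Rightarrow> vt_gen word set" where
  "lam n = (\<lambda>(i, j). VT_elem n
     (map \<rho>_let (rev [i + 1..<j]) @ [s_let i, \<rho>_let i] @ map \<rho>_let [i + 1..<j]))"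

text \<open>A vertex \<open>(i, j)\<close> of the graph of \<open>PVT 4\<close> stands for the generator \<open>lam 4 (i, j)\<close>. The
  generators \<open>x\<^sub>1, x\<^sub>2, x\<^sub>3\<close> are \<open>\<lambda>\<^sub>1\<^sub>,\<^sub>2, \<lambda>\<^sub>1\<^sub>,\<^sub>3, \<lambda>\<^sub>1\<^sub>,\<^sub>4\<close>, and \<open>y\<^sub>1, y\<^sub>2, y\<^sub>3\<close> are
  \<open>\<lambda>\<^sub>3\<^sub>,\<^sub>4, \<lambda>\<^sub>2\<^sub>,\<^sub>4, \<lambda>\<^sub>2\<^sub>,\<^sub>3\<close>. Everything below is symmetric in \<open>x\<^sub>i\<close> and \<open>y\<^sub>i\<close>.\<close>

definition x_vert :: "nat \<Rightarrow> nat \<times> nat" where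
  "x_vert i = (if i = 1 then (1, 2) else if i = 2 then (1, 3) else (1, 4))"

definition y_vert :: "nat \<Rightarrow> nat \<times> nat" where
  "y_vert i = (if i = 1 then (3, 4) else if i = 2 then (2, 4) else (2, 3))"

definition comp4 :: "nat \<Rightarrow> (nat \<times> nat) set" where
  "comp4 i = {x_vert i, y_vert i}"

definition verts4 :: "(nat \<times> nat) set" where
  "verts4 = (\<Union>i\<in>{1..3}. comp4 i)"

definition edges4 :: "(nat \<times> nat) set set" where
  "edges4 = (\<lambda>i. {x_vert i, y_vert i}) ` {1..3}"

definition graph_auts4 :: "(nat \<times> nat \<Rightarrow> nat \<times> nat) set" where
  "graph_auts4 = {\<sigma>. bij_betw \<sigma> verts4 verts4 \<and>
     (\<forall>a\<in>verts4. \<forall>b\<in>verts4. {\<sigma> a, \<sigma> b} \<in> edges4 \<longleftrightarrow> {a, b} \<in> edges4)}"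

type_synonym pvt_map = "vt_gen word set \<Rightarrow> vt_gen word set"

abbreviation Aut4 :: "pvt_map monoid" where
  "Aut4 \<equiv> AutoGroup (PVT 4)"

text \<open>The automorphisms of \<open>PVT 4\<close> sending every generator \<open>lam 4 v\<close> to \<open>f v\<close>; there is at most
  one, since these elements generate \<open>PVT 4\<close>.\<close>

definition auts_with_images :: "(nat \<times> nat \<Rightarrow> vt_gen word set) \<Rightarrow> pvt_map set" where
  "auts_with_images f = {\<phi> \<in> carrier Aut4. \<forall>v\<in>verts4. \<phi> (lam 4 v) = f v}"

definition Aut_gr :: "pvt_map monoid" where
  "Aut_gr = subgroup_generated Aut4
     (\<Union>\<sigma>\<in>graph_auts4. auts_with_images (\<lambda>v. lam 4 (\<sigma> v)))"

definition Aut_inv :: "pvt_map monoid" where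
  "Aut_inv = subgroup_generated Aut4
     (\<Union>a\<in>verts4. auts_with_images (\<lambda>v. if v = a then inv\<^bsub>PVT 4\<^esub> (lam 4 a) else lam 4 v))"

definition transvections :: "nat \<times> nat \<Rightarrow> nat \<times> nat \<Rightarrow> pvt_map set" where
  "transvections a b =
     auts_with_images (\<lambda>v. if v = a then lam 4 a \<otimes>\<^bsub>PVT 4\<^esub> lam 4 b else lam 4 v)"

definition Aut_tr :: "pvt_map monoid" where
  "Aut_tr = subgroup_generated Aut4
     (\<Union>i\<in>{1..3}. transvections (x_vert i) (y_vert i) \<union> transvections (y_vert i) (x_vert i))"

definition partial_conjs :: "nat \<times> nat \<Rightarrow> (nat \<times> nat) set \<Rightarrow> pvt_map set" where
  "partial_conjs b C = auts_with_images
     (\<lambda>v. if v \<in> C then inv\<^bsub>PVT 4\<^esub> (lam 4 b) \<otimes>\<^bsub>PVT 4\<^esub> lam 4 v \<otimes>\<^bsub>PVT 4\<^esub> lam 4 b else lam 4 v)"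

definition Aut_pc :: "pvt_map monoid" where
  "Aut_pc = subgroup_generated Aut4
     (\<Union>i\<in>{1..3}. \<Union>b\<in>comp4 i. \<Union>J\<in>Pow ({1..3} - {i}). partial_conjs b (\<Union>j\<in>J. comp4 j))"

definition Aut_gr_inv_tr :: "pvt_map monoid" where
  "Aut_gr_inv_tr =
     subgroup_generated Aut4 (carrier Aut_gr \<union> carrier Aut_inv \<union> carrier Aut_tr)"

definition Z2_free3 :: "(nat \<times> int \<times> int) word set monoid" where
  "Z2_free3 = free_product {1..3} (\<lambda>_. integer_group \<times>\<times> integer_group)"

definition GL2Z :: "(int^2^2) monoid" where
  "GL2Z = \<lparr>carrier = {A. invertible A}, monoid.mult = (**), one = mat 1\<rparr>"

definition GL2Z_cubed :: "(nat \<Rightarrow> int^2^2) monoid" where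
  "GL2Z_cubed = product_group {1..3} (\<lambda>_. GL2Z)"

definition perm_action :: "(nat \<Rightarrow> nat) \<Rightarrow> (nat \<Rightarrow> int^2^2) \<Rightarrow> nat \<Rightarrow> int^2^2" where
  "perm_action p = (\<lambda>M \<in> carrier GL2Z_cubed. \<lambda>i\<in>{1..3}. M (inv_into {1..3} p i))"

definition GL2Z_wr_S3 :: "((nat \<Rightarrow> int^2^2) \<times> (nat \<Rightarrow> nat)) monoid" where
  "GL2Z_wr_S3 = semidirect GL2Z_cubed (sym_group 3) perm_action"

end

theory Submission
  imports Defs
begin

text \<open>\<open>PVT 4\<close> is the free product \<open>F\<close> of three copies \<open>H\<^sub>1, H\<^sub>2, H\<^sub>3\<close> of \<open>\<int>\<^sup>2\<close>: let \<open>VT 4\<close> act on \<open>F\<close>, the \<open>\<rho>\<^sub>k\<close> by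
  automorphisms and the \<open>s\<^sub>k\<close> by the same automorphisms followed by translations; then \<open>PVT 4\<close> acts by
  translations.

  An element of a free product that is not conjugate into a factor has a virtually cyclic
  centralizer. So an automorphism of \<open>F\<close> maps every factor onto a conjugate of a factor, and it is the
  product of an automorphism conjugating each \<open>H\<^sub>i\<close> by some \<open>g\<^sub>i\<close> and of one permuting the factors
  themselves. The latter form \<open>GL\<^sub>2(\<int>) \<wr> S\<^sub>3\<close>. The former are products of partial conjugations: as long as
  the conjugates \<open>g\<^sub>i H\<^sub>i g\<^sub>i\<^sup>-\<^sup>1\<close> are not in Nielsen reduced position, a partial conjugation decreases the
  total length of the \<open>g\<^sub>i\<close>, and in reduced position they generate \<open>F\<close> only if all \<open>g\<^sub>i\<close> are trivial.
  Finally, the inner automorphisms have a complement among these, generated by the conjugations of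
  \<open>H\<^bsub>i+1\<^esub>\<close> by \<open>H\<^sub>i\<close> (indices modulo 3), and this complement is again a free product of three copies of
  \<open>\<int>\<^sup>2\<close>.\<close>

section \<open>Free products of copies of a group\<close>

text \<open>For \<open>PVT 4\<close> two bounds have to meet. The normal form
  \<open>generate G Ls <#> W\<close> shows that the six elements lambda generate the kernel; the
  action on \<open>F\<close> shows that they satisfy no relations beyond those of the free product.
  Its affine shape is forced by s_k = lambda_{k,k+1} rho_k, since rho_k should permute indices and
  lambda_{k,k+1} should be a translation. A factor of rank two contains, next to any nonzero u, an
  element v with no positive multiple among the multiples of u. The images of u and v commute, so a
  virtually cyclic centralizer is impossible for the image of u. The conjugators g_i are determined
  only up to right multiplication by H_i, because H_i is abelian. This freedom is used both in
  shortening them and in following them through products of twists. Only the cyclic pairs (i, i+1)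
  occur in the complement: modulo inner automorphisms, conjugating H_{i+2} by an element of H_i is
  the same as conjugating H_{i+1} by its inverse. Automorphisms are treated as total functions on
  the type \<open>F\<close>; the extensional maps of \<open>AutoGroup\<close> enter only at the end,
  through \<open>transport\<close>.\<close>

definition reduced :: "('i \<times> 'a::zero) list \<Rightarrow> bool" where
  "reduced w \<longleftrightarrow> 0 \<notin> snd ` set w \<and> distinct_adj (map fst w)"

text \<open>The van der Waerden action of a single letter on reduced words. The product is a fold of
  this action, so that associativity comes down to the fact that the letters of one factor act as a
  group (\<open>mcons_mcons\<close>).\<close>

definition mcons :: "'i \<times> 'a::group_add \<Rightarrow> ('i \<times> 'a) list \<Rightarrow> ('i \<times> 'a) list" where
  "mcons x w = (if snd x = 0 then w else case w of [] \<Rightarrow> [x] | y # ys \<Rightarrow>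
     if fst x = fst y then (if snd x + snd y = 0 then ys else (fst x, snd x + snd y) # ys) else x # w)"

lemma reduced_Nil [simp]: "reduced []"
  by (simp add: reduced_def)

lemma reduced_Cons: "reduced (x # w) \<longleftrightarrow> snd x \<noteq> 0 \<and> (w = [] \<or> fst x \<noteq> fst (hd w)) \<and> reduced w"
  by (cases w) (auto simp: reduced_def)

lemma reduced_append:
  "reduced (u @ v) \<longleftrightarrow> reduced u \<and> reduced v \<and> (u = [] \<or> v = [] \<or> fst (last u) \<noteq> fst (hd v))"
  by (auto simp: reduced_def distinct_adj_append_iff last_map hd_map)

lemma reduced_inverse: "reduced w \<Longrightarrow> reduced (rev (map (\<lambda>(i, a). (i, - a)) w))" for w :: "('i \<times> 'a::group_add) list"
  by (auto simp: reduced_def rev_map[symmetric] comp_def case_prod_unfold)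

lemma reduced_mcons: "reduced w \<Longrightarrow> reduced (mcons x w)"
  by (cases w) (auto simp: mcons_def reduced_Cons)

lemma mcons_zero [simp]: "mcons (i, 0) w = w"
  by (simp add: mcons_def)

lemma mcons_reduced: "reduced (x # w) \<Longrightarrow> mcons x w = x # w"
  by (cases w) (auto simp: mcons_def reduced_Cons)

lemma mcons_mcons:
  fixes a b :: "'a::group_add"
  shows "reduced w \<Longrightarrow> mcons (i, a) (mcons (i, b) w) = mcons (i, a + b) w"
proof (cases w)
  case (Cons y ys)
  assume r: "reduced w"
  obtain j c where y: "y = (j, c)" by force
  have *: "a + b = 0 \<Longrightarrow> a + (b + c) = c" for c by (simp flip: add.assoc)
  have **: "a + b = 0 \<Longrightarrow> b + c = 0 \<Longrightarrow> a = c" by (metis eq_neg_iff_add_eq_0 neg_eq_iff_add_eq_0)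
  have ***: "b + c = 0 \<Longrightarrow> c + b = 0" by (metis eq_neg_iff_add_eq_0 neg_eq_iff_add_eq_0)
  show ?thesis
    using r by (cases ys) (auto simp: mcons_def Cons y reduced_Cons add.assoc * dest: ** *** split: if_splits)
qed (auto simp: mcons_def)

lemma reduced_foldr: "reduced v \<Longrightarrow> reduced (foldr mcons u v)"
  by (induction u) (auto intro: reduced_mcons)

lemma foldr_mcons_Nil: "reduced u \<Longrightarrow> foldr mcons u [] = u"
  by (induction u) (auto simp: reduced_Cons intro!: mcons_reduced)

lemma foldr_mcons_append: "reduced (u @ v) \<Longrightarrow> foldr mcons u v = u @ v"
proof (induction u)
  case (Cons x u)
  from Cons.prems have "reduced (u @ v)"
    by (auto simp: reduced_Cons simp del: reduced_append)
  with Cons show ?case by (auto intro!: mcons_reduced)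
qed simp

text \<open>A merge or cancellation at the head of \<open>u\<close> does not change how
  \<open>u\<close> acts on \<open>v\<close>, because merged letters act by the sum of their values.
  This is the induction step of associativity.\<close>

lemma foldr_mcons_mcons:
  assumes "reduced v"
  shows "foldr mcons (mcons x u) v = mcons x (foldr mcons u v)"
proof -
  obtain i a where x: "x = (i, a)" by force
  show ?thesis
  proof (cases u)
    case (Cons y ys)
    obtain j b where y: "y = (j, b)" by force
    have "mcons (i, a) (mcons (i, b) (foldr mcons ys v)) = mcons (i, a + b) (foldr mcons ys v)"
      by (rule mcons_mcons) (rule reduced_foldr[OF assms])
    then show ?thesis
      by (auto simp: x y Cons mcons_def[of _ "(j, b) # ys"])
  qed (auto simp: mcons_def[of _ "[]"] x)
qed

lemma foldr_mcons_assoc: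
  "reduced v \<Longrightarrow> reduced w \<Longrightarrow> foldr mcons (foldr mcons u v) w = foldr mcons u (foldr mcons v w)"
  by (induction u) (simp_all add: foldr_mcons_mcons)

lemma foldr_mcons_inverse:
  assumes "reduced w"
  shows "foldr mcons (rev (map (\<lambda>(i, a). (i, - a)) w)) w = []"
  using assms
proof (induction w)
  case (Cons x w)
  obtain i a where x: "x = (i, a)" by force
  from Cons.prems have w: "reduced w" "reduced ((i, a) # w)" by (simp_all add: reduced_Cons x)
  have "mcons (i, - a) (x # w) = mcons (i, - a) (mcons (i, a) w)"
    using Cons.prems by (simp add: mcons_reduced x)
  also have "\<dots> = w" using mcons_mcons[OF w(1), of i "- a" a] by simp
  finally show ?case using Cons.IH w by (simp add: x)
qed simp

section \<open>The free product as a type: group structure, length, first and last letters\<close>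

typedef (overloaded) ('i, 'a) fprod = "{w :: ('i \<times> 'a::group_add) list. reduced w}"
  morphisms word_of Abs_fprod
  by (rule exI[of _ "[]"]) simp

setup_lifting type_definition_fprod

text \<open>Additive notation for a noncommutative group: as an instance of
  \<open>group_add\<close>, the free product is computed in without carrier conditions.\<close>

instantiation fprod :: (type, group_add) group_add
begin

lift_definition zero_fprod :: "('a, 'b) fprod" is "[] :: ('a \<times> 'b) list" by simp

lift_definition plus_fprod :: "('a, 'b) fprod \<Rightarrow> ('a, 'b) fprod \<Rightarrow> ('a, 'b) fprod" is "foldr mcons"
  by (rule reduced_foldr)

lift_definition uminus_fprod :: "('a, 'b) fprod \<Rightarrow> ('a, 'b) fprod"
  is "\<lambda>w. rev (map (\<lambda>(i, a). (i, - a)) w)"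
  by (rule reduced_inverse)

definition minus_fprod :: "('a, 'b) fprod \<Rightarrow> ('a, 'b) fprod \<Rightarrow> ('a, 'b) fprod" where
  "minus_fprod x y = x + - y"

instance
proof
  fix x y z :: "('a, 'b) fprod"
  show "x + y + z = x + (y + z)" by transfer (rule foldr_mcons_assoc)
  show "0 + x = x" by transfer simp
  show "x + 0 = x" by transfer (rule foldr_mcons_Nil)
  show "- x + x = 0" by transfer (rule foldr_mcons_inverse)
  show "x + - y = x - y" by (simp add: minus_fprod_def)
qed

end

lift_definition letter :: "'i \<Rightarrow> 'a::group_add \<Rightarrow> ('i, 'a) fprod" is "\<lambda>i a. if a = 0 then [] else [(i, a)]"
  by (auto simp: reduced_def)

definition len :: "('i, 'a::group_add) fprod \<Rightarrow> nat" where
  "len x = length (word_of x)"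

definition starts :: "'i \<Rightarrow> ('i, 'a::group_add) fprod \<Rightarrow> bool" where
  "starts i x \<longleftrightarrow> word_of x \<noteq> [] \<and> fst (hd (word_of x)) = i"

definition ends :: "'i \<Rightarrow> ('i, 'a::group_add) fprod \<Rightarrow> bool" where
  "ends i x \<longleftrightarrow> word_of x \<noteq> [] \<and> fst (last (word_of x)) = i"

lemma reduced_word_of [simp]: "reduced (word_of x)"
  using word_of by auto

lemma word_of_letter: "word_of (letter i a) = (if a = 0 then [] else [(i, a)])"
  by (rule letter.rep_eq)

lemma letter_zero [simp]: "letter i 0 = 0"
  by transfer simp

lemma letter_add: "letter i (a + b) = letter i a + letter i b"
  by transfer (auto simp: mcons_def)

lemma letter_minus: "letter i (- a) = - letter i a"
  by (metis add.right_inverse letter_add letter_zero minus_unique)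

lemma letter_eq_zero_iff [simp]: "letter i a = 0 \<longleftrightarrow> a = 0"
  by transfer auto

lemma letter_eq_iff: "letter i a = letter j b \<longleftrightarrow> a = b \<and> (i = j \<or> a = 0)"
  by transfer auto

lemma len_zero [simp]: "len 0 = 0"
  by (simp add: len_def zero_fprod.rep_eq)

lemma len_eq_zero_iff [simp]: "len x = 0 \<longleftrightarrow> x = 0"
  by (simp add: len_def zero_fprod.rep_eq flip: word_of_inject)

lemma len_letter: "len (letter i a) = (if a = 0 then 0 else 1)"
  by (simp add: len_def word_of_letter)

lemma len_minus [simp]: "len (- x) = len x"
  by (simp add: len_def uminus_fprod.rep_eq)

text \<open>Each step of the fold lengthens the word by at most one letter.\<close>

lemma len_add_le: "len (x + y) \<le> len x + len y"
proof -
  have "length (foldr mcons u v) \<le> length u + length v" for u v :: "('a \<times> 'b) list"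
  proof (induction u)
    case (Cons x u)
    have "length (mcons x w) \<le> Suc (length w)" for w :: "('a \<times> 'b) list"
      by (cases w) (auto simp: mcons_def)
    then show ?case using Cons by (auto intro: order_trans)
  qed simp
  then show ?thesis by (simp add: len_def plus_fprod.rep_eq)
qed

lemma not_starts_zero [simp]: "\<not> starts i 0"
  by (simp add: starts_def zero_fprod.rep_eq)

lemma not_ends_zero [simp]: "\<not> ends i 0"
  by (simp add: ends_def zero_fprod.rep_eq)

lemma starts_letter: "starts i (letter j a) \<longleftrightarrow> i = j \<and> a \<noteq> 0"
  by (auto simp: starts_def word_of_letter)

lemma ends_letter: "ends i (letter j a) \<longleftrightarrow> i = j \<and> a \<noteq> 0"
  by (auto simp: ends_def word_of_letter)

lemma starts_minus [simp]: "starts i (- x) \<longleftrightarrow> ends i x"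
  by (auto simp: starts_def ends_def uminus_fprod.rep_eq hd_rev last_map split: prod.splits)

lemma ends_minus [simp]: "ends i (- x) \<longleftrightarrow> starts i x"
  using starts_minus[of i "- x"] by simp

lemma starts_unique: "starts i x \<Longrightarrow> starts j x \<Longrightarrow> i = j"
  by (simp add: starts_def)

lemma ends_unique: "ends i x \<Longrightarrow> ends j x \<Longrightarrow> i = j"
  by (simp add: ends_def)

lemma ex_starts: "x \<noteq> 0 \<Longrightarrow> \<exists>i. starts i x"
  by (simp add: starts_def zero_fprod.rep_eq flip: word_of_inject)

lemma ex_ends: "x \<noteq> 0 \<Longrightarrow> \<exists>i. ends i x"
  by (simp add: ends_def zero_fprod.rep_eq flip: word_of_inject)

lemma word_of_add:
  assumes "\<nexists>i. ends i x \<and> starts i y"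
  shows "word_of (x + y) = word_of x @ word_of y"
  unfolding plus_fprod.rep_eq
  by (rule foldr_mcons_append) (use assms in \<open>auto simp: reduced_append starts_def ends_def\<close>)

lemma reduced_add:
  assumes "\<nexists>i. ends i x \<and> starts i y"
  shows "len (x + y) = len x + len y"
    and "starts i (x + y) \<longleftrightarrow> (if x = 0 then starts i y else starts i x)"
    and "ends i (x + y) \<longleftrightarrow> (if y = 0 then ends i x else ends i y)"
proof -
  have w: "word_of (x + y) = word_of x @ word_of y"
    using assms by (rule word_of_add)
  have z: "z = 0 \<longleftrightarrow> word_of z = []" for z :: "('a, 'b) fprod"
    by (simp add: zero_fprod.rep_eq flip: word_of_inject)
  show "len (x + y) = len x + len y"
    and "starts i (x + y) \<longleftrightarrow> (if x = 0 then starts i y else starts i x)"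
    and "ends i (x + y) \<longleftrightarrow> (if y = 0 then ends i x else ends i y)"
    by (simp_all add: len_def starts_def ends_def w z)
qed

lemma letter_reduced_add:
  assumes "a \<noteq> 0" "\<not> starts i y"
  shows "len (letter i a + y) = Suc (len y)"
    and "starts j (letter i a + y) \<longleftrightarrow> j = i"
    and "ends j (letter i a + y) \<longleftrightarrow> (if y = 0 then j = i else ends j y)"
    and "letter i a + y \<noteq> 0"
proof -
  have r: "\<nexists>k. ends k (letter i a) \<and> starts k y"
    using assms by (auto simp: ends_letter)
  show "len (letter i a + y) = Suc (len y)"
    using assms by (simp add: reduced_add(1)[OF r] len_letter)
  then show "letter i a + y \<noteq> 0" by auto
  show "starts j (letter i a + y) \<longleftrightarrow> j = i"
    and "ends j (letter i a + y) \<longleftrightarrow> (if y = 0 then j = i else ends j y)"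
    using assms by (simp_all add: reduced_add(2,3)[OF r] starts_letter ends_letter)
qed

text \<open>Allowing \<open>a = 0\<close> makes the splitting available for every \<open>x\<close>
  and \<open>i\<close>; the last clause tells when a letter is really removed, and the length clause
  lets the splitting drive inductions on length.\<close>

lemma starts_decomp:
  obtains a y where "x = letter i a + y" "\<not> starts i y" "len x = len y + (if a = 0 then 0 else 1)"
    "a = 0 \<longleftrightarrow> \<not> starts i x"
proof (cases "starts i x")
  case True
  then obtain a w where w: "word_of x = (i, a) # w" by (cases "word_of x") (auto simp: starts_def)
  have r: "reduced ((i, a) # w)" using reduced_word_of[of x] unfolding w .
  define y where "y = Abs_fprod w"
  have wy: "word_of y = w" using r by (simp add: y_def Abs_fprod_inverse reduced_Cons)
  have a: "a \<noteq> 0" and y: "\<not> starts i y" using r by (auto simp: reduced_Cons starts_def wy)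
  have "word_of (letter i a + y) = word_of x"
    using a y by (subst word_of_add) (auto simp: ends_letter word_of_letter wy w)
  then have "x = letter i a + y" by (simp add: word_of_inject)
  with a y True show thesis by (intro that[of a y]) (auto simp: letter_reduced_add)
next
  case False
  then show thesis by (intro that[of 0 x]) auto
qed

lemma ends_decomp:
  obtains a y where "x = y + letter i a" "\<not> ends i y" "len x = len y + (if a = 0 then 0 else 1)"
    "a = 0 \<longleftrightarrow> \<not> ends i x"
proof -
  obtain a y where *: "- x = letter i a + y" "\<not> starts i y"
      "len (- x) = len y + (if a = 0 then 0 else 1)" "a = 0 \<longleftrightarrow> \<not> starts i (- x)"
    by (rule starts_decomp)
  have "x = - (letter i a + y)" by (simp add: *(1)[symmetric])
  then have "x = - y + letter i (- a)"
    by (simp only: letter_minus minus_add)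
  moreover have "len x = len (- y) + (if - a = 0 then 0 else 1)"
    using *(3) by simp
  moreover have "- a = 0 \<longleftrightarrow> \<not> ends i x"
    using *(4) by simp
  ultimately show thesis using *(2) by (intro that[of "- y" "- a"]) simp_all
qed

lemma fprod_induct [case_names zero letter]:
  assumes "P 0" "\<And>i a x. a \<noteq> 0 \<Longrightarrow> \<not> starts i x \<Longrightarrow> P x \<Longrightarrow> P (letter i a + x)"
  shows "P x"
proof (induction "len x" arbitrary: x rule: less_induct)
  case less
  show ?case
  proof (cases "x = 0")
    case False
    then obtain i where i: "starts i x" using ex_starts by blast
    obtain a y where "x = letter i a + y" "\<not> starts i y" "len x = len y + (if a = 0 then 0 else 1)"
      "a = 0 \<longleftrightarrow> \<not> starts i x" by (rule starts_decomp)
    with i less assms show ?thesis by auto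
  qed (use assms in simp)
qed

section \<open>The universal property of the free product, and additive homomorphisms\<close>

definition additive_group :: "'a::group_add monoid" where
  "additive_group = \<lparr>carrier = UNIV, monoid.mult = (+), one = 0\<rparr>"

lemma carrier_additive_group [simp]: "carrier additive_group = UNIV"
  and mult_additive_group [simp]: "monoid.mult additive_group = (+)"
  and one_additive_group [simp]: "one additive_group = 0"
  by (simp_all add: additive_group_def)

lemma group_additive_group [simp]: "group (additive_group :: 'a::group_add monoid)"
proof (rule groupI, goal_cases)
  case (5 x)
  then show ?case by (auto intro: exI[of _ "- x"])
qed (simp_all add: add.assoc)

lemma inv_additive_group [simp]: "inv\<^bsub>additive_group\<^esub> x = - x"
  by (rule group.inv_equality) auto

definition fprod_lift :: "('b, 'c) monoid_scheme \<Rightarrow> ('i \<Rightarrow> 'a \<Rightarrow> 'b) \<Rightarrow> ('i, 'a::group_add) fprod \<Rightarrow> 'b" where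
  "fprod_lift G f x = foldr (\<lambda>(i, a) z. f i a \<otimes>\<^bsub>G\<^esub> z) (word_of x) \<one>\<^bsub>G\<^esub>"

lemma hom_one_additive:
  assumes "group G" "h \<in> hom additive_group G"
  shows "h 0 = \<one>\<^bsub>G\<^esub>"
  using hom_one[OF assms(2) group_additive_group assms(1)] by simp

context
  fixes G :: "('b, 'c) monoid_scheme" and f :: "'i \<Rightarrow> 'a::group_add \<Rightarrow> 'b"
  assumes G: "group G" and f: "\<And>i. f i \<in> hom additive_group G"
begin

interpretation group G by (rule G)

lemma fprod_lift_letter [simp]: "fprod_lift G f (letter i a) = f i a"
  using hom_in_carrier[OF f] by (simp add: fprod_lift_def word_of_letter hom_one_additive[OF G f])

lemma fprod_lift_hom: "fprod_lift G f \<in> hom additive_group G"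
proof -
  let ?e = "\<lambda>w. foldr (\<lambda>(i, a) z. f i a \<otimes>\<^bsub>G\<^esub> z) w \<one>\<^bsub>G\<^esub>"
  have fc [simp]: "f i a \<in> carrier G" for i a
    using hom_in_carrier[OF f, of a i] by simp
  have ec [simp]: "?e w \<in> carrier G" for w
    by (induction w) (auto simp: case_prod_unfold)
  have ec' [simp]: "foldr (\<lambda>p. (\<otimes>\<^bsub>G\<^esub>) (f (fst p) (snd p))) w \<one>\<^bsub>G\<^esub> \<in> carrier G" for w
    using ec[of w] by (simp add: case_prod_unfold)
  have fa: "f i (a + b) = f i a \<otimes>\<^bsub>G\<^esub> f i b" for i a b
    using hom_mult[OF f, of a b i] by simp
  have f0: "f i 0 = \<one>\<^bsub>G\<^esub>" for i by (rule hom_one_additive[OF G f])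
  \<comment> \<open>Evaluation does not see merging, since every \<open>f i\<close> is a
    homomorphism; hence it turns the fold into a product.\<close>
  have "?e (mcons x w) = ?e (x # w)" for x w
  proof (cases w)
    case (Cons y ys)
    have "f i a \<otimes>\<^bsub>G\<^esub> (f i b \<otimes>\<^bsub>G\<^esub> ?e ys) = f i (a + b) \<otimes>\<^bsub>G\<^esub> ?e ys" for i a b
      by (simp add: fa m_assoc)
    then show ?thesis
      by (auto simp: mcons_def Cons f0 case_prod_unfold)
  qed (auto simp: mcons_def f0 case_prod_unfold)
  then have "?e (foldr mcons u v) = ?e u \<otimes>\<^bsub>G\<^esub> ?e v" for u v
    by (induction u) (auto simp: m_assoc case_prod_unfold)
  then show ?thesis
    by (auto simp: hom_def fprod_lift_def plus_fprod.rep_eq)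
qed

end

lemma fprod_hom_eqI:
  assumes "group G" "h \<in> hom additive_group G" "k \<in> hom additive_group G"
    and "\<And>i a. h (letter i a) = k (letter i a)"
  shows "h x = k x"
proof (induction x rule: fprod_induct)
  case zero
  show ?case using assms by (simp add: hom_one_additive)
next
  case (letter i a x)
  show ?case using hom_mult[OF assms(2)] hom_mult[OF assms(3)] assms(4) letter by simp
qed

definition add_hom :: "('a::group_add \<Rightarrow> 'b::group_add) \<Rightarrow> bool" where
  "add_hom f \<longleftrightarrow> (\<forall>x y. f (x + y) = f x + f y)"

lemma add_hom_iff: "add_hom f \<longleftrightarrow> f \<in> hom additive_group additive_group"
  by (simp add: add_hom_def hom_def)

lemma add_hom_add: "add_hom f \<Longrightarrow> f (x + y) = f x + f y"
  by (simp add: add_hom_def)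

lemma add_hom_zero: "add_hom f \<Longrightarrow> f 0 = 0"
  using add_hom_add[of f 0 0] add_left_cancel[of "f 0" "f 0" 0] by simp

lemma add_hom_minus: "add_hom f \<Longrightarrow> f (- x) = - f x"
  by (metis add_hom_add add_hom_zero add.left_inverse eq_neg_iff_add_eq_0)

lemma add_hom_diff: "add_hom f \<Longrightarrow> f (x - y) = f x - f y"
  by (simp add: add_hom_add add_hom_minus diff_conv_add_uminus del: add_uminus_conv_diff)

lemmas add_hom_simps = add_hom_add add_hom_zero add_hom_minus add_hom_diff

lemma add_hom_id [simp]: "add_hom id" "add_hom (\<lambda>x. x)"
  by (simp_all add: add_hom_def)

lemma add_hom_comp: "add_hom f \<Longrightarrow> add_hom g \<Longrightarrow> add_hom (f \<circ> g)"
  by (simp add: add_hom_def)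

lemma add_hom_letter [simp]: "add_hom (letter i)"
  by (simp add: add_hom_def letter_add)

text \<open>Writing differences as sums with inverses and associating to the right proves word
  identities in a noncommutative group. The simp rule \<open>add_uminus_conv_diff\<close> works in
  the opposite direction and is removed wherever these are used.\<close>

lemmas add_normalize = diff_conv_add_uminus minus_add add.assoc

lemma add_hom_conj [simp]: "add_hom (\<lambda>x. g + x - g)"
  by (simp add: add_hom_def add_normalize del: add_uminus_conv_diff)

lemma add_hom_inv:
  assumes "add_hom f" "bij f" shows "add_hom (inv_into UNIV f)"
  unfolding add_hom_def
proof (intro allI)
  fix x y
  have "f (inv_into UNIV f x + inv_into UNIV f y) = x + y"
    using assms by (simp add: add_hom_add bij_is_surj surj_f_inv_f)
  then show "inv_into UNIV f (x + y) = inv_into UNIV f x + inv_into UNIV f y"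
    using assms(2) by (metis bij_is_inj inv_f_f)
qed

lemma letter_commute: "letter i (a::'a::ab_group_add) + letter i b = letter i b + letter i a"
  by (simp add: add.commute flip: letter_add)

lemma letter_conj_letter [simp]: "letter i (a::'a::ab_group_add) + letter i b - letter i a = letter i b"
  by (subst letter_commute) simp

definition fprod_ext :: "('i \<Rightarrow> 'a \<Rightarrow> 'b) \<Rightarrow> ('i, 'a::group_add) fprod \<Rightarrow> 'b::group_add" where
  "fprod_ext = fprod_lift additive_group"

lemma fprod_ext_letter: "(\<And>i. add_hom (f i)) \<Longrightarrow> fprod_ext f (letter i a) = f i a"
  unfolding fprod_ext_def by (rule fprod_lift_letter) (simp_all add: add_hom_iff)

lemma add_hom_fprod_ext: "(\<And>i. add_hom (f i)) \<Longrightarrow> add_hom (fprod_ext f)"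
  unfolding fprod_ext_def add_hom_iff by (rule fprod_lift_hom) simp_all

lemma add_hom_fprod_eqI:
  assumes "add_hom h" "add_hom k" "\<And>i a. h (letter i a) = k (letter i a)"
  shows "h = k"
proof
  fix x
  show "h x = k x"
    by (rule fprod_hom_eqI[OF group_additive_group assms(1,2)[unfolded add_hom_iff] assms(3)])
qed

text \<open>Bijections of a whole type, so that the product is plain composition and equality is
  pointwise; \<open>transport\<close> later relates this group to the extensional maps of
  \<open>AutoGroup\<close>.\<close>

definition aut_group :: "('g::group_add \<Rightarrow> 'g) monoid" where
  "aut_group = \<lparr>carrier = {f. bij f \<and> add_hom f}, monoid.mult = (\<circ>), one = id\<rparr>"

lemma carrier_aut_group: "f \<in> carrier aut_group \<longleftrightarrow> bij f \<and> add_hom f"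
  and mult_aut_group [simp]: "monoid.mult aut_group = (\<circ>)"
  and one_aut_group [simp]: "one aut_group = id"
  by (simp_all add: aut_group_def)

lemma group_aut_group [simp]: "group aut_group"
proof (rule groupI, goal_cases)
  case (5 f)
  then have "inv_into UNIV f \<in> carrier aut_group"
    by (simp add: carrier_aut_group add_hom_inv bij_imp_bij_inv)
  moreover have "inv_into UNIV f \<circ> f = id"
    using 5 by (simp add: carrier_aut_group bij_is_inj)
  ultimately show ?case by auto
qed (auto simp: carrier_aut_group add_hom_comp bij_comp comp_assoc)

lemma inv_aut_group: "f \<in> carrier aut_group \<Longrightarrow> inv\<^bsub>aut_group\<^esub> f = inv_into UNIV f"
  by (rule group.inv_equality)
    (auto simp: carrier_aut_group add_hom_inv bij_imp_bij_inv bij_is_inj)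

lemma aut_groupI:
  assumes "add_hom f" "add_hom g" "f \<circ> g = id" "g \<circ> f = id"
  shows "f \<in> carrier aut_group"
  using assms by (simp add: carrier_aut_group o_bij)

section \<open>Pure conjugating automorphisms\<close>

definition pure_conj :: "(('i, 'a::group_add) fprod \<Rightarrow> ('i, 'a) fprod) set" where
  "pure_conj = {\<phi> \<in> carrier aut_group. \<forall>i. \<exists>g. \<forall>a. \<phi> (letter i a) = g + letter i a - g}"

text \<open>For arbitrary \<open>c\<close> this is in general only an endomorphism. It is invertible
  when \<open>c\<close> is a letter of a factor outside \<open>J\<close>, because \<open>c\<close>
  is then fixed by the map.\<close>

definition pconj :: "('i, 'a::group_add) fprod \<Rightarrow> 'i set \<Rightarrow> ('i, 'a) fprod \<Rightarrow> ('i, 'a) fprod" where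
  "pconj c J = fprod_ext (\<lambda>i a. if i \<in> J then c + letter i a - c else letter i a)"

lemma pconj_letter: "pconj c J (letter i a) = (if i \<in> J then c + letter i a - c else letter i a)"
  unfolding pconj_def by (rule fprod_ext_letter) (auto simp: add_hom_def letter_add add_hom_add[OF add_hom_conj])

lemma add_hom_pconj [simp]: "add_hom (pconj c J)"
  unfolding pconj_def by (rule add_hom_fprod_ext) (auto simp: add_hom_def letter_add add_hom_add[OF add_hom_conj])

lemma pconj_zero [simp]: "pconj 0 J = id"
  by (rule add_hom_fprod_eqI) (auto simp: pconj_letter)

lemma pconj_add:
  fixes a b :: "'a::ab_group_add"
  assumes "j \<notin> J"
  shows "pconj (letter j (a + b)) J = pconj (letter j a) J \<circ> pconj (letter j b) J"
proof (rule add_hom_fprod_eqI)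
  \<comment> \<open>The outer map fixes the letter \<open>b\<close>, so the composite conjugates by
    \<open>letter j b + letter j a\<close>; commutativity of the factor restores the order.\<close>
  have ab: "letter j (a + b) = letter j b + letter j a" by (subst letter_commute) (rule letter_add)
  show "pconj (letter j (a + b)) J (letter i x) = (pconj (letter j a) J \<circ> pconj (letter j b) J) (letter i x)" for i x
    using assms by (auto simp: pconj_letter add_hom_simps[OF add_hom_pconj] ab)
      (simp add: add_normalize del: add_uminus_conv_diff)
qed (auto intro: add_hom_comp)

lemma pconj_aut:
  fixes a :: "'a::ab_group_add"
  assumes "j \<notin> J" shows "pconj (letter j a) J \<in> carrier aut_group"
  by (rule aut_groupI[of _ "pconj (letter j (- a)) J"]) (simp_all flip: pconj_add[OF assms])

lemma pconj_hom: "j \<notin> J \<Longrightarrow> (\<lambda>a::'a::ab_group_add. pconj (letter j a) J) \<in> hom additive_group aut_group"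
  by (rule homI) (simp_all add: pconj_aut pconj_add)

text \<open>The conditions on \<open>g\<close> make \<open>- g i + g j\<close> start outside the factor \<open>i\<close> and end outside the factor \<open>j\<close>, so
  that none of the letters of \<open>x\<close> is cancelled in the word of \<open>\<phi> x\<close>.\<close>

lemma conjugates_no_cancellation:
  assumes \<phi>: "add_hom \<phi>" "\<And>i a. \<phi> (letter i a) = g i + letter i a - g i"
    and g: "\<And>i. \<not> ends i (g i)" "\<And>i j. i \<noteq> j \<Longrightarrow> \<not> starts i (- g i + g j)"
    and "starts i x"
  shows "\<exists>z. \<phi> x = g i + z \<and> starts i z \<and> len x \<le> len z"
  using \<open>starts i x\<close>
proof (induction x arbitrary: i rule: fprod_induct)
  case (letter k a y)
  have [simp]: "k = i" using letter.prems letter_reduced_add(2)[OF letter.hyps] by simp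
  show ?case
  proof (cases "y = 0")
    case True
    have "\<not> starts i (- g i)" using g by simp
    from letter_reduced_add[OF letter.hyps(1) this]
    show ?thesis using True by (intro exI[of _ "letter i a - g i"]) (simp add: \<phi> add_diff_eq len_letter letter.hyps)
  next
    case False
    then obtain j where j: "starts j y" using ex_starts by blast
    with letter.hyps have ij: "i \<noteq> j" by auto
    from letter.IH[OF j] obtain z where z: "\<phi> y = g j + z" "starts j z" "len y \<le> len z" by blast
    define r where "r = - g i + g j"
    have "\<not> starts j (- g j + g i)" using ij by (intro g) simp
    moreover have "- g j + g i = - r" by (simp add: r_def minus_add)
    ultimately have "\<not> ends j r" by simp
    then have rz: "\<nexists>k. ends k r \<and> starts k z" using z(2) starts_unique by metis
    have "\<not> starts i (r + z)"
      using g(2)[OF ij] ij z(2) by (auto dest: starts_unique simp: reduced_add(2)[OF rz] simp flip: r_def)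
    note * = letter_reduced_add[OF letter.hyps(1) this]
    have "\<phi> (letter k a + y) = g i + (letter i a + (r + z))"
      by (simp add: add_hom_add[OF \<phi>(1)] \<phi>(2) z(1) r_def add.assoc diff_conv_add_uminus del: add_uminus_conv_diff)
    moreover have "len (letter k a + y) \<le> len (letter i a + (r + z))"
      using letter_reduced_add(1)[OF letter.hyps] z(3) by (simp add: *(1) reduced_add(1)[OF rz])
    ultimately show ?thesis using *(2) by blast
  qed
qed simp

text \<open>Apply the absence of cancellation to a preimage of a single letter of the factor
  \<open>k\<close>: the image has length \<open>len (g i) + len z = 1\<close> with \<open>z\<close>
  nonzero, which leaves no room for \<open>g i\<close> and forces \<open>i = k\<close>.\<close>

lemma conjugates_trivial:
  assumes \<phi>: "add_hom \<phi>" "surj \<phi>" "\<And>i a. \<phi> (letter i a) = g i + letter i a - g i"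
    and g: "\<And>i. \<not> ends i (g i)" "\<And>i j. i \<noteq> j \<Longrightarrow> \<not> starts i (- g i + g j)"
    and a: "(a::'a::group_add) \<noteq> 0"
  shows "g k = (0 :: ('i, 'a) fprod)"
proof -
  obtain x where x: "\<phi> x = letter k a" using \<phi>(2) by (metis surjD)
  with a have "x \<noteq> 0" using add_hom_zero[OF \<phi>(1)] by auto
  then obtain i where i: "starts i x" using ex_starts by blast
  obtain z where z: "\<phi> x = g i + z" "starts i z" "len x \<le> len z"
    using conjugates_no_cancellation[OF \<phi>(1,3) g i] by blast
  have r: "\<nexists>k. ends k (g i) \<and> starts k z" using g(1) z(2) starts_unique by metis
  have "len (g i) + len z = 1"
    using reduced_add(1)[OF r] a x z(1) by (simp add: len_letter)
  moreover have "0 < len z" using z(2) by (auto simp flip: len_eq_zero_iff simp: starts_def len_def)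
  ultimately have "len (g i) = 0" by linarith
  then have "g i = 0" by simp
  with x z i have "starts i (letter k a)" by simp
  with \<open>g i = 0\<close> show ?thesis by (simp add: starts_letter)
qed

lemma pure_conj_generated:
  fixes \<phi> :: "('i::finite, 'a::ab_group_add) fprod \<Rightarrow> ('i, 'a) fprod"
  assumes "\<phi> \<in> carrier aut_group" "\<And>i a. \<phi> (letter i a) = g i + letter i a - g i"
    and "\<exists>a::'a. a \<noteq> 0"
  shows "\<phi> \<in> generate aut_group {pconj (letter i a) {j} | i a j. i \<noteq> j}"
  using assms(1,2)
proof (induction "\<Sum>i\<in>UNIV. len (g i)" arbitrary: g \<phi> rule: less_induct)
  case less
  have \<phi>: "add_hom \<phi>" "bij \<phi>" using less.prems by (auto simp: carrier_aut_group)
  have sum_less: "(\<Sum>i\<in>UNIV. len ((g(j := y)) i)) < (\<Sum>i\<in>UNIV. len (g i))" if "len y < len (g j)" for j y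
    using that by (intro sum_strict_mono_ex1) auto
  consider (ending) i where "ends i (g i)"
    | (starting) i j where "i \<noteq> j" "\<not> ends i (g i)" "starts i (- g i + g j)"
    | (none) "\<And>i. \<not> ends i (g i)" "\<And>i j. i \<noteq> j \<Longrightarrow> \<not> starts i (- g i + g j)"
    by blast
  then show ?case
  proof cases
    case ending
    obtain a y where y: "g i = y + letter i a" "len (g i) = len y + (if a = 0 then 0 else 1)"
        "a = 0 \<longleftrightarrow> \<not> ends i (g i)" by (rule ends_decomp)
    have "len y < len (g i)" using y ending by simp
    \<comment> \<open>The factor is abelian, so \<open>letter i a\<close> commutes with the letter
      that it conjugates.\<close>
    moreover have "y + letter i a + letter i b - (y + letter i a) = y + letter i b - y" for b
    proof -
      have "y + letter i a + letter i b - (y + letter i a) = y + (letter i a + letter i b - letter i a) - y"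
        by (simp add: add_normalize del: add_uminus_conv_diff letter_conj_letter)
      then show ?thesis by simp
    qed
    ultimately show ?thesis
      using less.prems by (intro less.hyps[of "g(i := y)"] sum_less) (auto simp: y(1))
  next
    case starting
    obtain a y where y: "- g i + g j = letter i a + y" "\<not> starts i y"
        "a = 0 \<longleftrightarrow> \<not> starts i (- g i + g j)" by (rule starts_decomp)
    with starting have a: "a \<noteq> 0" by simp
    have gj: "g j = g i + (letter i a + y)" using y(1) by (metis add_minus_cancel)
    note * = letter_reduced_add[OF a y(2)]
    have r: "\<nexists>k. ends k (g i) \<and> starts k (letter i a + y)"
      using starting(2) by (simp add: *(2))
    have "len (g i + y) < len (g j)"
      using len_add_le[of "g i" y] by (simp add: gj reduced_add(1)[OF r] *(1))
    let ?p = "\<lambda>a::'a. pconj (letter i a) {j}"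
    \<comment> \<open>Precomposing with this partial conjugation multiplies \<open>g j\<close> on
      the left by \<open>\<phi> (letter i (- a))\<close>, which is
      \<open>g i + letter i (- a) - g i\<close>; the letter \<open>a\<close> inside
      \<open>g j = g i + (letter i a + y)\<close> disappears.\<close>
    define \<psi> where "\<psi> = \<phi> \<circ> ?p (- a)"
    have p: "?p b \<in> carrier aut_group" for b using starting(1) by (intro pconj_aut) simp
    have \<phi>\<psi>: "\<phi> = \<psi> \<circ> ?p a"
      using starting(1) by (simp add: \<psi>_def comp_assoc flip: pconj_add)
    have "\<psi> \<in> carrier aut_group"
      using monoid.m_closed[OF group.is_monoid[OF group_aut_group] less.prems(1) p] by (simp add: \<psi>_def)
    moreover have "\<psi> (letter k b) = (g(j := g i + y)) k + letter k b - (g(j := g i + y)) k" for k b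
    proof (cases "k = j")
      case True
      have "\<phi> (letter i (- a)) + g j = g i + y"
        unfolding less.prems(2) by (simp add: gj letter_minus add_normalize del: add_uminus_conv_diff)
      then have "\<phi> (letter i (- a)) = g i + y - g j" by (metis add_diff_cancel)
      then show ?thesis
        by (simp add: True \<psi>_def pconj_letter add_hom_simps[OF \<phi>(1)] less.prems(2))
          (simp add: add_normalize del: add_uminus_conv_diff)
    next
      case False
      then show ?thesis by (simp add: \<psi>_def pconj_letter less.prems)
    qed
    ultimately have "\<psi> \<in> generate aut_group {pconj (letter i a) {j} | i a j. i \<noteq> j}"
      by (rule less.hyps[OF sum_less[OF \<open>len (g i + y) < len (g j)\<close>]])
    moreover have "?p a \<in> generate aut_group {pconj (letter i a) {j} | i a j. i \<noteq> j}"
      using starting(1) by (intro generate.incl) blast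
    ultimately show ?thesis
      unfolding \<phi>\<psi> using generate.eng[of \<psi> aut_group _ "?p a"] by simp
  next
    case none
    obtain a :: 'a where "a \<noteq> 0" using assms(3) by blast
    then have "g i = 0" for i
      using conjugates_trivial[OF \<phi>(1) bij_is_surj[OF \<phi>(2)] less.prems(2) none] by blast
    then have "\<phi> = id"
      by (intro add_hom_fprod_eqI) (simp_all add: \<phi> less.prems(2))
    then show ?thesis using generate.one[of aut_group] by simp
  qed
qed

section \<open>Commuting elements\<close>

definition nmul :: "nat \<Rightarrow> 'a::monoid_add \<Rightarrow> 'a" where
  "nmul n x = ((+) x ^^ n) 0"

lemma nmul_0 [simp]: "nmul 0 x = 0"
  and nmul_Suc: "nmul (Suc n) x = x + nmul n x"
  by (simp_all add: nmul_def)

lemma nmul_add: "nmul (m + n) x = nmul m x + nmul n x"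
  by (induction m) (simp_all add: nmul_Suc add.assoc)

lemma nmul_commute:
  fixes x y :: "'a::monoid_add"
  assumes "x + y = y + x" shows "nmul m x + nmul n y = nmul n y + nmul m x"
proof -
  have 1: "x + nmul n y = nmul n y + x"
  proof (induction n)
    case (Suc n)
    have "x + nmul (Suc n) y = y + (x + nmul n y)"
      by (simp add: nmul_Suc assms flip: add.assoc)
    then show ?case by (simp add: Suc nmul_Suc add.assoc)
  qed simp
  show ?thesis
  proof (induction m)
    case (Suc m)
    have "nmul (Suc m) x + nmul n y = x + (nmul n y + nmul m x)"
      by (simp add: nmul_Suc add.assoc Suc)
    then show ?case by (simp add: nmul_Suc 1 flip: add.assoc)
  qed simp
qed

lemma add_hom_nmul: "add_hom f \<Longrightarrow> f (nmul n x) = nmul n (f x)"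
  by (induction n) (simp_all add: nmul_Suc add_hom_zero add_hom_add)

text \<open>A letter added on the left can consume or replace only the first letter of a word, so
  \<open>x\<close> reaches at most the first \<open>len x\<close> letters of
  \<open>y\<close>.\<close>

lemma word_of_add_drop: "\<exists>u. word_of (x + y) = u @ drop (len x) (word_of y)"
proof -
  have "\<exists>u. foldr mcons w v = u @ drop (length w) v" for w v :: "('a \<times> 'b) list"
  proof (induction w)
    case (Cons l w)
    then obtain u where u: "foldr mcons w v = u @ drop (length w) v" by blast
    have K: "\<exists>t. mcons l (a # z) = t @ z" for a and z :: "('a \<times> 'b) list"
    proof -
      have "\<exists>b. mcons l (a # z) = [] @ z \<or> mcons l (a # z) = [b] @ z \<or> mcons l (a # z) = [l, a] @ z"
        by (auto simp: mcons_def)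
      then show ?thesis by blast
    qed
    show ?case
    proof (cases u)
      case (Cons a u')
      obtain t where "mcons l (u @ drop (length w) v) = t @ drop (length w) v"
        using K[of a "u' @ drop (length w) v"] Cons by auto
      moreover have "drop (length w) v = take 1 (drop (length w) v) @ drop (Suc (length w)) v"
        by (metis append_take_drop_id drop_drop plus_1_eq_Suc)
      ultimately show ?thesis using u by (metis append.assoc foldr.simps(2) length_Cons comp_apply)
    next
      case Nil
      show ?thesis
      proof (cases "drop (length w) v")
        case (Cons a z)
        then have "drop (Suc (length w)) v = z" by (metis drop_Suc drop_tl list.sel(3))
        then show ?thesis
          using K[of a z] by (simp add: u Nil Cons)
      next
        case Nil': Nil
        then show ?thesis by (auto simp: u Nil)
      qed
    qed
  qed simp
  then show ?thesis by (simp add: plus_fprod.rep_eq len_def)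
qed

text \<open>The mirror image of \<open>word_of_add_drop\<close>, obtained by inverting the
  sum.\<close>

lemma word_of_add_take: "\<exists>u. word_of (x + y) = take (len x - len y) (word_of x) @ u"
proof -
  let ?n = "\<lambda>w :: ('a \<times> 'b) list. rev (map (\<lambda>(i, a). (i, - a)) w)"
  have nn: "?n (?n w) = w" for w by (simp add: rev_map comp_def case_prod_unfold)
  obtain u where u: "word_of (- y + - x) = u @ drop (len y) (word_of (- x))"
    using word_of_add_drop[of "- y" "- x"] by auto
  have "word_of (x + y) = ?n (word_of (- y + - x))"
    by (metis minus_add minus_minus uminus_fprod.rep_eq)
  also have "\<dots> = ?n (drop (len y) (?n (word_of x))) @ ?n u"
    unfolding u by (simp add: uminus_fprod.rep_eq)
  also have "?n (drop (len y) (?n (word_of x))) = take (len x - len y) (word_of x)"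
    by (simp add: drop_rev drop_map len_def take_map nn rev_map comp_def case_prod_unfold)
  finally show ?thesis by blast
qed

lemma add_eqI_word_of: "word_of z = word_of x @ word_of y \<Longrightarrow> z = x + y"
  by (metis reduced_word_of foldr_mcons_append plus_fprod.rep_eq word_of_inject)

context
  fixes a :: "('i, 'a::group_add) fprod" and i j :: 'i
  assumes a: "starts i a" "ends j a" "i \<noteq> j"
begin

lemma nmul_reduced: "(\<forall>k. starts k (nmul n a) \<longrightarrow> k = i) \<and> word_of (nmul n a) = concat (replicate n (word_of a))"
proof (induction n)
  case (Suc n)
  have r: "\<nexists>k. ends k a \<and> starts k (nmul n a)"
    using Suc.IH a ends_unique by metis
  have "a \<noteq> 0" using a(1) by auto
  then show ?case
    using a Suc.IH by (auto simp: nmul_Suc reduced_add(2)[OF r] word_of_add[OF r] dest: starts_unique)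
qed (simp add: zero_fprod.rep_eq)

lemmas starts_nmul = nmul_reduced[THEN conjunct1, rule_format]
  and word_of_nmul = nmul_reduced[THEN conjunct2]

lemma len_nmul: "len (nmul n a) = n * len a"
  by (simp add: len_def word_of_nmul length_concat sum_list_replicate)

lemma len_pos: "0 < len a"
  using a(1) by (simp add: len_def starts_def)

lemma ends_nmul: "0 < n \<Longrightarrow> ends j (nmul n a)"
proof (induction n)
  case (Suc n)
  have r: "\<nexists>k. ends k a \<and> starts k (nmul n a)"
    using starts_nmul a ends_unique by metis
  show ?case using Suc a by (cases "n = 0") (auto simp: nmul_Suc reduced_add(3)[OF r])
qed simp

text \<open>Adding a high multiple of \<open>a\<close> to \<open>nmul n y\<close> gives a word that is not affected by adding further
  multiples of \<open>a\<close> on the right. As it commutes with them, it is a prefix of a power of \<open>a\<close>.\<close>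

lemma commuting_prefix:
  assumes "a + y = y + a"
  shows "\<exists>m q r. r < len a \<and> nmul n y + nmul m a = nmul q a + Abs_fprod (take r (word_of a))"
proof -
  \<comment> \<open>With \<open>m\<close> larger than the length of \<open>nmul n y\<close>, the
    last letter of \<open>nmul m a\<close> survives in \<open>z\<close>. So \<open>z\<close> ends in
    the factor \<open>j\<close>, and multiples of \<open>a\<close> can be appended without
    cancellation.\<close>
  define m where "m = Suc (len (nmul n y))"
  define z where "z = nmul n y + nmul m a"
  \<comment> \<open>This \<open>N\<close> makes \<open>nmul N a\<close> at least twice as long as
    \<open>z\<close>, so that adding \<open>z\<close> on its right cannot disturb its first
    \<open>len z\<close> letters.\<close>
  define N where "N = Suc (2 * len z)"
  have le: "t \<le> t * len a" for t using len_pos by simp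
  have comm: "nmul k a + z = z + nmul k a" for k
  proof -
    have "nmul k a + (nmul n y + nmul m a) = nmul n y + (nmul k a + nmul m a)"
      using nmul_commute[OF assms, of k n] by (simp flip: add.assoc)
    then show ?thesis by (simp add: z_def add.assoc add.commute flip: nmul_add)
  qed
  obtain u where u: "word_of z = u @ drop (len (nmul n y)) (word_of (nmul m a))"
    using word_of_add_drop unfolding z_def by blast
  have "length (word_of (nmul m a)) = m * len a" using len_nmul by (simp add: len_def)
  then have "len (nmul n y) < length (word_of (nmul m a))"
    using le[of m] by (simp add: m_def)
  moreover have "ends j (nmul m a)" by (rule ends_nmul) (simp add: m_def)
  ultimately have "ends j z" by (simp add: ends_def u)
  then have "\<nexists>k. ends k z \<and> starts k (nmul N a)"
    using starts_nmul a(3) ends_unique by metis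
  then have w1: "word_of (z + nmul N a) = word_of z @ word_of (nmul N a)"
    by (rule word_of_add)
  obtain v where w2: "word_of (nmul N a + z) = take (len (nmul N a) - len z) (word_of (nmul N a)) @ v"
    using word_of_add_take by blast
  define t where "t = len (nmul N a) - len z"
  have t: "len z \<le> t" "t \<le> length (word_of (nmul N a))"
    using le[of N] by (simp_all add: t_def len_nmul N_def len_def[symmetric])
  \<comment> \<open>Compare the first \<open>len z\<close> letters of \<open>z + nmul N a\<close>
    and \<open>nmul N a + z\<close>, which are equal elements.\<close>
  have "word_of z = take (len z) (word_of z @ word_of (nmul N a))" by (simp add: len_def)
  also have "\<dots> = take (len z) (take t (word_of (nmul N a)) @ v)"
    using w1 w2 by (simp add: comm t_def)
  also have "\<dots> = take (len z) (word_of (nmul N a))" using t by (simp add: min_def)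
  finally have z: "word_of z = take (len z) (word_of (nmul N a))" .
  define q r where "q = len z div len a" and "r = len z mod len a"
  have qr: "len z = q * len a + r" "r < len a" using len_pos by (simp_all add: q_def r_def)
  have "q \<le> len z" by (simp add: q_def)
  then obtain p where p: "N = q + Suc p" by (metis N_def add_Suc_right less_iff_Suc_add mult_2 trans_le_add1 le_imp_less_Suc)
  have "word_of z = word_of (nmul q a) @ take r (word_of (nmul (Suc p) a))"
  proof -
    have "length (word_of (nmul q a)) = q * len a" using len_nmul by (simp add: len_def)
    moreover have "word_of (nmul N a) = word_of (nmul q a) @ word_of (nmul (Suc p) a)"
      by (simp only: word_of_nmul p replicate_add concat_append)
    ultimately show ?thesis using z by (simp add: qr(1))
  qed
  also have "take r (word_of (nmul (Suc p) a)) = take r (word_of a)"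
    using qr(2) by (simp add: word_of_nmul len_def)
  also have "take r (word_of a) = word_of (Abs_fprod (take r (word_of a)))"
    using reduced_word_of[of a] by (metis Abs_fprod_inverse append_take_drop_id mem_Collect_eq reduced_append)
  finally have "z = nmul q a + Abs_fprod (take r (word_of a))" by (rule add_eqI_word_of)
  with qr(2) show ?thesis unfolding z_def by blast
qed

text \<open>Pigeonhole: the remainders \<open>r n\<close> in \<open>commuting_prefix\<close> take
  finitely many values, so two multiples of \<open>y\<close> leave the same tail, and comparing them
  eliminates it. Having multiples of \<open>a\<close> on both sides avoids negative multiples. This
  is the form in which the centralizer of \<open>a\<close> is virtually cyclic.\<close>

lemma commuting_power_relation:
  assumes "a + y = y + a"
  shows "\<exists>d k l. 0 < d \<and> nmul d y + nmul k a = nmul l a"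
proof -
  obtain m q r where mqr: "\<And>n. r n < len a"
      "\<And>n. nmul n y + nmul (m n) a = nmul (q n) a + Abs_fprod (take (r n) (word_of a))"
    using commuting_prefix[OF assms] by metis
  have "finite (range r)" by (rule finite_subset[of _ "{..<len a}"]) (use mqr in auto)
  then have "\<not> inj r" using finite_imageD infinite_UNIV_nat by blast
  then obtain n n' where nn: "n < n'" "r n = r n'" by (metis injI linorder_neqE_nat)
  then obtain d where d: "n' = n + d" "0 < d" by (metis less_imp_add_positive)
  define p where "p = Abs_fprod (take (r n) (word_of a))"
  have e1: "nmul n y + nmul (m n) a = nmul (q n) a + p"
    and e2: "nmul (n + d) y + nmul (m n') a = nmul (q n') a + p"
    using mqr(2)[of n] mqr(2)[of n'] by (simp_all add: p_def nn(2) d(1))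
  note comm = nmul_commute[OF assms, symmetric]
  have "nmul n y + (nmul d y + nmul (q n + m n') a) = nmul (n + d) y + nmul (q n) a + nmul (m n') a"
    by (simp add: nmul_add add.assoc)
  also have "\<dots> = nmul (q n) a + (nmul (n + d) y + nmul (m n') a)"
    by (simp only: comm[of "n + d" "q n"] add.assoc)
  also have "\<dots> = nmul (q n + q n') a + p"
    by (simp only: e2 nmul_add[of "q n"] add.assoc)
  also have "\<dots> = nmul (q n') a + (nmul (q n) a + p)"
    by (simp add: nmul_add add.assoc add.commute[of "q n"])
  also have "\<dots> = nmul (q n') a + nmul n y + nmul (m n) a"
    by (simp add: add.assoc flip: e1)
  also have "\<dots> = nmul n y + nmul (q n' + m n) a"
    by (simp only: comm[of n "q n'", symmetric] nmul_add add.assoc)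
  finally have "nmul d y + nmul (q n + m n') a = nmul (q n' + m n) a"
    by (simp only: add_left_cancel)
  then show ?thesis using d(2) by blast
qed

end

text \<open>While the first and last letters lie in the same factor, conjugation carries the first
  one to the end, where the two merge. The last alternative is exactly the hypothesis of
  \<open>commuting_power_relation\<close>; the others are the elements conjugate into a
  factor.\<close>

lemma cyclic_reduction:
  fixes x :: "('i, 'a::group_add) fprod"
  obtains c y where "x = c + y - c"
    "y = 0 \<or> (\<exists>i a. y = letter i a) \<or> (\<exists>i j. i \<noteq> j \<and> starts i y \<and> ends j y)"
proof -
  have "\<exists>c y. x = c + y - c \<and>
    (y = 0 \<or> (\<exists>i a. y = letter i a) \<or> (\<exists>i j. i \<noteq> j \<and> starts i y \<and> ends j y))"
  proof (induction "len x" arbitrary: x rule: less_induct)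
    case less
    show ?case
    proof (cases "x = 0")
      case False
      then obtain i j where ij: "starts i x" "ends j x" using ex_starts ex_ends by metis
      show ?thesis
      proof (cases "i = j")
        case True
        obtain a y where y: "x = letter i a + y" "\<not> starts i y" "len x = len y + (if a = 0 then 0 else 1)"
          "a = 0 \<longleftrightarrow> \<not> starts i x" by (rule starts_decomp)
        with ij have a: "a \<noteq> 0" by simp
        show ?thesis
        proof (cases "y = 0")
          case True
          then show ?thesis using y by (intro exI[of _ 0] exI[of _ x]) auto
        next
          case False
          have "ends i y" using ij True False letter_reduced_add(3)[OF a y(2)] by (simp add: y(1))
          obtain b z where z: "y = z + letter i b" "len y = len z + (if b = 0 then 0 else 1)"
            "b = 0 \<longleftrightarrow> \<not> ends i y" by (rule ends_decomp)
          \<comment> \<open>The conjugate of \<open>x\<close> in which the first letter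
            \<open>a\<close> has been moved behind the last letter \<open>b\<close>.\<close>
          have "len (z + letter i (b + a)) < len x"
            using len_add_le[of z "letter i (b + a)"] y z a \<open>ends i y\<close> by (auto simp: len_letter split: if_splits)
          from less[OF this] obtain c t where ct: "z + letter i (b + a) = c + t - c"
            "t = 0 \<or> (\<exists>i a. t = letter i a) \<or> (\<exists>i j. i \<noteq> j \<and> starts i t \<and> ends j t)" by blast
          have "x = letter i a + (z + letter i (b + a)) - letter i a"
            by (simp add: y z letter_add add_normalize del: add_uminus_conv_diff)
          also have "\<dots> = letter i a + c + t - (letter i a + c)"
            unfolding ct(1) by (simp add: add_normalize del: add_uminus_conv_diff)
          finally show ?thesis using ct(2) by blast
        qed
      next
        case False
        then show ?thesis using ij by (intro exI[of _ 0] exI[of _ x]) auto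
      qed
    qed (auto intro!: exI[of _ 0])
  qed
  then show thesis using that by blast
qed

text \<open>Factors are malnormal and contain the centralizers of their nonzero elements. A last
  letter of \<open>g\<close> in the factor \<open>i\<close> acts trivially; for the remaining part
  \<open>y\<close>, the conjugate has length \<open>2 * len y + 1\<close>, so \<open>y\<close> must
  vanish.\<close>

lemma conj_letter_eq_letter:
  fixes a b :: "'a::ab_group_add"
  assumes "letter j b = g + letter i a - g" "a \<noteq> 0"
  shows "i = j" "b = a" "\<exists>c. g = letter i c"
proof -
  obtain c y where y: "g = y + letter i c" "\<not> ends i y" by (rule ends_decomp)
  have "g + letter i a - g = y + (letter i c + letter i a - letter i c) - y"
    by (simp add: y(1) add_normalize del: add_uminus_conv_diff letter_conj_letter)
  then have eq: "letter j b = y + (letter i a + - y)"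
    by (simp add: assms(1) add_diff_eq)
  have 1: "\<not> starts i (- y)" using y(2) by simp
  note * = letter_reduced_add[OF assms(2) 1]
  have r: "\<nexists>k. ends k y \<and> starts k (letter i a + - y)"
    using y(2) by (simp add: * del: add_uminus_conv_diff)
  have "len (letter j b) = Suc (2 * len y)"
    using reduced_add(1)[OF r] *(1) by (simp add: eq del: add_uminus_conv_diff)
  then have "y = 0" by (simp add: len_letter split: if_splits)
  with eq y(1) assms(2) show "i = j" "b = a" "\<exists>c. g = letter i c"
    by (auto simp: letter_eq_iff)
qed

text \<open>Conjugating back by \<open>c\<close> reduces this to the centralizer of a letter, which
  \<open>conj_letter_eq_letter\<close> describes.\<close>

lemma commutes_conj_letter:
  fixes a :: "'a::ab_group_add"
  assumes "x + (c + letter i a - c) = (c + letter i a - c) + x" "a \<noteq> 0"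
  shows "\<exists>b. x = c + letter i b - c"
proof -
  define z where "z = - c + x + c"
  have x: "x = c + z - c" by (simp add: z_def add_normalize del: add_uminus_conv_diff)
  have "c + (z + letter i a) - c = c + (letter i a + z) - c"
    using assms(1) unfolding x by (simp add: add_normalize del: add_uminus_conv_diff)
  then have "z + letter i a = letter i a + z" by (metis add_left_cancel diff_add_cancel)
  then have "letter i a = z + letter i a - z" by simp
  from conj_letter_eq_letter(3)[OF this assms(2)] show ?thesis using x by blast
qed

text \<open>If the image of \<open>letter i u\<close> were not conjugate into a factor, the
  commuting image of \<open>letter i v\<close> would satisfy a power relation with it. Injectivity
  pulls this relation back to \<open>u\<close> and \<open>v\<close>, where it is excluded.\<close>

lemma aut_letter_conjugate:
  fixes \<phi> :: "('i, 'a::ab_group_add) fprod \<Rightarrow> ('i, 'a) fprod"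
  assumes "\<phi> \<in> carrier aut_group" "u \<noteq> 0"
    and "\<And>d k l. 0 < d \<Longrightarrow> nmul d v + nmul k u \<noteq> nmul l u"
  shows "\<exists>c j w. \<phi> (letter i u) = c + letter j w - c"
proof -
  have \<phi>: "add_hom \<phi>" "inj \<phi>" using assms(1) by (auto simp: carrier_aut_group bij_is_inj)
  obtain c y where y: "\<phi> (letter i u) = c + y - c"
    "y = 0 \<or> (\<exists>i a. y = letter i a) \<or> (\<exists>i j. i \<noteq> j \<and> starts i y \<and> ends j y)"
    by (rule cyclic_reduction)
  have False if ij: "k \<noteq> l" "starts k y" "ends l y" for k l
  proof -
    \<comment> \<open>The automorphism followed by the conjugation that makes the image of
      \<open>letter i u\<close> cyclically reduced.\<close>
    define h where "h x = - c + \<phi> x + c" for x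
    have h: "add_hom h"
      by (simp add: add_hom_def h_def add_hom_add[OF \<phi>(1)] add_normalize del: add_uminus_conv_diff)
    have hy: "h (letter i u) = y"
      unfolding h_def y(1) by (simp add: add_normalize del: add_uminus_conv_diff)
    have "y + h (letter i v) = h (letter i v) + y"
      unfolding hy[symmetric] add_hom_add[OF h, symmetric] by (subst letter_commute) simp
    then obtain d m n where d: "0 < d" "nmul d (h (letter i v)) + nmul m y = nmul n y"
      using commuting_power_relation[OF ij(2,3,1)] by blast
    then have "h (letter i (nmul d v + nmul m u)) = h (letter i (nmul n u))"
      by (simp add: hy add_hom_nmul[OF h] add_hom_nmul[OF add_hom_letter] add_hom_add[OF h] letter_add)
    then have "\<phi> (letter i (nmul d v + nmul m u)) = \<phi> (letter i (nmul n u))"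
      by (simp add: h_def)
    with \<phi>(2) have "nmul d v + nmul m u = nmul n u"
      by (simp add: inj_eq letter_eq_iff)
    with assms(3)[OF d(1)] show False by blast
  qed
  with y show ?thesis by (metis letter_zero)
qed

section \<open>Automorphisms of a free product of copies of a group of rank two\<close>

definition fprod_map :: "('i \<Rightarrow> 'j) \<Rightarrow> ('i \<Rightarrow> 'a \<Rightarrow> 'b) \<Rightarrow> ('i, 'a::group_add) fprod \<Rightarrow> ('j, 'b::group_add) fprod" where
  "fprod_map s A = fprod_ext (\<lambda>i a. letter (s i) (A i a))"

lemma fprod_map_letter: "(\<And>i. add_hom (A i)) \<Longrightarrow> fprod_map s A (letter i a) = letter (s i) (A i a)"
  unfolding fprod_map_def by (rule fprod_ext_letter) (simp add: add_hom_def letter_add)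

lemma add_hom_fprod_map: "(\<And>i. add_hom (A i)) \<Longrightarrow> add_hom (fprod_map s A)"
  unfolding fprod_map_def by (rule add_hom_fprod_ext) (simp add: add_hom_def letter_add)

lemma fprod_map_comp:
  assumes "\<And>i. add_hom (A i)" "\<And>i. add_hom (B i)"
  shows "fprod_map s A \<circ> fprod_map t B = fprod_map (s \<circ> t) (\<lambda>i. A (t i) \<circ> B i)"
proof (rule add_hom_fprod_eqI)
  have AB: "add_hom (A (t i) \<circ> B i)" for i using assms by (intro add_hom_comp)
  show "add_hom (fprod_map s A \<circ> fprod_map t B)" "add_hom (fprod_map (s \<circ> t) (\<lambda>i. A (t i) \<circ> B i))"
    using assms AB by (simp_all add: add_hom_comp add_hom_fprod_map)
  show "(fprod_map s A \<circ> fprod_map t B) (letter i a) = fprod_map (s \<circ> t) (\<lambda>i. A (t i) \<circ> B i) (letter i a)" for i a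
    using assms AB by (simp add: fprod_map_letter)
qed

lemma fprod_map_id [simp]: "fprod_map id (\<lambda>_. id) = id"
  by (rule add_hom_fprod_eqI) (simp_all add: add_hom_fprod_map fprod_map_letter)

lemma fprod_map_inverse:
  assumes "bij s" "\<And>i. A i \<in> carrier aut_group"
  defines "t \<equiv> inv_into UNIV s" and "B \<equiv> \<lambda>j. inv_into UNIV (A (inv_into UNIV s j))"
  shows "fprod_map s A \<in> carrier aut_group" "inv\<^bsub>aut_group\<^esub> fprod_map s A = fprod_map t B"
    "bij t" "B j \<in> carrier aut_group"
proof -
  have A: "bij (A i)" "add_hom (A i)" for i using assms(2)[of i] by (auto simp: carrier_aut_group)
  show t: "bij t" using assms(1) by (simp add: t_def bij_imp_bij_inv)
  have Bc: "B j \<in> carrier aut_group" for j by (simp add: B_def A add_hom_inv carrier_aut_group bij_imp_bij_inv)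
  then show "B j \<in> carrier aut_group" .
  have B: "add_hom (B j)" for j using Bc by (simp add: carrier_aut_group)
  have st: "s \<circ> t = id" "t \<circ> s = id" "\<And>i. t (s i) = i"
    using assms(1) surj_iff[of s] by (simp_all add: t_def bij_is_inj bij_is_surj)
  have AB: "A (t j) \<circ> B j = id" "B (s i) \<circ> A i = id" for i j
    using A(1)[of "t j"] A(1)[of i] surj_iff[of "A (t j)"] st(3)[of i]
    by (simp_all add: B_def bij_is_inj bij_is_surj flip: t_def)
  have hom: "add_hom (fprod_map s A)" "add_hom (fprod_map t B)"
    using A B by (auto intro!: add_hom_fprod_map)
  have inv: "fprod_map s A \<circ> fprod_map t B = id" "fprod_map t B \<circ> fprod_map s A = id"
    by (simp_all add: fprod_map_comp[OF A(2) B] fprod_map_comp[OF B A(2)] st AB)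
  show *: "fprod_map s A \<in> carrier aut_group"
    using hom inv by (rule aut_groupI)
  have "fprod_map t B \<in> carrier aut_group"
    using hom(2,1) inv(2,1) by (rule aut_groupI)
  with * inv show "inv\<^bsub>aut_group\<^esub> fprod_map s A = fprod_map t B"
    by (intro group.inv_equality[OF group_aut_group]) simp_all
qed

lemmas fprod_map_aut = fprod_map_inverse(1)

definition factor_auts :: "(('i, 'a::group_add) fprod \<Rightarrow> ('i, 'a) fprod) set" where
  "factor_auts = {fprod_map s A | s A. bij s \<and> (\<forall>i. A i \<in> carrier aut_group)}"

lemma subgroup_factor_auts: "subgroup factor_auts aut_group"
proof (rule group.subgroupI[OF group_aut_group])
  show "factor_auts \<subseteq> carrier aut_group" by (auto simp: factor_auts_def intro: fprod_map_aut)
  have "fprod_map id (\<lambda>_. id) \<in> factor_auts"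
    unfolding factor_auts_def using group.is_monoid[OF group_aut_group, THEN monoid.one_closed] by force
  then show "factor_auts \<noteq> {}" by blast
next
  fix f :: "('a, 'b) fprod \<Rightarrow> ('a, 'b) fprod" assume "f \<in> factor_auts"
  then obtain s A where f: "f = fprod_map s A" "bij s" "\<And>i. A i \<in> carrier aut_group"
    unfolding factor_auts_def by blast
  show "inv\<^bsub>aut_group\<^esub> f \<in> factor_auts"
    unfolding f(1) fprod_map_inverse(2)[OF f(2,3)] factor_auts_def
    using fprod_map_inverse(3,4)[of s A, OF f(2,3)] by blast
next
  fix f g :: "('a, 'b) fprod \<Rightarrow> ('a, 'b) fprod" assume "f \<in> factor_auts" "g \<in> factor_auts"
  then obtain s A t B where "f = fprod_map s A" "bij s" "\<And>i. A i \<in> carrier aut_group"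
    "g = fprod_map t B" "bij t" "\<And>i. B i \<in> carrier aut_group"
    unfolding factor_auts_def by blast
  then show "f \<otimes>\<^bsub>aut_group\<^esub> g \<in> factor_auts"
    by (auto simp: factor_auts_def fprod_map_comp carrier_aut_group bij_comp add_hom_comp
        intro!: exI[of _ "s \<circ> t"] exI[of _ "\<lambda>i. A (t i) \<circ> B i"])
qed

lemma subgroup_pure_conj: "subgroup pure_conj aut_group"
proof (rule group.subgroupI[OF group_aut_group])
  show "pure_conj \<subseteq> carrier aut_group" by (auto simp: pure_conj_def)
  have "id \<in> pure_conj"
    using group.is_monoid[OF group_aut_group, THEN monoid.one_closed]
    by (auto simp: pure_conj_def intro: exI[of _ 0])
  then show "pure_conj \<noteq> {}" by blast
next
  fix f :: "('a, 'b) fprod \<Rightarrow> ('a, 'b) fprod" assume f: "f \<in> pure_conj"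
  then have f': "f \<in> carrier aut_group" "inj f" by (auto simp: pure_conj_def carrier_aut_group bij_is_inj)
  define h where "h = inv_into UNIV f"
  have hc: "h \<in> carrier aut_group"
    using f' group.inv_closed[OF group_aut_group f'(1)] by (simp add: inv_aut_group h_def)
  then have h: "add_hom h" by (simp add: carrier_aut_group)
  have hf: "h (f x) = x" for x using f'(2) by (simp add: h_def)
  have "\<exists>g. \<forall>a. h (letter i a) = g + letter i a - g" for i
  proof -
    obtain g where g: "\<And>a. f (letter i a) = g + letter i a - g" using f by (auto simp: pure_conj_def)
    have eq: "letter i a = h g + h (letter i a) - h g" for a
      using hf[of "letter i a"] by (simp add: g add_hom_simps[OF h])
    \<comment> \<open>Applying the inverse \<open>h\<close> to the formula for \<open>f\<close> and
      solving for \<open>h (letter i a)\<close> gives the conjugator \<open>- h g\<close>.\<close>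
    have "h (letter i a) = - h g + letter i a - (- h g)" for a
    proof -
      have "h (letter i a) = - h g + (h g + h (letter i a) - h g) - (- h g)"
        by (simp add: add_normalize del: add_uminus_conv_diff)
      then show ?thesis by (simp only: eq[symmetric])
    qed
    then show ?thesis by blast
  qed
  with hc show "inv\<^bsub>aut_group\<^esub> f \<in> pure_conj"
    by (simp add: inv_aut_group f' pure_conj_def flip: h_def)
next
  fix f h :: "('a, 'b) fprod \<Rightarrow> ('a, 'b) fprod" assume *: "f \<in> pure_conj" "h \<in> pure_conj"
  then have f: "add_hom f" by (simp add: pure_conj_def carrier_aut_group)
  have "\<exists>g. \<forall>a. f (h (letter i a)) = g + letter i a - g" for i
  proof -
    obtain k l where "\<And>a. f (letter i a) = k + letter i a - k" "\<And>a. h (letter i a) = l + letter i a - l"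
      using * unfolding pure_conj_def by blast
    then show ?thesis
      by (intro exI[of _ "f l + k"]) (simp add: add_hom_simps[OF f] add_normalize del: add_uminus_conv_diff)
  qed
  moreover have "f \<circ> h \<in> carrier aut_group"
    using monoid.m_closed[OF group.is_monoid[OF group_aut_group], of f h] * by (simp add: pure_conj_def)
  ultimately show "f \<otimes>\<^bsub>aut_group\<^esub> h \<in> pure_conj"
    by (simp add: pure_conj_def)
qed

text \<open>The condition \<open>rank2\<close> says that the multiples of a nonzero element never
  contain a positive multiple of every other element. It fails for infinite cyclic factors, and
  there automorphisms need not carry factors to conjugates of factors.\<close>

context
  fixes dummy :: "'a::ab_group_add itself"
  assumes nontrivial: "\<exists>u::'a. u \<noteq> 0"
    and rank2: "\<And>u::'a. u \<noteq> 0 \<Longrightarrow> \<exists>v. \<forall>d k l. 0 < d \<longrightarrow> nmul d v + nmul k u \<noteq> nmul l u"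
begin

text \<open>One nonzero letter is sent into a conjugate of a factor by
  \<open>aut_letter_conjugate\<close>. The rest of its factor commutes with it, so its image lies in
  the same conjugate.\<close>

lemma aut_factor_conjugate:
  fixes \<phi> :: "('i, 'a) fprod \<Rightarrow> ('i, 'a) fprod"
  assumes "\<phi> \<in> carrier aut_group"
  shows "\<exists>c j. \<forall>a. \<exists>b. \<phi> (letter i a) = c + letter j b - c"
proof -
  have \<phi>: "add_hom \<phi>" "inj \<phi>" using assms by (auto simp: carrier_aut_group bij_is_inj)
  obtain u :: 'a where u: "u \<noteq> 0" using nontrivial by blast
  with rank2 obtain v where "\<And>d k l. 0 < d \<Longrightarrow> nmul d v + nmul k u \<noteq> nmul l u" by blast
  from aut_letter_conjugate[OF assms u this] obtain c j w where w: "\<phi> (letter i u) = c + letter j w - c"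
    by blast
  have "w \<noteq> 0"
  proof
    assume "w = 0"
    then have "\<phi> (letter i u) = \<phi> 0" using w by (simp add: add_hom_zero[OF \<phi>(1)])
    with \<phi>(2) u show False by (simp add: inj_eq)
  qed
  have "\<exists>b. \<phi> (letter i a) = c + letter j b - c" for a
  proof (rule commutes_conj_letter[OF _ \<open>w \<noteq> 0\<close>])
    show "\<phi> (letter i a) + (c + letter j w - c) = c + letter j w - c + \<phi> (letter i a)"
      unfolding w[symmetric] add_hom_add[OF \<phi>(1), symmetric] by (subst letter_commute) simp
  qed
  then show ?thesis by blast
qed

text \<open>The inverse automorphism also maps factors into conjugates of factors. Comparing the two
  through malnormality shows that the maps of indices and of factor elements invert each
  other.\<close>

lemma aut_decomposition:
  fixes \<phi> :: "('i::finite, 'a) fprod \<Rightarrow> ('i, 'a) fprod"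
  assumes "\<phi> \<in> carrier aut_group"
  shows "\<exists>s A c. bij s \<and> (\<forall>i. A i \<in> carrier aut_group) \<and>
    (\<forall>i a. \<phi> (letter i a) = c i + letter (s i) (A i a) - c i)"
proof -
  have \<phi>: "add_hom \<phi>" "inj \<phi>" "bij \<phi>" using assms by (auto simp: carrier_aut_group bij_is_inj)
  define \<psi> where "\<psi> = inv_into UNIV \<phi>"
  have \<psi>: "add_hom \<psi>" "\<psi> \<in> carrier aut_group"
    using \<phi> by (simp_all add: \<psi>_def add_hom_inv carrier_aut_group bij_imp_bij_inv)
  have \<psi>\<phi>: "\<psi> (\<phi> x) = x" "\<phi> (\<psi> x) = x" for x
    using \<phi> by (simp_all add: \<psi>_def bij_is_surj surj_f_inv_f)
  have "\<forall>i. \<exists>c s A. \<forall>a. \<phi> (letter i a) = c + letter s (A a) - c"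
    using aut_factor_conjugate[OF assms] by metis
  then obtain c s A where c: "\<And>i a. \<phi> (letter i a) = c i + letter (s i) (A i a) - c i"
    by metis
  have "\<forall>i. \<exists>c s A. \<forall>a. \<psi> (letter i a) = c + letter s (A a) - c"
    using aut_factor_conjugate[OF \<psi>(2)] by metis
  then obtain d t B where d: "\<And>i a. \<psi> (letter i a) = d i + letter (t i) (B i a) - d i"
    by metis
  \<comment> \<open>A letter is exhibited as a conjugate of a letter, so
    \<open>conj_letter_eq_letter\<close> identifies both the factor and the value.\<close>
  have "letter i a = (\<psi> (c i) + d (s i)) + letter (t (s i)) (B (s i) (A i a)) - (\<psi> (c i) + d (s i))" for i a
    using \<psi>\<phi>(1)[of "letter i a"]
    by (simp add: c add_hom_simps[OF \<psi>(1)] d add_normalize del: add_uminus_conv_diff)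
  moreover have "B (s i) (A i a) \<noteq> 0" if "a \<noteq> 0" for i a
  proof
    assume "B (s i) (A i a) = 0"
    with calculation[of i a] that show False by simp
  qed
  ultimately have ts: "t (s i) = i" "a = B (s i) (A i a)" if "a \<noteq> 0" for i a
    using conj_letter_eq_letter[of i a] that by metis+
  have s: "bij s"
  proof -
    have "inj s" by (rule inj_on_inverseI[of _ t]) (use ts(1) nontrivial in blast)
    then show ?thesis by (simp add: finite_UNIV_inj_surj bij_def)
  qed
  have A: "add_hom (A i)" for i
    unfolding add_hom_def
  proof (intro allI)
    \<comment> \<open>Additivity of \<open>\<phi>\<close> passes to \<open>A i\<close>, since
      conjugation by the common \<open>c i\<close> can be cancelled.\<close>
    fix a b
    have "c i + letter (s i) (A i (a + b)) - c i = c i + letter (s i) (A i a + A i b) - c i"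
      using c[of i "a + b"] by (simp add: letter_add add_hom_add[OF \<phi>(1)] c add_normalize del: add_uminus_conv_diff)
    then show "A i (a + b) = A i a + A i b"
      by (metis add_left_cancel diff_add_cancel letter_eq_iff)
  qed
  have "inj (A i)" for i
    using c[of i] \<phi>(2) by (intro injI) (metis injD letter_eq_iff)
  moreover have "surj (A i)" for i
    unfolding surj_def
  proof
    fix w
    show "\<exists>a. w = A i a"
    proof (cases "w = 0")
      case True
      then show ?thesis using add_hom_zero[OF A] by metis
    next
      case False
      have si: "t (s i) = i" using ts(1) nontrivial by blast
      have "letter (s i) w = \<phi> (d (s i) + letter i (B (s i) w) - d (s i))"
        using \<psi>\<phi>(2)[of "letter (s i) w"] by (simp add: d si)
      then have eq: "letter (s i) w = (\<phi> (d (s i)) + c i) + letter (s i) (A i (B (s i) w)) - (\<phi> (d (s i)) + c i)"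
        by (simp add: add_hom_simps[OF \<phi>(1)] c add_normalize del: add_uminus_conv_diff)
      then have "A i (B (s i) w) \<noteq> 0" using False by auto
      with conj_letter_eq_letter(2)[OF eq] show ?thesis by metis
    qed
  qed
  ultimately have "A i \<in> carrier aut_group" for i
    by (simp add: carrier_aut_group bij_def A)
  with s c show ?thesis by blast
qed

lemma pure_conj_factor_auts:
  fixes \<phi> :: "('i::finite, 'a) fprod \<Rightarrow> ('i, 'a) fprod"
  assumes "\<phi> \<in> carrier aut_group"
  shows "\<exists>\<pi>\<in>pure_conj. \<exists>\<tau>\<in>factor_auts. \<phi> = \<pi> \<circ> \<tau>"
proof -
  interpret G: group aut_group by (rule group_aut_group)
  obtain s A c where *: "bij s" "\<And>i. A i \<in> carrier aut_group"
    "\<And>i a. \<phi> (letter i a) = c i + letter (s i) (A i a) - c i"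
    using aut_decomposition[OF assms] by auto
  define l where "l = fprod_map s A"
  have l: "l \<in> carrier aut_group" "l \<in> factor_auts"
    using * by (auto simp: l_def fprod_map_aut factor_auts_def)
  define \<pi> where "\<pi> = \<phi> \<circ> inv_into UNIV l"
  have \<pi>: "\<pi> \<in> carrier aut_group"
    using G.m_closed[OF assms G.inv_closed[OF l(1)]] by (simp add: \<pi>_def inv_aut_group l)
  have \<pi>l: "\<pi> (l x) = \<phi> x" for x
    using l(1) by (simp add: \<pi>_def carrier_aut_group bij_is_inj)
  have "\<exists>g. \<forall>a. \<pi> (letter j a) = g + letter j a - g" for j
  proof -
    obtain i where i: "s i = j" using *(1) by (metis bij_pointE)
    have "\<pi> (letter j a) = c i + letter j a - c i" for a
    proof -
      obtain b where b: "A i b = a" using *(2)[of i] by (metis carrier_aut_group bij_pointE)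
      have "l (letter i b) = letter j a"
        using *(2) by (simp add: l_def fprod_map_letter carrier_aut_group i b)
      then show ?thesis using \<pi>l[of "letter i b"] *(3)[of i b] i b by simp
    qed
    then show ?thesis by blast
  qed
  with \<pi> have "\<pi> \<in> pure_conj" by (simp add: pure_conj_def)
  moreover have "\<phi> = \<pi> \<circ> l" using \<pi>l by auto
  ultimately show ?thesis using l(2) by blast
qed

text \<open>In the decomposition of \<open>\<phi>\<close>, a conjugate of a nonzero letter that is
  again a letter must be that same letter, so the conjugators have no effect. The criterion is used
  for the graph, inversion and transvection generators.\<close>

lemma factor_autsI:
  fixes \<phi> :: "('i::finite, 'a) fprod \<Rightarrow> ('i, 'a) fprod"
  assumes "\<phi> \<in> carrier aut_group" "\<And>i. \<exists>j. \<forall>a. \<exists>b. \<phi> (letter i a) = letter j b"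
  shows "\<phi> \<in> factor_auts"
proof -
  obtain s A c where *: "bij s" "\<And>i. A i \<in> carrier aut_group"
    "\<And>i a. \<phi> (letter i a) = c i + letter (s i) (A i a) - c i"
    using aut_decomposition[OF assms(1)] by auto
  have A: "add_hom (A i)" "inj (A i)" for i using *(2) by (auto simp: carrier_aut_group bij_is_inj)
  have "\<phi> = fprod_map s A"
  proof (rule add_hom_fprod_eqI)
    show "\<phi> (letter i a) = fprod_map s A (letter i a)" for i a
    proof (cases "a = 0")
      case True
      then show ?thesis using assms(1) A add_hom_fprod_map[of A s] by (simp add: add_hom_zero carrier_aut_group)
    next
      case False
      then have "A i a \<noteq> 0" using A by (metis add_hom_zero injD)
      moreover obtain j b where "\<phi> (letter i a) = letter j b" using assms(2) by blast
      ultimately show ?thesis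
        using *(3)[of i a] conj_letter_eq_letter[of j b "c i" "s i" "A i a"] by (simp add: fprod_map_letter A)
    qed
  qed (use assms A in \<open>auto simp: carrier_aut_group intro: add_hom_fprod_map\<close>)
  with * show ?thesis by (auto simp: factor_auts_def)
qed

lemma pure_conj_normal: "(pure_conj :: (('i::finite, 'a) fprod \<Rightarrow> ('i, 'a) fprod) set) \<lhd> aut_group"
proof -
  interpret G: group aut_group by (rule group_aut_group)
  have "f \<circ> p \<circ> inv_into UNIV f \<in> pure_conj"
    if f: "f \<in> carrier aut_group" and p: "p \<in> pure_conj" for f p :: "('i, 'a) fprod \<Rightarrow> ('i, 'a) fprod"
  proof -
    define h where "h = inv_into UNIV f"
    have h: "h \<in> carrier aut_group" using f by (simp add: h_def flip: inv_aut_group)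
    have pc: "p \<in> carrier aut_group" using p by (simp add: pure_conj_def)
    note hom = add_hom_simps[of f] add_hom_simps[of p]
    have hom': "add_hom f" "add_hom p" using f pc by (auto simp: carrier_aut_group)
    have fh: "f (h x) = x" for x using f by (simp add: h_def carrier_aut_group bij_is_surj surj_f_inv_f)
    have "\<exists>g. \<forall>a. f (p (h (letter i a))) = g + letter i a - g" for i
    proof -
      obtain c j where cj: "\<And>a. \<exists>b. h (letter i a) = c + letter j b - c"
        using aut_factor_conjugate[OF h, of i] by blast
      obtain g where g: "\<And>b. p (letter j b) = g + letter j b - g" using p by (auto simp: pure_conj_def)
      \<comment> \<open>The inverse \<open>h\<close> of \<open>f\<close> leads to
        \<open>c + letter j b - c\<close>; then \<open>p\<close> contributes \<open>p c + g\<close>,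
        and rewriting \<open>f (letter j b)\<close> as the conjugate of \<open>letter i a\<close> by
        \<open>- f c\<close> gives the last term.\<close>
      have "f (p (h (letter i a))) = (f (p c + g) - f c) + letter i a - (f (p c + g) - f c)" for a
      proof -
        obtain b where b: "h (letter i a) = c + letter j b - c" using cj by blast
        have 1: "f (p (h (letter i a))) = f (p c) + (f g + f (letter j b) - f g) - f (p c)"
          by (simp add: b hom hom' g)
        have 2: "letter i a = f c + f (letter j b) - f c"
          using fh[of "letter i a"] by (simp add: b hom hom')
        show ?thesis
          unfolding 1 by (subst 2) (simp add: hom hom' add_normalize del: add_uminus_conv_diff)
      qed
      then show ?thesis by blast
    qed
    moreover have "f \<circ> p \<circ> h \<in> carrier aut_group"
      using G.m_closed[OF G.m_closed[OF f pc] h] by simp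
    ultimately show ?thesis by (simp add: pure_conj_def flip: h_def)
  qed
  then show ?thesis
    unfolding G.normal_inv_iff by (simp add: subgroup_pure_conj inv_aut_group)
qed

text \<open>Each letter is mapped to a letter which is also a conjugate of it, hence to
  itself.\<close>

lemma pure_conj_Int_factor_auts:
  "(pure_conj :: (('i, 'a) fprod \<Rightarrow> ('i, 'a) fprod) set) \<inter> factor_auts = {id}"
proof -
  have "\<phi> = id" if pc: "\<phi> \<in> pure_conj" and fa: "\<phi> \<in> factor_auts" for \<phi> :: "('i, 'a) fprod \<Rightarrow> ('i, 'a) fprod"
  proof -
    obtain s A where \<phi>: "\<phi> = fprod_map s A" "\<And>i. A i \<in> carrier aut_group"
      using fa unfolding factor_auts_def by blast
    have A: "add_hom (A i)" for i using \<phi>(2) by (simp add: carrier_aut_group)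
    have "\<phi> (letter i a) = letter i a" for i a
    proof (cases "a = 0")
      case False
      obtain g where "\<phi> (letter i a) = g + letter i a - g" using pc unfolding pure_conj_def by blast
      with conj_letter_eq_letter[of "s i" "A i a" g i a] False show ?thesis
        by (simp add: \<phi>(1) fprod_map_letter A)
    qed (simp add: \<phi>(1) add_hom_zero[OF add_hom_fprod_map[OF A]])
    then show ?thesis
      by (intro add_hom_fprod_eqI) (simp_all add: \<phi>(1) add_hom_fprod_map A)
  qed
  moreover have "id \<in> pure_conj" "id \<in> factor_auts"
    using subgroup.one_closed[OF subgroup_pure_conj] subgroup.one_closed[OF subgroup_factor_auts] by simp_all
  ultimately show ?thesis by blast
qed

lemma internal_semidirect_pure_conj:
  "is_internal_semidirect aut_group (pure_conj :: (('i::finite, 'a) fprod \<Rightarrow> ('i, 'a) fprod) set) factor_auts"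
  unfolding is_internal_semidirect_def
proof (intro conjI)
  show "pure_conj <#>\<^bsub>aut_group\<^esub> factor_auts = (carrier aut_group :: (('i, 'a) fprod \<Rightarrow> ('i, 'a) fprod) set)"
  proof
    show "pure_conj <#>\<^bsub>aut_group\<^esub> factor_auts \<subseteq> (carrier aut_group :: (('i, 'a) fprod \<Rightarrow> ('i, 'a) fprod) set)"
      using subgroup.subset[OF subgroup_pure_conj] subgroup.subset[OF subgroup_factor_auts]
      by (intro monoid.set_mult_closed group.is_monoid[OF group_aut_group])
    show "(carrier aut_group :: (('i, 'a) fprod \<Rightarrow> ('i, 'a) fprod) set) \<subseteq> pure_conj <#>\<^bsub>aut_group\<^esub> factor_auts"
      using pure_conj_factor_auts by (fastforce simp: set_mult_def)
  qed
qed (simp_all add: pure_conj_normal subgroup_factor_auts pure_conj_Int_factor_auts)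

end

section \<open>Three factors\<close>

text \<open>The numeral type \<open>3\<close> has arithmetic modulo 3, which provides the cyclic
  order of the factors.\<close>

lemma type3_simps [simp]:
  fixes i :: 3
  shows "i + 1 \<noteq> i" "i + 2 \<noteq> i" "i \<noteq> i + 1" "i \<noteq> i + 2" "i + 1 \<noteq> i + 2" "i + 2 \<noteq> i + 1"
    "i + 1 + 1 = i + 2" "i + 1 + 2 = i" "i + 2 + 1 = i" "i + 2 + 2 = i + 1"
  using exhaust_3[of i] by auto

lemma type3_cases:
  fixes i j :: 3
  obtains "j = i" | "j = i + 1" | "j = i + 2"
  using exhaust_3[of i] exhaust_3[of j] by auto

section \<open>Inner automorphisms and their complement, generated by the twists\<close>

definition inner_aut :: "'g::group_add \<Rightarrow> 'g \<Rightarrow> 'g" where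
  "inner_aut g x = g + x - g"

lemma add_hom_inner_aut: "add_hom (inner_aut g)"
  unfolding inner_aut_def[abs_def] by (rule add_hom_conj)

lemma inner_hom: "inner_aut \<in> hom additive_group aut_group"
proof (rule homI)
  have eq: "inner_aut (x + y) = inner_aut x \<circ> inner_aut y" for x y :: "'a"
    by (rule ext) (simp add: inner_aut_def add_normalize del: add_uminus_conv_diff)
  then show "inner_aut (x \<otimes>\<^bsub>additive_group\<^esub> y) = inner_aut x \<otimes>\<^bsub>aut_group\<^esub> inner_aut y" for x y :: "'a"
    by simp
  have 0: "inner_aut (0::'a) = id" by (rule ext) (simp add: inner_aut_def)
  show "inner_aut x \<in> carrier aut_group" for x :: 'a
    by (rule aut_groupI[of _ "inner_aut (- x)"]) (simp_all add: 0 add_hom_inner_aut flip: eq)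
qed

lemma inner_normal: "range (inner_aut :: 'g::group_add \<Rightarrow> _) \<lhd> aut_group"
proof -
  interpret G: group "aut_group :: ('g \<Rightarrow> 'g) monoid" by (rule group_aut_group)
  have "subgroup (inner_aut ` carrier additive_group) (aut_group :: ('g \<Rightarrow> 'g) monoid)"
    by (rule group_hom.img_is_subgroup) (simp add: group_hom_def group_hom_axioms_def inner_hom)
  moreover have "f \<circ> inner_aut g \<circ> inv_into UNIV f \<in> range inner_aut" if "f \<in> carrier aut_group" for f and g :: 'g
  proof -
    have "f \<circ> inner_aut g \<circ> inv_into UNIV f = inner_aut (f g)"
      using that by (auto simp: fun_eq_iff inner_aut_def carrier_aut_group add_hom_simps bij_is_surj surj_f_inv_f)
    then show ?thesis by simp
  qed
  ultimately show ?thesis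
    unfolding G.normal_inv_iff by (auto simp: inv_aut_group)
qed

lemma inner_pure_conj: "inner_aut g \<in> pure_conj"
  using hom_in_carrier[OF inner_hom] by (auto simp: pure_conj_def inner_aut_def)

definition twist :: "3 \<Rightarrow> 'a::group_add \<Rightarrow> (3, 'a) fprod \<Rightarrow> (3, 'a) fprod" where
  "twist i a = pconj (letter i a) {i + 1}"

definition twists :: "(3, 'a::group_add) fprod \<Rightarrow> (3, 'a) fprod \<Rightarrow> (3, 'a) fprod" where
  "twists = fprod_lift aut_group twist"

lemma twist_letter: "twist i a (letter j b) = (if j = i + 1 then letter i a + letter j b - letter i a else letter j b)"
  by (simp add: twist_def pconj_letter)

lemma twist_hom: "twist i \<in> hom additive_group (aut_group :: ((3, 'a::ab_group_add) fprod \<Rightarrow> _) monoid)"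
  unfolding twist_def by (rule pconj_hom) simp

lemma twists_hom: "twists \<in> hom additive_group (aut_group :: ((3, 'a::ab_group_add) fprod \<Rightarrow> _) monoid)"
  unfolding twists_def by (rule fprod_lift_hom) (simp_all add: twist_hom)

lemma twists_letter: "twists (letter i (a::'a::ab_group_add)) = twist i a"
  unfolding twists_def by (rule fprod_lift_letter) (simp_all add: twist_hom)

lemma twists_add: "twists (x + y) = twists x \<circ> twists (y :: (3, 'a::ab_group_add) fprod)"
  using hom_mult[OF twists_hom, of x y] by simp

lemma twists_zero: "twists (0 :: (3, 'a::ab_group_add) fprod) = id"
  using hom_one_additive[OF group_aut_group twists_hom] by simp

lemma twist_pure_conj: "twist i (a::'a::ab_group_add) \<in> pure_conj"
proof -
  have "\<exists>g. \<forall>b. twist i a (letter j b) = g + letter j b - g" for j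
    by (cases "j = i + 1") (auto simp: twist_letter intro: exI[of _ "letter i a"] exI[of _ 0])
  then show ?thesis
    using hom_in_carrier[OF twist_hom, of a i] by (simp add: pure_conj_def)
qed

lemma twists_pure_conj: "twists (x :: (3, 'a::ab_group_add) fprod) \<in> pure_conj"
proof (induction x rule: fprod_induct)
  case zero
  show ?case using subgroup.one_closed[OF subgroup_pure_conj] by (simp add: twists_zero id_def)
next
  case (letter i a x)
  show ?case
    using subgroup.m_closed[OF subgroup_pure_conj twist_pure_conj letter(3)]
    by (simp add: twists_add twists_letter comp_def)
qed

text \<open>The cosets \<open>g j H\<^sub>j\<close> are vertices of the Bass-Serre tree. After a twist by a letter of the factor \<open>i\<close>, the
  paths from the \<open>i\<close>-th vertex to the two others leave it in different directions, so that this vertex lies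
  between them. The next twist, by another factor, then moves one of the other vertices further away.\<close>

definition twist_ready :: "3 \<Rightarrow> ((3, 'a::ab_group_add) fprod \<Rightarrow> (3, 'a) fprod) \<Rightarrow> bool" where
  "twist_ready i \<phi> \<longleftrightarrow> add_hom \<phi> \<and> (\<exists>g. (\<forall>j a. \<phi> (letter j a) = g j + letter j a - g j) \<and>
     \<not> starts i (- g i + g (i + 1)) \<and> \<not> ends (i + 1) (- g i + g (i + 1)) \<and>
     \<not> starts i (- g i + g (i + 2)) \<and> \<not> ends (i + 2) (- g i + g (i + 2)))"

definition twisted :: "3 \<Rightarrow> ((3, 'a::ab_group_add) fprod \<Rightarrow> (3, 'a) fprod) \<Rightarrow> bool" where
  "twisted i \<phi> \<longleftrightarrow> add_hom \<phi> \<and> (\<exists>g h u w. (\<forall>j a. \<phi> (letter j a) = g j + letter j a - g j) \<and> h \<noteq> 0 \<and>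
     g (i + 1) = g i + letter i h + u \<and> g (i + 2) = g i + w \<and>
     \<not> starts i u \<and> \<not> ends (i + 1) u \<and> \<not> starts i w \<and> \<not> ends (i + 2) w)"

lemma twist_ready_id: "twist_ready i id"
  unfolding twist_ready_def by (auto intro: exI[of _ "\<lambda>_. 0"])

text \<open>The twist multiplies \<open>g (i + 1)\<close> on the left by the image of
  \<open>letter i h\<close>, that is, it inserts \<open>letter i h\<close> between
  \<open>g i\<close> and the old path \<open>- g i + g (i + 1)\<close>.\<close>

lemma twisted_twist:
  assumes "twist_ready i \<phi>" "h \<noteq> 0"
  shows "twisted i (\<phi> \<circ> twist i h)"
proof -
  obtain g where g: "add_hom \<phi>" "\<And>j a. \<phi> (letter j a) = g j + letter j a - g j"
     "\<not> starts i (- g i + g (i + 1))" "\<not> ends (i + 1) (- g i + g (i + 1))"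
     "\<not> starts i (- g i + g (i + 2))" "\<not> ends (i + 2) (- g i + g (i + 2))"
    using assms(1) unfolding twist_ready_def by blast
  define g' where "g' = g(i + 1 := g i + letter i h + (- g i + g (i + 1)))"
  have "(\<phi> \<circ> twist i h) (letter j a) = g' j + letter j a - g' j" for j a
    by (auto simp: twist_letter g'_def add_hom_simps[OF g(1)] g(2))
      (simp add: add_normalize del: add_uminus_conv_diff)
  moreover have "add_hom (\<phi> \<circ> twist i h)"
    unfolding twist_def by (intro add_hom_comp g add_hom_pconj)
  moreover have "g' (i + 1) = g' i + letter i h + (- g i + g (i + 1))" "g' (i + 2) = g' i + (- g i + g (i + 2))"
    by (simp_all add: g'_def add.assoc)
  ultimately show ?thesis
    unfolding twisted_def using g(3-6) assms(2) by blast
qed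

text \<open>For data as in \<open>twisted\<close> this element is
  \<open>- g (i + 1) + g (i + 2)\<close>. The nonzero letter of the factor \<open>i\<close> in its
  middle meets no letter of that factor in \<open>u\<close> or \<open>w\<close>, so nothing
  cancels.\<close>

lemma twisted_reduced:
  fixes i :: 3 and h :: "'a::ab_group_add"
  assumes "h \<noteq> 0" "\<not> starts i u" "\<not> ends (i + 1) u" "\<not> starts i w" "\<not> ends (i + 2) w"
  shows "\<not> starts (i + 1) (- u + (letter i (- h) + w))" "\<not> ends (i + 2) (- u + (letter i (- h) + w))"
    "- u + (letter i (- h) + w) \<noteq> 0"
proof -
  have h: "- h \<noteq> 0" using assms(1) by simp
  note * = letter_reduced_add[OF h assms(4)]
  have r: "\<nexists>k. ends k (- u) \<and> starts k (letter i (- h) + w)" using assms(2) by (simp add: *)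
  show "\<not> starts (i + 1) (- u + (letter i (- h) + w))" "\<not> ends (i + 2) (- u + (letter i (- h) + w))"
    using assms by (auto simp only: reduced_add(2,3)[OF r] * starts_minus split: if_splits) auto
  have "len (- u + (letter i (- h) + w)) \<noteq> 0"
    using * by (simp only: reduced_add(1)[OF r])
  then show "- u + (letter i (- h) + w) \<noteq> 0" using len_eq_zero_iff by metis
qed

lemma twisted_ready:
  assumes "twisted i \<phi>" "j \<noteq> i"
  shows "twist_ready j \<phi>"
proof -
  obtain g h u w where g: "add_hom \<phi>" "\<And>j a. \<phi> (letter j a) = g j + letter j a - g j" "h \<noteq> 0"
    "g (i + 1) = g i + letter i h + u" "g (i + 2) = g i + w"
    "\<not> starts i u" "\<not> ends (i + 1) u" "\<not> starts i w" "\<not> ends (i + 2) w"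
    using assms(1) unfolding twisted_def by blast
  note v = twisted_reduced[OF g(3,6-9)]
  show ?thesis
  proof (cases rule: type3_cases[of j i])
    case 2
    have j: "j + 1 = i + 2" "j + 2 = i" by (simp_all only: 2 type3_simps)
    \<comment> \<open>With the old \<open>g i\<close>, the element \<open>- g j + g i\<close> would
      be \<open>- u + letter i (- h)\<close>, which ends in the factor \<open>i\<close>. Replacing
      \<open>g i\<close> within its coset by the abelian factor turns it into
      \<open>- u\<close>.\<close>
    define g' where "g' = g(i := g i + letter i h)"
    have "\<phi> (letter k a) = g' k + letter k a - g' k" for k a
    proof (cases "k = i")
      case True
      have "g' i + letter i a - g' i = g i + (letter i h + letter i a - letter i h) - g i"
        by (simp add: g'_def add_normalize del: add_uminus_conv_diff letter_conj_letter)
      then show ?thesis using True g(2) by simp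
    qed (simp add: g'_def g(2))
    moreover have "- g' j + g' (j + 1) = - u + (letter i (- h) + w)"
      by (simp add: j, simp add: 2 g'_def g(4,5) letter_minus add_normalize del: add_uminus_conv_diff)
    moreover have "- g' j + g' (j + 2) = - u"
      by (simp add: j, simp add: 2 g'_def g(4) add_normalize del: add_uminus_conv_diff)
    ultimately show ?thesis
      unfolding twist_ready_def using g(1) v(1,2) g(6,7)
      by (intro conjI exI[of _ g'] allI) (simp_all only: 2 type3_simps starts_minus ends_minus not_False_eq_True)
  next
    case 3
    have j: "j + 1 = i" "j + 2 = i + 1" by (simp_all only: 3 type3_simps)
    have "- g j + g (j + 1) = - w"
      by (simp add: j, simp add: 3 g(5) add_normalize del: add_uminus_conv_diff)
    moreover have "- g j + g (j + 2) = - (- u + (letter i (- h) + w))"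
      by (simp add: j, simp add: 3 g(4,5) letter_minus add_normalize del: add_uminus_conv_diff)
    ultimately show ?thesis
      unfolding twist_ready_def using g(1,2) v(1,2) g(8,9)
      by (intro conjI exI[of _ g] allI) (simp_all only: 3 type3_simps starts_minus ends_minus not_False_eq_True)
  qed (use assms in simp)
qed

text \<open>For an inner automorphism every \<open>g j\<close> is \<open>c\<close> followed by a
  letter of the factor \<open>j\<close>. Then \<open>- g (i + 1) + g (i + 2)\<close> either starts
  in the factor \<open>i + 1\<close>, ends in the factor \<open>i + 2\<close> or vanishes, against
  \<open>twisted_reduced\<close>.\<close>

lemma twisted_not_inner:
  assumes "twisted i (inner_aut c :: (3, 'a::ab_group_add) fprod \<Rightarrow> _)"
  shows False
proof -
  obtain g h u w where g: "\<And>j a. inner_aut c (letter j a) = g j + letter j a - g j" "(h::'a) \<noteq> 0"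
    "g (i + 1) = g i + letter i h + u" "g (i + 2) = g i + w"
    "\<not> starts i u" "\<not> ends (i + 1) u" "\<not> starts i w" "\<not> ends (i + 2) w"
    using assms unfolding twisted_def by blast
  note v = twisted_reduced[OF g(2,5-8)]
  have "\<exists>b. - c + g j = letter j b" for j
  proof -
    have "letter j h = - c + (c + letter j h - c) + c"
      by (simp add: add_normalize del: add_uminus_conv_diff)
    also have "\<dots> = (- c + g j) + letter j h - (- c + g j)"
      using g(1)[of j h] unfolding inner_aut_def by (simp add: add_normalize del: add_uminus_conv_diff)
    finally show ?thesis using g(2) by (rule conj_letter_eq_letter(3))
  qed
  then obtain b where b: "\<And>j. g j = c + letter j (b j)" by (metis add_minus_cancel)
  have "- u + (letter i (- h) + w) = - g (i + 1) + g (i + 2)"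
    by (simp add: g(3,4) letter_minus add_normalize del: add_uminus_conv_diff)
  also have "\<dots> = letter (i + 1) (- b (i + 1)) + letter (i + 2) (b (i + 2))"
    by (simp add: b letter_minus add_normalize del: add_uminus_conv_diff)
  finally have eq: "- u + (letter i (- h) + w) = letter (i + 1) (- b (i + 1)) + letter (i + 2) (b (i + 2))" .
  show False
  proof (cases "b (i + 1) = 0")
    case True
    with v(2,3) show False unfolding eq by (auto simp: ends_letter)
  next
    case False
    then have "starts (i + 1) (letter (i + 1) (- b (i + 1)) + letter (i + 2) (b (i + 2)))"
      by (subst letter_reduced_add) (simp_all add: starts_letter)
    with v(1) show False unfolding eq by simp
  qed
qed

text \<open>Induction from the right end of the word, because the last letter is the innermost map.
  The preceding letter lies in a different factor, which is what \<open>twisted_ready\<close>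
  requires.\<close>

lemma twists_twisted:
  fixes x :: "(3, 'a::ab_group_add) fprod"
  shows "ends i x \<Longrightarrow> twisted i (twists x)"
proof (induction "len x" arbitrary: x i)
  case 0
  then have "x = 0" by (metis len_eq_zero_iff)
  with 0 show ?case by simp
next
  case (Suc n)
  obtain a y where y: "x = y + letter i a" "\<not> ends i y" "len x = len y + (if a = 0 then 0 else 1)"
    "a = 0 \<longleftrightarrow> \<not> ends i x" by (rule ends_decomp)
  have "twist_ready i (twists y)"
  proof (cases "y = 0")
    case True
    then show ?thesis by (simp add: twists_zero twist_ready_id)
  next
    case False
    then obtain j where j: "ends j y" using ex_ends by blast
    with Suc y have "twisted j (twists y)" by simp
    moreover have "i \<noteq> j" using j y(2) by blast
    ultimately show ?thesis by (rule twisted_ready)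
  qed
  then show ?case using y Suc.prems by (simp add: twists_add twists_letter twisted_twist)
qed

text \<open>This yields both the injectivity of \<open>twists\<close> (with \<open>c = 0\<close>)
  and its trivial intersection with the inner automorphisms.\<close>

lemma twists_inner: "twists x = inner_aut c \<Longrightarrow> x = 0"
  for x :: "(3, 'a::ab_group_add) fprod"
  using twists_twisted twisted_not_inner ex_ends by metis

lemma inj_twists: "inj (twists :: (3, 'a::ab_group_add) fprod \<Rightarrow> _)"
proof (rule injI)
  fix x y :: "(3, 'a) fprod" assume "twists x = twists y"
  then have "twists (x - y) = twists (y - y)"
    by (simp only: diff_conv_add_uminus twists_add)
  also have "\<dots> = inner_aut 0" by (simp add: twists_zero inner_aut_def fun_eq_iff)
  finally show "x = y" using twists_inner by fastforce
qed

lemma inj_inner: "inj (inner_aut :: (3, 'a::ab_group_add) fprod \<Rightarrow> _)" if nontrivial: "\<exists>u::'a. u \<noteq> 0"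
proof (rule injI)
  fix x y :: "(3, 'a) fprod" assume eq: "inner_aut x = inner_aut y"
  obtain u :: 'a where u: "u \<noteq> 0" using nontrivial by blast
  have "\<exists>b. - y + x = letter i b" for i
  proof -
    have "x + letter i u - x = y + letter i u - y" using fun_cong[OF eq] by (simp add: inner_aut_def)
    then have "- y + (x + letter i u - x) + y = letter i u"
      by (simp add: add_normalize del: add_uminus_conv_diff)
    then have "letter i u = (- y + x) + letter i u - (- y + x)"
      by (simp add: add_normalize del: add_uminus_conv_diff)
    then show ?thesis using u by (rule conj_letter_eq_letter(3))
  qed
  \<comment> \<open>The difference centralizes every factor, so it lies in two different factors and
    is zero.\<close>
  then obtain b c where "- y + x = letter 1 b" "- y + x = letter 2 c" by metis
  then have "- y + x = 0" by (auto simp: letter_eq_iff)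
  then have "y + (- y + x) = y" by simp
  then show "x = y" by simp
qed

text \<open>Conjugating the factor \<open>i + 1\<close> is a twist. To conjugate the factor
  \<open>i + 2\<close>, conjugate everything by \<open>letter i a\<close> and undo this on the
  factor \<open>i + 1\<close> by the opposite twist; the abelian factor \<open>i\<close> is not
  affected.\<close>

lemma pconj_twists:
  fixes a :: "'a::ab_group_add"
  assumes "i \<noteq> j"
  shows "pconj (letter i a) {j} \<in> range inner_aut <#>\<^bsub>aut_group\<^esub> range twists"
proof (cases rule: type3_cases[of j i])
  case 2
  have "pconj (letter i a) {j} = inner_aut 0 \<circ> twists (letter i a)"
    by (simp add: 2 twists_letter twist_def inner_aut_def fun_eq_iff)
  then show ?thesis unfolding set_mult_def by auto
next
  case 3
  have "pconj (letter i a) {j} = inner_aut (letter i a) \<circ> twists (letter i (- a))"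
  proof (rule add_hom_fprod_eqI)
    have h: "add_hom (inner_aut (letter i a))" by (rule add_hom_inner_aut)
    show "add_hom (inner_aut (letter i a) \<circ> twists (letter i (- a)))"
      by (intro add_hom_comp h) (simp add: twists_letter twist_def)
    show "pconj (letter i a) {j} (letter k b) = (inner_aut (letter i a) \<circ> twists (letter i (- a))) (letter k b)" for k b
      by (cases rule: type3_cases[of k i])
        (simp_all add: 3 twists_letter twist_letter pconj_letter inner_aut_def,
         simp add: letter_minus add_normalize del: add_uminus_conv_diff)
  qed simp
  then show ?thesis unfolding set_mult_def by auto
qed (use assms in simp)

lemma internal_semidirect_inner_twists:
  assumes nontrivial: "\<exists>u::'a::ab_group_add. u \<noteq> 0"
  shows "is_internal_semidirect (aut_group\<lparr>carrier := pure_conj\<rparr>)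
    (range inner_aut) (range (twists :: (3, 'a) fprod \<Rightarrow> _))"
proof -
  interpret G: group "aut_group :: ((3, 'a) fprod \<Rightarrow> _) monoid" by (rule group_aut_group)
  have tw: "subgroup (range (twists :: (3, 'a) fprod \<Rightarrow> _)) aut_group"
    using group_hom.img_is_subgroup[of additive_group aut_group "twists :: (3, 'a) fprod \<Rightarrow> _"]
    by (simp add: group_hom_def group_hom_axioms_def twists_hom)
  have pc: "subgroup (pure_conj :: ((3, 'a) fprod \<Rightarrow> _) set) aut_group" by (rule subgroup_pure_conj)
  have sub: "range (inner_aut :: (3, 'a) fprod \<Rightarrow> _) \<subseteq> pure_conj" "range (twists :: (3, 'a) fprod \<Rightarrow> _) \<subseteq> pure_conj"
    using inner_pure_conj twists_pure_conj by blast+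
  have prod: "subgroup (range inner_aut <#>\<^bsub>aut_group\<^esub> range (twists :: (3, 'a) fprod \<Rightarrow> _)) aut_group"
    by (rule G.mult_norm_subgroup[OF inner_normal tw])
  have "(pure_conj :: ((3, 'a) fprod \<Rightarrow> _) set) \<subseteq> range inner_aut <#>\<^bsub>aut_group\<^esub> range twists"
  proof
    fix \<phi> :: "(3, 'a) fprod \<Rightarrow> (3, 'a) fprod" assume "\<phi> \<in> pure_conj"
    then obtain g where "\<phi> \<in> carrier aut_group" "\<And>i a. \<phi> (letter i a) = g i + letter i a - g i"
      unfolding pure_conj_def by (auto simp: choice_iff)
    then have "\<phi> \<in> generate aut_group {pconj (letter i a) {j} | i a j. i \<noteq> j}"
      by (rule pure_conj_generated) (rule nontrivial)
    also have "\<dots> \<subseteq> range inner_aut <#>\<^bsub>aut_group\<^esub> range twists"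
      \<comment> \<open>The product set is a subgroup because the inner automorphisms are normal, so
        it suffices that it contains the generating partial conjugations.\<close>
      by (rule G.generate_subgroup_incl[OF _ prod]) (auto intro: pconj_twists)
    finally show "\<phi> \<in> range inner_aut <#>\<^bsub>aut_group\<^esub> range twists" .
  qed
  moreover have "range inner_aut <#>\<^bsub>aut_group\<^esub> range twists \<subseteq> (pure_conj :: ((3, 'a) fprod \<Rightarrow> _) set)"
  proof -
    have "inner_aut g \<otimes>\<^bsub>aut_group\<^esub> twists x \<in> pure_conj" for g x :: "(3, 'a) fprod"
      by (intro subgroup.m_closed[OF pc] inner_pure_conj twists_pure_conj)
    then show ?thesis by (auto simp: set_mult_def)
  qed
  ultimately have "range inner_aut <#>\<^bsub>aut_group\<^esub> range twists = (pure_conj :: ((3, 'a) fprod \<Rightarrow> _) set)"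
    by blast
  moreover have "range (inner_aut :: (3, 'a) fprod \<Rightarrow> _) \<lhd> (aut_group\<lparr>carrier := pure_conj\<rparr>)"
    by (rule G.normal_restrict_supergroup[OF pc inner_normal sub(1)])
  moreover have "subgroup (range twists) (aut_group\<lparr>carrier := pure_conj :: ((3, 'a) fprod \<Rightarrow> _) set\<rparr>)"
    using subgroup.subgroup_is_group G.subgroup_incl[OF tw pc] sub by blast
  moreover have "range inner_aut \<inter> range (twists :: (3, 'a) fprod \<Rightarrow> _) = {id}"
  proof -
    have "\<phi> = id" if inn: "\<phi> \<in> range inner_aut" and tws: "\<phi> \<in> range (twists :: (3, 'a) fprod \<Rightarrow> _)" for \<phi>
    proof -
      obtain x where "\<phi> = twists x" using tws by auto
      moreover obtain c where "\<phi> = inner_aut c" using inn by auto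
      ultimately show ?thesis using twists_inner[of x c] by (simp add: twists_zero)
    qed
    moreover have "id \<in> range (inner_aut :: (3, 'a) fprod \<Rightarrow> _)" "id \<in> range (twists :: (3, 'a) fprod \<Rightarrow> _)"
      using subgroup.one_closed[OF normal_imp_subgroup[OF inner_normal]] subgroup.one_closed[OF tw]
      by simp_all
    ultimately show ?thesis by blast
  qed
  ultimately show ?thesis
    unfolding is_internal_semidirect_def by (simp add: set_mult_def)
qed

section \<open>Presented groups\<close>

definition pres_class :: "'a set \<Rightarrow> ('a word \<times> 'a word) set \<Rightarrow> 'a word \<Rightarrow> 'a word set" where
  "pres_class S R w = pres_rel S R `` {w}"

definition word_inverse :: "'a word \<Rightarrow> 'a word" where
  "word_inverse w = rev (map (\<lambda>(a, e). (a, \<not> e)) w)"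

lemma words_Nil [simp]: "[] \<in> words S"
  by (simp add: words_def)

lemma words_Cons [simp]: "(a, e) # w \<in> words S \<longleftrightarrow> a \<in> S \<and> w \<in> words S"
  by (auto simp: words_def)

lemma words_append [simp]: "u @ v \<in> words S \<longleftrightarrow> u \<in> words S \<and> v \<in> words S"
  by (auto simp: words_def)

lemma word_inverse_words [simp]: "word_inverse w \<in> words S \<longleftrightarrow> w \<in> words S"
  by (induction w) (auto simp: word_inverse_def)

lemma pres_eq_words: "pres_eq S R u v \<Longrightarrow> u \<in> words S \<and> v \<in> words S"
  by (induction rule: pres_eq.induct) auto

lemma pres_eq_append:
  assumes "pres_eq S R u v" "x \<in> words S" "y \<in> words S"
  shows "pres_eq S R (x @ u @ y) (x @ v @ y)"
  using assms
proof (induction rule: pres_eq.induct)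
  case (cancel u v a e)
  then show ?case using pres_eq.cancel[of "x @ u" S "v @ y" a R e] by simp
next
  case (rel u v l r)
  then show ?case using pres_eq.rel[of "x @ u" S "v @ y" l r R] by simp
qed (auto intro: pres_eq.intros)

lemma pres_eq_cong:
  assumes "pres_eq S R u u'" "pres_eq S R v v'"
  shows "pres_eq S R (u @ v) (u' @ v')"
  using pres_eq_append[OF assms(1), of "[]" v] pres_eq_append[OF assms(2), of u' "[]"]
    pres_eq_words[OF assms(1)] pres_eq_words[OF assms(2)] by (auto intro: pres_eq.trans)

lemma equiv_pres_rel: "equiv (words S) (pres_rel S R)"
  by (rule equivI)
    (auto simp: refl_on_def pres_rel_def sym_def trans_def dest: pres_eq_words intro: pres_eq.intros)

lemma pres_class_eq_iff:
  "u \<in> words S \<Longrightarrow> v \<in> words S \<Longrightarrow> pres_class S R u = pres_class S R v \<longleftrightarrow> pres_eq S R u v"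
  unfolding pres_class_def by (subst eq_equiv_class_iff[OF equiv_pres_rel]) (auto simp: pres_rel_def)

lemma carrier_presented_group: "carrier (presented_group S R) = pres_class S R ` words S"
  by (auto simp: presented_group_def quotient_def pres_class_def)

lemma one_presented_group: "\<one>\<^bsub>presented_group S R\<^esub> = pres_class S R []"
  by (simp add: presented_group_def pres_class_def)

lemma mult_pres_class:
  assumes "u \<in> words S" "v \<in> words S"
  shows "pres_class S R u \<otimes>\<^bsub>presented_group S R\<^esub> pres_class S R v = pres_class S R (u @ v)"
proof -
  have "pres_class S R (u' @ v') = pres_class S R (u @ v)"
    if "u' \<in> pres_class S R u" "v' \<in> pres_class S R v" for u' v'
  proof -
    have "pres_eq S R (u @ v) (u' @ v')"
      using that by (intro pres_eq_cong) (auto simp: pres_class_def pres_rel_def)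
    then show ?thesis using pres_eq_words[of S R] pres_class_eq_iff by metis
  qed
  moreover have "u \<in> pres_class S R u" "v \<in> pres_class S R v"
    using assms by (auto simp: pres_class_def pres_rel_def intro: pres_eq.refl)
  ultimately have "(\<Union>u'\<in>pres_class S R u. \<Union>v'\<in>pres_class S R v. pres_class S R (u' @ v')) = pres_class S R (u @ v)"
    by blast
  then show ?thesis by (simp add: presented_group_def pres_class_def)
qed

lemma pres_eq_inverse: "w \<in> words S \<Longrightarrow> pres_eq S R (word_inverse w @ w) []"
proof (induction w)
  case Nil
  show ?case by (simp add: word_inverse_def pres_eq.refl)
next
  case (Cons x w)
  obtain a e where x: "x = (a, e)" by force
  have "pres_eq S R (word_inverse w @ [(a, \<not> e), (a, \<not> \<not> e)] @ w) (word_inverse w @ w)"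
    using Cons.prems x by (intro pres_eq.cancel) auto
  then show ?case using Cons by (auto simp: x word_inverse_def intro: pres_eq.trans)
qed

lemma group_presented_group [simp]: "group (presented_group S R)"
proof (rule groupI)
  fix x assume "x \<in> carrier (presented_group S R)"
  then obtain w where w: "x = pres_class S R w" "w \<in> words S" by (auto simp: carrier_presented_group)
  have "pres_class S R (word_inverse w) \<otimes>\<^bsub>presented_group S R\<^esub> x = \<one>\<^bsub>presented_group S R\<^esub>"
    using w pres_eq_inverse[of w S R] by (simp add: mult_pres_class one_presented_group pres_class_eq_iff)
  with w show "\<exists>y\<in>carrier (presented_group S R). y \<otimes>\<^bsub>presented_group S R\<^esub> x = \<one>\<^bsub>presented_group S R\<^esub>"
    by (auto simp: carrier_presented_group)
qed (auto simp: carrier_presented_group one_presented_group mult_pres_class)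

lemma inv_pres_class:
  assumes "w \<in> words S"
  shows "inv\<^bsub>presented_group S R\<^esub> (pres_class S R w) = pres_class S R (word_inverse w)"
  using assms pres_eq_inverse[OF assms, of R]
  by (intro group.inv_equality[OF group_presented_group])
    (auto simp: carrier_presented_group mult_pres_class one_presented_group pres_class_eq_iff)

lemma pres_class_rel:
  assumes "(l, r) \<in> R" "l \<in> words S" "r \<in> words S"
  shows "pres_class S R l = pres_class S R r"
  using assms pres_eq.rel[of "[]" S "[]" l r R] by (simp add: pres_class_eq_iff)

lemma presented_group_generated:
  assumes "subgroup H (presented_group S R)" "\<And>a. a \<in> S \<Longrightarrow> pres_class S R [(a, True)] \<in> H"
  shows "H = carrier (presented_group S R)"
proof
  show "H \<subseteq> carrier (presented_group S R)" by (rule subgroup.subset[OF assms(1)])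
  have "pres_class S R w \<in> H" if "w \<in> words S" for w
    using that
  proof (induction w)
    case Nil
    show ?case using subgroup.one_closed[OF assms(1)] by (simp add: one_presented_group)
  next
    case (Cons x w)
    obtain a e where x: "x = (a, e)" by force
    have "pres_class S R [(a, e)] \<in> H"
    proof (cases e)
      case False
      have "inv\<^bsub>presented_group S R\<^esub> (pres_class S R [(a, True)]) \<in> H"
        using Cons.prems by (intro subgroup.m_inv_closed[OF assms(1)] assms(2)) (simp add: x)
      then show ?thesis using Cons.prems False by (simp add: x inv_pres_class word_inverse_def)
    qed (use assms(2) Cons.prems x in simp)
    moreover have "pres_class S R w \<in> H" using Cons by (simp add: x)
    ultimately have "pres_class S R [(a, e)] \<otimes>\<^bsub>presented_group S R\<^esub> pres_class S R w \<in> H"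
      by (rule subgroup.m_closed[OF assms(1)])
    then show ?case using Cons.prems by (simp add: x mult_pres_class)
  qed
  then show "carrier (presented_group S R) \<subseteq> H" by (auto simp: carrier_presented_group)
qed

definition word_eval :: "('b, 'c) monoid_scheme \<Rightarrow> ('a \<Rightarrow> 'b) \<Rightarrow> 'a word \<Rightarrow> 'b" where
  "word_eval G f w = foldr (\<lambda>(a, e) z. (if e then f a else inv\<^bsub>G\<^esub> f a) \<otimes>\<^bsub>G\<^esub> z) w \<one>\<^bsub>G\<^esub>"

lemma word_eval_Nil [simp]: "word_eval G f [] = \<one>\<^bsub>G\<^esub>"
  and word_eval_Cons [simp]:
    "word_eval G f ((a, e) # w) = (if e then f a else inv\<^bsub>G\<^esub> f a) \<otimes>\<^bsub>G\<^esub> word_eval G f w"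
  by (simp_all add: word_eval_def)

definition pres_lift :: "('b, 'c) monoid_scheme \<Rightarrow> ('a \<Rightarrow> 'b) \<Rightarrow> 'a word set \<Rightarrow> 'b" where
  "pres_lift G f A = the_elem (word_eval G f ` A)"

text \<open>A function that respects the relations is constant on a class, so its image is a
  singleton. This serves both \<open>pres_lift\<close> and \<open>VT_to_sym\<close>.\<close>

lemma the_elem_pres_class:
  assumes "\<And>v. pres_eq S R w v \<Longrightarrow> h v = h w" "w \<in> words S"
  shows "the_elem (h ` pres_class S R w) = h w"
proof -
  have "h ` pres_class S R w = {h w}"
    using assms by (auto simp: pres_class_def pres_rel_def intro: pres_eq.refl image_eqI[of _ _ w])
  then show ?thesis by simp
qed

context
  fixes G :: "('b, 'c) monoid_scheme" and f :: "'a \<Rightarrow> 'b" and S R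
  assumes G: "group G" and f: "\<And>a. a \<in> S \<Longrightarrow> f a \<in> carrier G"
    and rels: "\<And>l r. (l, r) \<in> R \<Longrightarrow> l \<in> words S \<Longrightarrow> r \<in> words S \<Longrightarrow> word_eval G f l = word_eval G f r"
begin

interpretation G: group G by (rule G)

lemma word_eval_closed: "w \<in> words S \<Longrightarrow> word_eval G f w \<in> carrier G"
  by (induction w) (auto simp: f)

lemma word_eval_append:
  "u \<in> words S \<Longrightarrow> v \<in> words S \<Longrightarrow> word_eval G f (u @ v) = word_eval G f u \<otimes>\<^bsub>G\<^esub> word_eval G f v"
  by (induction u) (auto simp: f G.m_assoc word_eval_closed)

lemma word_eval_pres_eq: "pres_eq S R u v \<Longrightarrow> word_eval G f u = word_eval G f v"
proof (induction rule: pres_eq.induct)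
  case (cancel u v a e)
  have "word_eval G f ([(a, e), (a, \<not> e)] @ v) = word_eval G f v"
    using cancel by (auto simp: f word_eval_closed simp flip: G.m_assoc)
  then show ?case using cancel by (simp add: word_eval_append)
next
  case (rel u v l r)
  then show ?case by (simp add: word_eval_append rels)
qed auto

lemma pres_lift_class: "w \<in> words S \<Longrightarrow> pres_lift G f (pres_class S R w) = word_eval G f w"
  unfolding pres_lift_def by (rule the_elem_pres_class) (auto dest: word_eval_pres_eq)

lemma pres_lift_hom: "pres_lift G f \<in> hom (presented_group S R) G"
  by (rule homI)
    (auto simp: carrier_presented_group pres_lift_class word_eval_closed mult_pres_class word_eval_append)

end

text \<open>The \<open>f i\<close> assemble to a homomorphism from the free product that
  \<open>\<psi>\<close> inverts on the left. As its image is a subgroup containing all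
  \<open>f i a\<close>, it is onto, and both maps are bijective. This is applied to
  \<open>Z2_free3\<close> and to \<open>PVT 4\<close>.\<close>

lemma iso_fprodI:
  fixes \<psi> :: "'g \<Rightarrow> ('i, 'a::group_add) fprod"
  assumes G: "group G" and \<psi>: "\<psi> \<in> hom G additive_group"
    and f: "\<And>i. f i \<in> hom additive_group G" and \<psi>f: "\<And>i a. \<psi> (f i a) = letter i a"
    and gen: "\<And>H. subgroup H G \<Longrightarrow> (\<And>i a. f i a \<in> H) \<Longrightarrow> carrier G \<subseteq> H"
  shows "\<psi> \<in> iso G additive_group"
proof -
  define \<kappa> where "\<kappa> = fprod_lift G f"
  have \<kappa>: "\<kappa> \<in> hom additive_group G"
    unfolding \<kappa>_def by (rule fprod_lift_hom[OF G f])
  have "subgroup (\<kappa> ` carrier additive_group) G"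
    using \<kappa> G by (intro group_hom.img_is_subgroup) (simp add: group_hom_def group_hom_axioms_def)
  then have "carrier G \<subseteq> \<kappa> ` carrier additive_group"
  proof (rule gen)
    show "f i a \<in> \<kappa> ` carrier additive_group" for i a
      by (rule image_eqI[of _ _ "letter i a"]) (simp_all add: \<kappa>_def fprod_lift_letter[OF G f])
  qed
  then have "carrier G \<subseteq> range \<kappa>" by simp
  have "\<psi> \<circ> \<kappa> = id"
  proof (rule add_hom_fprod_eqI)
    show "add_hom (\<psi> \<circ> \<kappa>)" unfolding add_hom_iff using hom_compose[OF \<kappa> \<psi>] .
    show "(\<psi> \<circ> \<kappa>) (letter i a) = id (letter i a)" for i a
      by (simp add: \<kappa>_def \<psi>f fprod_lift_letter[OF G f])
  qed simp
  then have \<psi>\<kappa>: "\<psi> (\<kappa> x) = x" for x by (metis comp_apply id_apply)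
  have "bij_betw \<psi> (carrier G) UNIV"
    unfolding bij_betw_def
  proof
    show "inj_on \<psi> (carrier G)"
      using \<open>carrier G \<subseteq> range \<kappa>\<close> \<psi>\<kappa> by (intro inj_on_inverseI[of _ \<kappa>]) auto
    show "\<psi> ` carrier G = UNIV"
      using \<psi>\<kappa> hom_in_carrier[OF \<kappa>] by (metis UNIV_I carrier_additive_group image_eqI subsetI subset_antisym subset_UNIV)
  qed
  with \<psi> show ?thesis by (simp add: iso_def)
qed

text \<open>In the type \<open>3\<close> the numeral 3 is 0, so the representatives from 1 to 3 are
  fixed by hand; \<open>of_nat\<close> converts back.\<close>

definition index3 :: "3 \<Rightarrow> nat" where
  "index3 i = (if i = 1 then 1 else if i = 2 then 2 else 3)"

lemma index3_bounds [simp]: "Suc 0 \<le> index3 i" "index3 i \<le> 3"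
  by (simp_all add: index3_def)

lemma of_nat_index3 [simp]: "of_nat (index3 i) = i"
  using exhaust_3[of i] by (auto simp: index3_def)

lemma index3_of_nat [simp]: "n \<in> {1..3} \<Longrightarrow> index3 (of_nat n) = n"
proof -
  assume "n \<in> {1..3}"
  then consider "n = 1" | "n = 2" | "n = 3" by fastforce
  then show ?thesis by cases (simp_all add: index3_def)
qed

definition Z2_free3_to_fprod :: "(nat \<times> int \<times> int) word set \<Rightarrow> (3, int^2) fprod" where
  "Z2_free3_to_fprod = pres_lift additive_group (\<lambda>(i, a, b). letter (of_nat i) (vector [a, b]))"

lemma vector_2_add: "vector [a + c, b + d] = (vector [a, b] + vector [c, d] :: int^2)"
  by (simp add: vec_eq_iff forall_2)

lemma vector_2_components: "vector [v $ 1, v $ 2] = (v :: int^2)"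
  by (simp add: vec_eq_iff forall_2)

lemma group_Z2_free3: "group Z2_free3"
  by (simp add: Z2_free3_def free_product_def)

lemma Z2_free3_iso: "Z2_free3_to_fprod \<in> iso Z2_free3 additive_group"
proof -
  define S :: "(nat \<times> int \<times> int) set" where "S = (SIGMA i:{1..3}. carrier (integer_group \<times>\<times> integer_group))"
  define R :: "((nat \<times> int \<times> int) word \<times> (nat \<times> int \<times> int) word) set" where
    "R = {([((i, g), True), ((i, h), True)], [((i, g \<otimes>\<^bsub>integer_group \<times>\<times> integer_group\<^esub> h), True)]) | i g h.
      i \<in> {1..3} \<and> g \<in> carrier (integer_group \<times>\<times> integer_group) \<and> h \<in> carrier (integer_group \<times>\<times> integer_group)}"
  have Z: "Z2_free3 = presented_group S R"
    by (simp add: Z2_free3_def free_product_def S_def R_def)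
  have S: "(i, g) \<in> S \<longleftrightarrow> i \<in> {1..3}" for i g by (auto simp: S_def)
  let ?h = "(\<lambda>(i, a, b). letter (of_nat i) (vector [a, b])) :: _ \<Rightarrow> (3, int^2) fprod"
  have rels: "word_eval additive_group ?h l = word_eval additive_group ?h r" if "(l, r) \<in> R" for l r
    using that by (auto simp: R_def vector_2_add letter_add)
  have hc: "?h a \<in> carrier additive_group" for a by simp
  note lift = pres_lift_hom[OF group_additive_group hc rels] pres_lift_class[OF group_additive_group hc rels]
  define f where "f i v = pres_class S R [((index3 i, v $ 1, v $ 2), True)]" for i :: 3 and v :: "int^2"
  show ?thesis
  proof (rule iso_fprodI[where f = f])
    show "group Z2_free3" by (rule group_Z2_free3)
    show "Z2_free3_to_fprod \<in> hom Z2_free3 additive_group"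
      unfolding Z2_free3_to_fprod_def Z by (rule lift(1))
    show "Z2_free3_to_fprod (f i v) = letter i v" for i v
      unfolding Z2_free3_to_fprod_def f_def
      by (subst lift(2)) (simp_all add: S vector_2_components)
    show "f i \<in> hom additive_group Z2_free3" for i
    proof (rule homI)
      show "f i v \<in> carrier Z2_free3" for v
        by (simp add: Z carrier_presented_group f_def S)
      show "f i (v \<otimes>\<^bsub>additive_group\<^esub> w) = f i v \<otimes>\<^bsub>Z2_free3\<^esub> f i w" for v w
        using pres_class_rel[of "[((index3 i, v $ 1, v $ 2), True), ((index3 i, w $ 1, w $ 2), True)]"
          "[((index3 i, v $ 1 + w $ 1, v $ 2 + w $ 2), True)]" R S]
        by (fastforce simp: Z f_def mult_pres_class S R_def)
    qed
    fix H assume H: "subgroup H Z2_free3" "\<And>i v. f i v \<in> H"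
    have "pres_class S R [(a, True)] \<in> H" if "a \<in> S" for a
    proof -
      obtain i x y where a: "a = (i, x, y)" by (cases a)
      have "pres_class S R [(a, True)] = f (of_nat i) (vector [x, y])"
        using that by (simp add: a S f_def)
      with H(2) show ?thesis by simp
    qed
    then show "carrier Z2_free3 \<subseteq> H"
      using presented_group_generated[of H S R] H(1) by (simp add: Z)
  qed
qed

section \<open>The group \<open>VT 4\<close>\<close>

text \<open>With the six generators as variables of an arbitrary group, the relations become rewrite
  rules and no quotient classes appear in the computations.\<close>

locale vt4_relations = group G for G (structure) +
  fixes r1 r2 r3 s1 s2 s3
  assumes closed [simp]: "r1 \<in> carrier G" "r2 \<in> carrier G" "r3 \<in> carrier G"
    "s1 \<in> carrier G" "s2 \<in> carrier G" "s3 \<in> carrier G"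
  and r_sq: "r1 \<otimes> r1 = \<one>" "r2 \<otimes> r2 = \<one>" "r3 \<otimes> r3 = \<one>"
  and s_sq: "s1 \<otimes> s1 = \<one>" "s2 \<otimes> s2 = \<one>" "s3 \<otimes> s3 = \<one>"
  and far: "s3 \<otimes> s1 = s1 \<otimes> s3" "r3 \<otimes> r1 = r1 \<otimes> r3" "r1 \<otimes> s3 = s3 \<otimes> r1" "r3 \<otimes> s1 = s1 \<otimes> r3"
  and braid: "r1 \<otimes> r2 \<otimes> r1 = r2 \<otimes> r1 \<otimes> r2" "r2 \<otimes> r3 \<otimes> r2 = r3 \<otimes> r2 \<otimes> r3"
  and mixed: "r1 \<otimes> r2 \<otimes> s1 = s2 \<otimes> r1 \<otimes> r2" "r2 \<otimes> r3 \<otimes> s2 = s3 \<otimes> r2 \<otimes> r3"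
begin

text \<open>In words associated to the right, a product \<open>a \<otimes> b\<close> occurs inside
  \<open>a \<otimes> (b \<otimes> x)\<close>; this extends a relation to that form.\<close>

lemma mult_tail2: "a \<otimes> b = c \<Longrightarrow> a \<in> carrier G \<Longrightarrow> b \<in> carrier G \<Longrightarrow> x \<in> carrier G \<Longrightarrow> a \<otimes> (b \<otimes> x) = c \<otimes> x"
  using m_assoc by metis

lemma sq_tail:
  assumes "x \<in> carrier G"
  shows "r1 \<otimes> (r1 \<otimes> x) = x" "r2 \<otimes> (r2 \<otimes> x) = x" "r3 \<otimes> (r3 \<otimes> x) = x"
    "s1 \<otimes> (s1 \<otimes> x) = x" "s2 \<otimes> (s2 \<otimes> x) = x" "s3 \<otimes> (s3 \<otimes> x) = x"
  using assms by (simp_all add: mult_tail2[OF r_sq(1)] mult_tail2[OF r_sq(2)] mult_tail2[OF r_sq(3)]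
      mult_tail2[OF s_sq(1)] mult_tail2[OF s_sq(2)] mult_tail2[OF s_sq(3)])

lemma far_tail:
  assumes "x \<in> carrier G"
  shows "s3 \<otimes> (s1 \<otimes> x) = s1 \<otimes> (s3 \<otimes> x)" "r3 \<otimes> (r1 \<otimes> x) = r1 \<otimes> (r3 \<otimes> x)"
    "r1 \<otimes> (s3 \<otimes> x) = s3 \<otimes> (r1 \<otimes> x)" "r3 \<otimes> (s1 \<otimes> x) = s1 \<otimes> (r3 \<otimes> x)"
  using assms by (simp_all add: mult_tail2[OF far(1)] mult_tail2[OF far(2)] mult_tail2[OF far(3)] mult_tail2[OF far(4)] m_assoc)

lemma braid':
  "r1 \<otimes> (r2 \<otimes> r1) = r2 \<otimes> (r1 \<otimes> r2)" "r2 \<otimes> (r3 \<otimes> r2) = r3 \<otimes> (r2 \<otimes> r3)"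
  using braid by (simp_all add: m_assoc)

lemma braid_tail:
  assumes "x \<in> carrier G"
  shows "r1 \<otimes> (r2 \<otimes> (r1 \<otimes> x)) = r2 \<otimes> (r1 \<otimes> (r2 \<otimes> x))" "r2 \<otimes> (r3 \<otimes> (r2 \<otimes> x)) = r3 \<otimes> (r2 \<otimes> (r3 \<otimes> x))"
  using mult_tail2[OF braid(1) _ _ assms] mult_tail2[OF braid(2) _ _ assms] assms by (simp_all add: m_assoc)

text \<open>A completion rule. The word r3 r1 r2 r1 can be rewritten by commuting r3 past r1 or by
  the braid relation; this joins the two results.\<close>

lemma long_braid_tail:
  assumes "x \<in> carrier G"
  shows "r1 \<otimes> (r3 \<otimes> (r2 \<otimes> (r1 \<otimes> x))) = r3 \<otimes> (r2 \<otimes> (r1 \<otimes> (r2 \<otimes> x)))"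
proof -
  have "r1 \<otimes> (r3 \<otimes> (r2 \<otimes> (r1 \<otimes> x))) = r3 \<otimes> (r1 \<otimes> (r2 \<otimes> (r1 \<otimes> x)))"
    using assms by (simp add: far_tail)
  then show ?thesis using assms by (simp add: braid_tail)
qed

lemma long_braid: "r1 \<otimes> (r3 \<otimes> (r2 \<otimes> r1)) = r3 \<otimes> (r2 \<otimes> (r1 \<otimes> r2))"
  using long_braid_tail[of \<one>] by simp

lemma s2_eq: "s2 = r1 \<otimes> (r2 \<otimes> (s1 \<otimes> (r2 \<otimes> r1)))"
proof -
  have "r1 \<otimes> (r2 \<otimes> (s1 \<otimes> (r2 \<otimes> r1))) = (r1 \<otimes> r2 \<otimes> s1) \<otimes> (r2 \<otimes> r1)"
    by (simp add: m_assoc)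
  also have "\<dots> = s2" unfolding mixed by (simp add: m_assoc sq_tail r_sq)
  finally show ?thesis by simp
qed

lemma s3_eq: "s3 = r2 \<otimes> (r3 \<otimes> (s2 \<otimes> (r3 \<otimes> r2)))"
proof -
  have "r2 \<otimes> (r3 \<otimes> (s2 \<otimes> (r3 \<otimes> r2))) = (r2 \<otimes> r3 \<otimes> s2) \<otimes> (r3 \<otimes> r2)"
    by (simp add: m_assoc)
  also have "\<dots> = s3" unfolding mixed by (simp add: m_assoc sq_tail r_sq)
  finally show ?thesis by simp
qed

text \<open>Together with \<open>s2_eq\<close> and \<open>s3_eq\<close>, these rules rewrite a word in \<open>s1\<close> and the \<open>r\<close>'s so that
  \<open>r3\<close> moves to the right; on words in the \<open>r\<close>'s they are confluent.\<close>

lemmas rewrite = m_assoc r_sq s_sq sq_tail far(2,4) far_tail(2,4) braid' braid_tail long_braid long_braid_tail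

section \<open>The elements lambda, their conjugates and the subgroup that they generate\<close>

definition L12 where "L12 = s1 \<otimes> r1"
definition L13 where "L13 = r2 \<otimes> (s1 \<otimes> (r1 \<otimes> r2))"
definition L14 where "L14 = r3 \<otimes> (r2 \<otimes> (s1 \<otimes> (r1 \<otimes> (r2 \<otimes> r3))))"
definition L23 where "L23 = s2 \<otimes> r2"
definition L24 where "L24 = r3 \<otimes> (s2 \<otimes> (r2 \<otimes> r3))"
definition L34 where "L34 = s3 \<otimes> r3"

lemmas L_defs = L12_def L13_def L14_def L23_def L24_def L34_def

lemma L_closed [simp]: "L12 \<in> carrier G" "L13 \<in> carrier G" "L14 \<in> carrier G"
   "L23 \<in> carrier G" "L24 \<in> carrier G" "L34 \<in> carrier G"
  by (simp_all add: L_defs)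

text \<open>With the corresponding facts for \<open>r2\<close> and \<open>r3\<close>, this makes the
  subgroup generated by the lambdas invariant under conjugation by the r's. An inverse arises when
  the transposition reverses the two indices of a lambda.\<close>

lemma conj_r1:
  "r1 \<otimes> L12 \<otimes> r1 = inv L12" "r1 \<otimes> L34 \<otimes> r1 = L34" "r1 \<otimes> L13 \<otimes> r1 = L23"
  "r1 \<otimes> L23 \<otimes> r1 = L13" "r1 \<otimes> L14 \<otimes> r1 = L24" "r1 \<otimes> L24 \<otimes> r1 = L14"
proof -
  have "r1 \<otimes> L12 \<otimes> r1 \<otimes> L12 = \<one>" by (simp add: L12_def rewrite)
  then show "r1 \<otimes> L12 \<otimes> r1 = inv L12" by (intro inv_equality[symmetric]) simp_all
qed (unfold L_defs, unfold s3_eq, unfold s2_eq, simp_all add: rewrite)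

lemma conj_r2:
  "r2 \<otimes> L12 \<otimes> r2 = L13" "r2 \<otimes> L13 \<otimes> r2 = L12" "r2 \<otimes> L34 \<otimes> r2 = L24"
  "r2 \<otimes> L24 \<otimes> r2 = L34" "r2 \<otimes> L14 \<otimes> r2 = L14" "r2 \<otimes> L23 \<otimes> r2 = inv L23"
proof -
  have "r2 \<otimes> L23 \<otimes> r2 \<otimes> L23 = \<one>" by (simp add: L23_def rewrite)
  then show "r2 \<otimes> L23 \<otimes> r2 = inv L23" by (intro inv_equality[symmetric]) simp_all
qed (unfold L_defs, unfold s3_eq, unfold s2_eq, simp_all add: rewrite)

lemma conj_r3:
  "r3 \<otimes> L12 \<otimes> r3 = L12" "r3 \<otimes> L34 \<otimes> r3 = inv L34" "r3 \<otimes> L13 \<otimes> r3 = L14"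
  "r3 \<otimes> L14 \<otimes> r3 = L13" "r3 \<otimes> L23 \<otimes> r3 = L24" "r3 \<otimes> L24 \<otimes> r3 = L23"
proof -
  have "r3 \<otimes> L34 \<otimes> r3 \<otimes> L34 = \<one>" by (simp add: L34_def rewrite)
  then show "r3 \<otimes> L34 \<otimes> r3 = inv L34" by (intro inv_equality[symmetric]) simp_all
qed (unfold L_defs, unfold s2_eq, simp_all add: rewrite)

lemma conj_mult:
  assumes "r \<otimes> r = \<one>" "r \<in> carrier G" "x \<in> carrier G" "y \<in> carrier G"
  shows "r \<otimes> (x \<otimes> y) \<otimes> r = (r \<otimes> x \<otimes> r) \<otimes> (r \<otimes> y \<otimes> r)"
proof -
  have "(r \<otimes> x \<otimes> r) \<otimes> (r \<otimes> y \<otimes> r) = r \<otimes> x \<otimes> (r \<otimes> r) \<otimes> y \<otimes> r"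
    using assms(2-) by (simp add: m_assoc)
  then show ?thesis using assms by (simp add: m_assoc)
qed

text \<open>Only the first identity comes from the far commutation relations; conjugation by
  \<open>r2\<close> and then by \<open>r3\<close> carries it to the other two.\<close>

lemma L_commute: "L12 \<otimes> L34 = L34 \<otimes> L12" "L13 \<otimes> L24 = L24 \<otimes> L13" "L14 \<otimes> L23 = L23 \<otimes> L14"
proof -
  show 1: "L12 \<otimes> L34 = L34 \<otimes> L12"
    by (simp add: L12_def L34_def m_assoc far far_tail)
  show 2: "L13 \<otimes> L24 = L24 \<otimes> L13"
    unfolding conj_r2(1,3)[symmetric] by (simp add: 1 flip: conj_mult[OF r_sq(2)])
  show "L14 \<otimes> L23 = L23 \<otimes> L14"
    unfolding conj_r3(3,6)[symmetric] by (simp add: 2 flip: conj_mult[OF r_sq(3)])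
qed

definition Ls where "Ls = {L12, L13, L14, L23, L24, L34}"

lemma generate_conj_closed:
  assumes "r \<otimes> r = \<one>" "r \<in> carrier G" "A \<subseteq> carrier G" "\<And>x. x \<in> A \<Longrightarrow> r \<otimes> x \<otimes> r \<in> generate G A"
    "y \<in> generate G A"
  shows "r \<otimes> y \<otimes> r \<in> generate G A"
  using assms(5)
proof (induction rule: generate.induct)
  case one
  then show ?case using assms(1,2) generate.one[of G A] by simp
next
  case (inv h)
  have "inv r = r" using assms(1,2) by (simp add: inv_equality)
  then have "r \<otimes> inv h \<otimes> r = inv (r \<otimes> h \<otimes> r)"
    using inv assms(2,3) by (simp add: inv_mult_group m_assoc subsetD)
  then show ?case
    using generate_m_inv_closed[OF assms(3)] assms(4)[OF inv] by simp
next
  case (eng h1 h2)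
  then show ?case
    using generate_in_carrier[OF assms(3)] assms(1,2) by (simp add: conj_mult generate.eng)
qed (use assms in auto)

lemma Ls_conj_closed:
  assumes "r \<in> {r1, r2, r3}" "y \<in> generate G Ls"
  shows "r \<otimes> y \<otimes> r \<in> generate G Ls"
proof (rule generate_conj_closed[OF _ _ _ _ assms(2)])
  show "r \<otimes> r = \<one>" "r \<in> carrier G" using assms(1) r_sq by auto
  show "Ls \<subseteq> carrier G" by (simp add: Ls_def)
  show "r \<otimes> x \<otimes> r \<in> generate G Ls" if "x \<in> Ls" for x
    using assms(1) that
    by (auto simp: Ls_def conj_r1 conj_r2 conj_r3 intro: generate.incl generate.inv)
qed

text \<open>Representatives of the cosets of \<open>S\<^sub>3\<close> in \<open>S\<^sub>4\<close>, of \<open>S\<^sub>2\<close> in \<open>S\<^sub>3\<close> and of the trivial group in \<open>S\<^sub>2\<close>.\<close>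

definition W3 where "W3 = {\<one>, r3, r2 \<otimes> r3, r1 \<otimes> (r2 \<otimes> r3)}"
definition W2 where "W2 = {\<one>, r2, r1 \<otimes> r2}"
definition W1 where "W1 = {\<one>, r1}"

lemma W_closed: "w \<in> W3 \<Longrightarrow> w \<in> carrier G" "w \<in> W2 \<Longrightarrow> w \<in> carrier G" "w \<in> W1 \<Longrightarrow> w \<in> carrier G"
  by (auto simp: W3_def W2_def W1_def)

lemma W1_mult: "w \<in> W1 \<Longrightarrow> r1 \<otimes> w \<in> W1"
  by (auto simp: W1_def r_sq)

text \<open>A generator times a coset representative is either another representative or a
  representative times a generator of the smaller symmetric group, which is then passed on to the
  next level. \<open>W3_mult\<close> has the same pattern one level higher.\<close>

lemma W2_mult:
  assumes "r \<in> {r1, r2}" "w \<in> W2"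
  shows "r \<otimes> w \<in> W2 \<or> (\<exists>v\<in>W2. r \<otimes> w = v \<otimes> r1)"
proof -
  have "r2 \<otimes> (r1 \<otimes> r2) = r1 \<otimes> r2 \<otimes> r1" by (simp add: m_assoc braid')
  then show ?thesis using assms by (auto simp: W2_def r_sq sq_tail)
qed

lemma W3_mult:
  assumes "r \<in> {r1, r2, r3}" "w \<in> W3"
  shows "r \<otimes> w \<in> W3 \<or> (\<exists>v\<in>W3. \<exists>q\<in>{r1, r2}. r \<otimes> w = v \<otimes> q)"
proof -
  have "r3 \<otimes> (r2 \<otimes> r3) = r2 \<otimes> r3 \<otimes> r2" "r2 \<otimes> (r1 \<otimes> (r2 \<otimes> r3)) = r1 \<otimes> (r2 \<otimes> r3) \<otimes> r1"
    "r3 \<otimes> (r1 \<otimes> (r2 \<otimes> r3)) = r1 \<otimes> (r2 \<otimes> r3) \<otimes> r2" "r1 \<otimes> r3 = r3 \<otimes> r1"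
    by (simp_all add: rewrite)
  then show ?thesis
    using assms by (auto simp: W3_def r_sq sq_tail)
qed

text \<open>The subgroup generated by \<open>r1\<close>, \<open>r2\<close>, \<open>r3\<close>,
  written along the chain from S_1 to S_4.\<close>

definition W where "W = {w3 \<otimes> (w2 \<otimes> w1) | w3 w2 w1. w3 \<in> W3 \<and> w2 \<in> W2 \<and> w1 \<in> W1}"

lemma W_mult:
  assumes r: "r \<in> {r1, r2, r3}" and "w \<in> W"
  shows "r \<otimes> w \<in> W"
proof -
  obtain w3 w2 w1 where w: "w = w3 \<otimes> (w2 \<otimes> w1)" "w3 \<in> W3" "w2 \<in> W2" "w1 \<in> W1"
    using assms(2) by (auto simp: W_def)
  have [simp]: "r \<in> carrier G" "w3 \<in> carrier G" "w2 \<in> carrier G" "w1 \<in> carrier G"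
    using r w by (auto intro: W_closed)
  have in_W: "x \<otimes> (y \<otimes> z) \<in> W" if "x \<in> W3" "y \<in> W2" "z \<in> W1" for x y z
    using that by (auto simp: W_def)
  have *: "v \<otimes> (q \<otimes> (w2 \<otimes> w1)) \<in> W" if "v \<in> W3" "q \<in> {r1, r2}" for v q
  proof -
    have [simp]: "q \<in> carrier G" "v \<in> carrier G" using that W_closed by auto
    from W2_mult[OF that(2) w(3)] show ?thesis
    proof
      assume "q \<otimes> w2 \<in> W2"
      then have "v \<otimes> ((q \<otimes> w2) \<otimes> w1) \<in> W" using that w by (intro in_W)
      then show ?thesis by (simp add: m_assoc)
    next
      assume "\<exists>u\<in>W2. q \<otimes> w2 = u \<otimes> r1"
      then obtain u where u: "u \<in> W2" "q \<otimes> w2 = u \<otimes> r1" by blast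
      have "q \<otimes> (w2 \<otimes> w1) = u \<otimes> (r1 \<otimes> w1)"
        using u W_closed(2)[OF u(1)] by (simp flip: m_assoc)
      then show ?thesis using that u w W1_mult by (simp add: in_W)
    qed
  qed
  from W3_mult[OF r w(2)] show ?thesis
  proof
    assume "r \<otimes> w3 \<in> W3"
    then have "(r \<otimes> w3) \<otimes> (w2 \<otimes> w1) \<in> W" using w by (intro in_W)
    then show ?thesis by (simp add: w m_assoc)
  next
    assume "\<exists>v\<in>W3. \<exists>q\<in>{r1, r2}. r \<otimes> w3 = v \<otimes> q"
    then obtain v q where v: "v \<in> W3" "q \<in> {r1, r2}" "r \<otimes> w3 = v \<otimes> q" by blast
    have [simp]: "v \<in> carrier G" "q \<in> carrier G" using v W_closed by auto
    have "r \<otimes> w = (r \<otimes> w3) \<otimes> (w2 \<otimes> w1)" by (simp add: w m_assoc)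
    also have "\<dots> = v \<otimes> (q \<otimes> (w2 \<otimes> w1))" by (simp add: v m_assoc)
    finally show ?thesis using *[OF v(1,2)] by simp
  qed
qed

lemma W_carrier: "w \<in> W \<Longrightarrow> w \<in> carrier G"
  by (auto simp: W_def dest: W_closed)

lemma set_multI: "x \<in> A \<Longrightarrow> y \<in> B \<Longrightarrow> x \<otimes> y \<in> A <#> B"
  by (auto simp: set_mult_def)

text \<open>An r passes through the subgroup of the lambdas by conjugation and is absorbed by
  \<open>W\<close>; each s is a lambda times the r of the same index. So every element of the group
  generated by the six elements has this form.\<close>

lemma normal_form_mult:
  assumes "x \<in> generate G Ls <#> W" "r \<in> {r1, r2, r3, s1, s2, s3}"
  shows "r \<otimes> x \<in> generate G Ls <#> W"
proof -
  have Ls: "Ls \<subseteq> carrier G" by (simp add: Ls_def)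
  have r: "r \<otimes> y \<in> generate G Ls <#> W"
    if r: "r \<in> {r1, r2, r3}" and y: "y \<in> generate G Ls <#> W" for r y
  proof -
    obtain h w where y: "y = h \<otimes> w" "h \<in> generate G Ls" "w \<in> W"
      using y by (auto simp: set_mult_def)
    have [simp]: "h \<in> carrier G" "w \<in> carrier G" "r \<in> carrier G"
      using y r generate_in_carrier[OF Ls] by (auto intro: W_carrier)
    have rr: "r \<otimes> r = \<one>" using r r_sq by auto
    have "(r \<otimes> h \<otimes> r) \<otimes> (r \<otimes> w) = r \<otimes> h \<otimes> (r \<otimes> r) \<otimes> w" by (simp add: m_assoc)
    also have "\<dots> = r \<otimes> y" by (simp add: rr y m_assoc)
    finally show ?thesis
      using set_multI[OF Ls_conj_closed[OF r y(2)] W_mult[OF r y(3)]] by simp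
  qed
  have L: "a \<otimes> y \<in> generate G Ls <#> W" if a: "a \<in> Ls" and y: "y \<in> generate G Ls <#> W" for a y
  proof -
    obtain h w where y: "y = h \<otimes> w" "h \<in> generate G Ls" "w \<in> W"
      using y by (auto simp: set_mult_def)
    have "a \<otimes> y = (a \<otimes> h) \<otimes> w"
      using y a Ls generate_in_carrier[OF Ls y(2)] by (auto simp: m_assoc W_carrier)
    then show ?thesis
      using set_multI[OF generate.eng[OF generate.incl[OF a] y(2)] y(3)] by simp
  qed
  have xc: "x \<in> carrier G"
    using assms(1) generate_in_carrier[OF Ls] by (auto simp: set_mult_def W_carrier)
  have s: "s1 \<otimes> x = L12 \<otimes> (r1 \<otimes> x)" "s2 \<otimes> x = L23 \<otimes> (r2 \<otimes> x)" "s3 \<otimes> x = L34 \<otimes> (r3 \<otimes> x)"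
    using xc by (simp_all add: L_defs m_assoc sq_tail)
  have "L12 \<otimes> (r1 \<otimes> x) \<in> generate G Ls <#> W" "L23 \<otimes> (r2 \<otimes> x) \<in> generate G Ls <#> W"
    "L34 \<otimes> (r3 \<otimes> x) \<in> generate G Ls <#> W"
    by (rule L, simp add: Ls_def, rule r, simp, rule assms(1))+
  with r[OF _ assms(1)] assms(2) show ?thesis by (auto simp: s)
qed

end

section \<open>The group \<open>PVT 4\<close>\<close>

abbreviation VT4_class :: "vt_gen word \<Rightarrow> vt_gen word set" where
  "VT4_class \<equiv> pres_class (VT_gens 4) (VT_rels 4)"

lemma VT_gens_4: "TwinGen k \<in> VT_gens 4 \<longleftrightarrow> k \<in> {1, 2, 3}" "RhoGen k \<in> VT_gens 4 \<longleftrightarrow> k \<in> {1, 2, 3}"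
  by (auto simp: VT_gens_def)

lemma group_VT [simp]: "group (VT n)"
  by (simp add: VT_def)

interpretation VT4: vt4_relations "VT 4" "VT4_class [\<rho>_let (Suc 0)]" "VT4_class [\<rho>_let 2]" "VT4_class [\<rho>_let 3]"
    "VT4_class [s_let (Suc 0)]" "VT4_class [s_let 2]" "VT4_class [s_let 3]"
proof (intro vt4_relations.intro group_VT vt4_relations_axioms.intro)
  show "VT4_class [\<rho>_let (Suc 0)] \<in> carrier (VT 4)" "VT4_class [\<rho>_let 2] \<in> carrier (VT 4)"
    "VT4_class [\<rho>_let 3] \<in> carrier (VT 4)" "VT4_class [s_let (Suc 0)] \<in> carrier (VT 4)"
    "VT4_class [s_let 2] \<in> carrier (VT 4)" "VT4_class [s_let 3] \<in> carrier (VT 4)"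
    by (simp_all add: VT_def carrier_presented_group VT_gens_4)
qed (simp_all add: VT_def mult_pres_class VT_gens_4 one_presented_group,
    (rule pres_class_rel, force simp: VT_rels_def, simp add: VT_gens_4, simp add: VT_gens_4)+)

lemma lam_4:
  "lam 4 (1, 2) = VT4.L12" "lam 4 (1, 3) = VT4.L13" "lam 4 (1, 4) = VT4.L14"
  "lam 4 (2, 3) = VT4.L23" "lam 4 (2, 4) = VT4.L24" "lam 4 (3, 4) = VT4.L34"
  unfolding VT4.L_defs
  by (simp_all add: lam_def VT_elem_def VT_def mult_pres_class VT_gens_4 upt_rec numeral_2_eq_2[symmetric] numeral_3_eq_3[symmetric]
      flip: pres_class_def)

lemma word_perm_append: "word_perm (u @ v) = word_perm u \<circ> word_perm v"
  by (induction u) (auto simp: word_perm_def)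

lemma word_perm_Cons: "word_perm ((a, e) # w) = gen_perm a \<circ> word_perm w"
  by (simp add: word_perm_def)

lemma word_perm_Nil [simp]: "word_perm [] = id"
  by (simp add: word_perm_def)

lemma gen_perm_gen_perm: "gen_perm a \<circ> gen_perm a = id"
  by (cases a) (simp_all add: fun_eq_iff)

lemma word_perm_pres_eq: "pres_eq (VT_gens n) (VT_rels n) u v \<Longrightarrow> word_perm u = word_perm v"
proof (induction rule: pres_eq.induct)
  case (cancel u v a e)
  show ?case by (simp add: word_perm_append word_perm_Cons gen_perm_gen_perm flip: comp_assoc)
next
  case (rel u v l r)
  have "word_perm l = word_perm r"
    using rel(5) by (auto simp: VT_rels_def word_perm_Cons fun_eq_iff Transposition.transpose_def)
  then show ?case by (simp add: word_perm_append)
qed auto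

lemma VT_to_sym_class: "w \<in> words (VT_gens 4) \<Longrightarrow> VT_to_sym (VT4_class w) = word_perm w"
  unfolding VT_to_sym_def by (rule the_elem_pres_class) (auto dest: word_perm_pres_eq)

lemma word_perm_permutes: "w \<in> words (VT_gens 4) \<Longrightarrow> word_perm w permutes {1..4}"
proof (induction w)
  case (Cons x w)
  obtain a e where x: "x = (a, e)" by force
  have "gen_perm a permutes {1..4}"
    using Cons.prems by (cases a) (auto simp: x VT_gens_4 intro!: permutes_swap_id)
  moreover have "word_perm w permutes {1..4}" using Cons x by simp
  ultimately show ?case unfolding x word_perm_Cons by (intro permutes_compose)
qed (simp add: permutes_id)

lemma VT_to_sym_hom: "VT_to_sym \<in> hom (VT 4) (sym_group 4)"
  by (rule homI)
    (auto simp: VT_def carrier_presented_group mult_pres_class VT_to_sym_class word_perm_append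
      sym_group_carrier sym_group_mult word_perm_permutes simp del: One_nat_def)

lemma subgroup_kernel_VT: "subgroup (kernel (VT 4) (sym_group 4) VT_to_sym) (VT 4)"
  by (rule group_hom.subgroup_kernel)
    (simp add: group_hom_def group_hom_axioms_def VT_to_sym_hom sym_group_is_group)

lemma group_PVT [simp]: "group (PVT 4)"
  unfolding PVT_def by (rule subgroup.subgroup_is_group[OF subgroup_kernel_VT group_VT])

text \<open>The factor from \<open>W3\<close> is recognised by where it sends 4, since the others
  fix 4; next the factor from \<open>W2\<close> by where it sends 3, and finally the one from
  \<open>W1\<close> by where it sends 1.\<close>

lemma VT_to_sym_W:
  assumes "w \<in> VT4.W" "VT_to_sym w = id"
  shows "w = \<one>\<^bsub>VT 4\<^esub>"
proof -
  obtain w3 w2 w1 where w: "w = w3 \<otimes>\<^bsub>VT 4\<^esub> (w2 \<otimes>\<^bsub>VT 4\<^esub> w1)" "w3 \<in> VT4.W3" "w2 \<in> VT4.W2" "w1 \<in> VT4.W1"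
    using assms(1) by (auto simp: VT4.W_def)
  have r: "VT_to_sym (VT4_class [\<rho>_let k]) = Transposition.transpose k (k + 1)" if "k \<in> {1, 2, 3}" for k
    using that by (subst VT_to_sym_class) (auto simp: VT_gens_4 word_perm_Cons)
  have one: "VT_to_sym \<one>\<^bsub>VT 4\<^esub> = id"
    by (simp add: VT_def one_presented_group VT_to_sym_class)
  have mult: "VT_to_sym (x \<otimes>\<^bsub>VT 4\<^esub> y) = VT_to_sym x \<circ> VT_to_sym y" if "x \<in> carrier (VT 4)" "y \<in> carrier (VT 4)" for x y
    using hom_mult[OF VT_to_sym_hom that] by (simp add: sym_group_mult)
  have cl: "w3 \<in> carrier (VT 4)" "w2 \<in> carrier (VT 4)" "w1 \<in> carrier (VT 4)"
    using w VT4.W_closed by auto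
  have eq: "VT_to_sym w3 (VT_to_sym w2 (VT_to_sym w1 i)) = i" for i
    using assms(2) cl by (simp add: w(1) mult fun_eq_iff)
  note simps = r one mult Transposition.transpose_def
  have "VT_to_sym w1 4 = 4" "VT_to_sym w2 4 = 4" "VT_to_sym w1 3 = 3"
    using w(3,4) by (auto simp: VT4.W1_def VT4.W2_def simps)
  with eq[of 4] eq[of 3] have 3: "VT_to_sym w3 4 = 4" and 2: "VT_to_sym w3 (VT_to_sym w2 3) = 3" by auto
  from 3 w(2) have w3: "w3 = \<one>\<^bsub>VT 4\<^esub>" by (auto simp: VT4.W3_def simps)
  with 2 w(3) have w2: "w2 = \<one>\<^bsub>VT 4\<^esub>" by (auto simp: VT4.W2_def simps)
  with eq[of 1] w3 w(4) have "w1 = \<one>\<^bsub>VT 4\<^esub>" by (auto simp: VT4.W1_def simps)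
  with w(1) w2 w3 show ?thesis by simp
qed

text \<open>The nontrivial inclusion writes a kernel element as a product of lambdas times an
  element of \<open>W\<close>; the latter has trivial permutation, hence is the identity.\<close>

lemma carrier_PVT: "carrier (PVT 4) = generate (VT 4) VT4.Ls"
proof
  have Ls: "VT4.Ls \<subseteq> carrier (VT 4)" by (simp add: VT4.Ls_def)
  let ?K = "kernel (VT 4) (sym_group 4) VT_to_sym"
  have "VT4.Ls \<subseteq> ?K"
    unfolding VT4.Ls_def kernel_def
    unfolding VT4.L_defs
    by (auto simp: VT_def mult_pres_class VT_gens_4 carrier_presented_group VT_to_sym_class sym_group_one
        word_perm_Cons fun_eq_iff)
  then have K: "generate (VT 4) VT4.Ls \<subseteq> ?K"
    by (rule VT4.generate_subgroup_incl[OF _ subgroup_kernel_VT])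
  then show "generate (VT 4) VT4.Ls \<subseteq> carrier (PVT 4)" by (simp add: PVT_def)
  have nf: "VT4_class w \<in> generate (VT 4) VT4.Ls <#>\<^bsub>VT 4\<^esub> VT4.W" if "w \<in> words (VT_gens 4)" for w
    using that
  proof (induction w)
    case Nil
    have "\<one>\<^bsub>VT 4\<^esub> \<in> VT4.W"
      using VT4.r_one[OF VT4.one_closed]
      by (auto simp: VT4.W_def VT4.W1_def VT4.W2_def VT4.W3_def intro!: exI[of _ "\<one>\<^bsub>VT 4\<^esub>"])
    from VT4.set_multI[OF generate.one[of "VT 4" VT4.Ls] this]
    have "\<one>\<^bsub>VT 4\<^esub> \<in> generate (VT 4) VT4.Ls <#>\<^bsub>VT 4\<^esub> VT4.W" by simp
    moreover have "VT4_class [] = \<one>\<^bsub>VT 4\<^esub>" by (simp add: VT_def one_presented_group)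
    ultimately show ?case by simp
  next
    case (Cons x w)
    obtain a e where x: "x = (a, e)" by force
    have a: "a \<in> VT_gens 4" "w \<in> words (VT_gens 4)" using Cons.prems by (auto simp: x)
    then have "a \<in> {RhoGen 1, RhoGen 2, RhoGen 3, TwinGen 1, TwinGen 2, TwinGen 3}"
      by (cases a) (auto simp: VT_gens_4)
    then have mem: "VT4_class [(a, True)] \<in> {VT4_class [\<rho>_let (Suc 0)], VT4_class [\<rho>_let 2], VT4_class [\<rho>_let 3],
      VT4_class [s_let (Suc 0)], VT4_class [s_let 2], VT4_class [s_let 3]}" by auto
    \<comment> \<open>All generators are involutions, so a letter and its formal inverse have the
      same class.\<close>
    then have "VT4_class [(a, True)] \<otimes>\<^bsub>VT 4\<^esub> VT4_class [(a, True)] = \<one>\<^bsub>VT 4\<^esub>"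
      using VT4.r_sq VT4.s_sq by auto
    then have "inv\<^bsub>VT 4\<^esub> VT4_class [(a, True)] = VT4_class [(a, True)]"
      using mem by (intro VT4.inv_equality) auto
    moreover have "inv\<^bsub>VT 4\<^esub> VT4_class [(a, True)] = VT4_class [(a, False)]"
      using a by (simp add: VT_def inv_pres_class word_inverse_def)
    ultimately have "VT4_class [(a, e)] = VT4_class [(a, True)]" by (cases e) auto
    moreover have "VT4_class [(a, e)] \<otimes>\<^bsub>VT 4\<^esub> VT4_class w = VT4_class (x # w)"
      using a by (simp add: VT_def mult_pres_class x)
    ultimately show ?case
      using VT4.normal_form_mult[OF Cons.IH[OF a(2)] mem] by simp
  qed
  show "carrier (PVT 4) \<subseteq> generate (VT 4) VT4.Ls"
  proof
    fix x assume x: "x \<in> carrier (PVT 4)"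
    then obtain w where w: "x = VT4_class w" "w \<in> words (VT_gens 4)" and x1: "VT_to_sym x = id"
      by (auto simp: PVT_def kernel_def VT_def carrier_presented_group sym_group_one)
    obtain h v where hv: "x = h \<otimes>\<^bsub>VT 4\<^esub> v" "h \<in> generate (VT 4) VT4.Ls" "v \<in> VT4.W"
      using nf[OF w(2)] by (auto simp: set_mult_def w(1))
    have "h \<in> ?K" using hv(2) K by blast
    then have h: "h \<in> carrier (VT 4)" "VT_to_sym h = id" by (auto simp: kernel_def sym_group_one)
    have "VT_to_sym v = id"
      using hom_mult[OF VT_to_sym_hom h(1) VT4.W_carrier[OF hv(3)]] x1 h(2) by (simp add: hv(1) sym_group_mult)
    then have "v = \<one>\<^bsub>VT 4\<^esub>" by (rule VT_to_sym_W[OF hv(3)])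
    with hv h show "x \<in> generate (VT 4) VT4.Ls" by simp
  qed
qed

section \<open>The affine action of \<open>VT 4\<close> on the free product\<close>

type_synonym F = "(3, int^2) fprod"

definition perm_group :: "('g \<Rightarrow> 'g) monoid" where
  "perm_group = \<lparr>carrier = {f. bij f}, monoid.mult = (\<circ>), one = id\<rparr>"

lemma perm_group_simps [simp]: "f \<in> carrier perm_group \<longleftrightarrow> bij f"
  "monoid.mult perm_group = (\<circ>)" "one perm_group = id"
  by (simp_all add: perm_group_def)

lemma group_perm_group [simp]: "group perm_group"
proof (rule groupI, goal_cases)
  case (5 f)
  then have "bij (inv_into UNIV f)" "inv_into UNIV f \<circ> f = id"
    by (simp_all add: bij_is_inj bij_imp_bij_inv)
  then show ?case by auto
qed (auto simp: bij_comp comp_assoc)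

text \<open>In the factor \<open>i\<close>, the vector \<open>e1\<close> stands for x_i and
  \<open>e2\<close> for y_i.\<close>

definition e1 :: "int^2" where "e1 = vector [1, 0]"
definition e2 :: "int^2" where "e2 = vector [0, 1]"

lemma e1_e2 [simp]: "e1 $ 1 = 1" "e1 $ 2 = 0" "e2 $ 1 = 0" "e2 $ 2 = 1"
  by (simp_all add: e1_def e2_def)

definition neg1 :: "int^2 \<Rightarrow> int^2" where "neg1 v = vector [- v $ 1, v $ 2]"
definition neg2 :: "int^2 \<Rightarrow> int^2" where "neg2 v = vector [v $ 1, - v $ 2]"
definition swap :: "int^2 \<Rightarrow> int^2" where "swap v = vector [v $ 2, v $ 1]"

lemma neg_swap [simp]:
  "neg1 v $ 1 = - v $ 1" "neg1 v $ 2 = v $ 2" "neg2 v $ 1 = v $ 1" "neg2 v $ 2 = - v $ 2"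
  "swap v $ 1 = v $ 2" "swap v $ 2 = v $ 1"
  by (simp_all add: neg1_def neg2_def swap_def)

lemma add_hom_neg_swap [simp]: "add_hom neg1" "add_hom neg2" "add_hom swap"
  by (simp_all add: add_hom_def vec_eq_iff forall_2)

text \<open>Conjugation by \<open>\<rho>\<^sub>k\<close> permutes the indices of the \<open>\<lambda>\<^sub>i\<^sub>,\<^sub>j\<close>, with \<open>\<lambda>\<^sub>j\<^sub>,\<^sub>i\<close> standing for the inverse of \<open>\<lambda>\<^sub>i\<^sub>,\<^sub>j\<close>.\<close>

definition rho_aut :: "nat \<Rightarrow> F \<Rightarrow> F" where
  "rho_aut k = (if k = 1 then fprod_map (\<lambda>i. if i = 1 then 1 else if i = 2 then 3 else 2) (\<lambda>i. if i = 1 then neg1 else swap)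
    else if k = 2 then fprod_map (\<lambda>i. if i = 1 then 2 else if i = 2 then 1 else 3) (\<lambda>i. if i = 3 then neg2 else id)
    else fprod_map (\<lambda>i. if i = 1 then 1 else if i = 2 then 3 else 2) (\<lambda>i. if i = 1 then neg2 else id))"

text \<open>The image of lambda_{k,k+1}, which is x_1, y_3, y_1 for k = 1, 2, 3.\<close>

definition s_shift :: "nat \<Rightarrow> F" where
  "s_shift k = (if k = 1 then letter 1 e1 else if k = 2 then letter 3 e2 else letter 1 e2)"

lemma add_hom_rho_aut [simp]: "add_hom (rho_aut k)"
  unfolding rho_aut_def by (auto intro: add_hom_fprod_map)

lemma rho_aut_letter:
  "rho_aut 1 (letter 1 v) = letter 1 (neg1 v)" "rho_aut 1 (letter 2 v) = letter 3 (swap v)" "rho_aut 1 (letter 3 v) = letter 2 (swap v)"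
  "rho_aut 2 (letter 1 v) = letter 2 v" "rho_aut 2 (letter 2 v) = letter 1 v" "rho_aut 2 (letter 3 v) = letter 3 (neg2 v)"
  "rho_aut 3 (letter 1 v) = letter 1 (neg2 v)" "rho_aut 3 (letter 2 v) = letter 3 v" "rho_aut 3 (letter 3 v) = letter 2 v"
  by (simp_all add: rho_aut_def fprod_map_letter)

lemma add_hom_fprod_eqI_3:
  assumes "add_hom f" "add_hom g" "\<And>v. f (letter 1 v) = g (letter 1 v)" "\<And>v. f (letter 2 v) = g (letter 2 v)"
    "\<And>v. f (letter 3 v) = g (letter 3 v)"
  shows "f = (g :: (3, 'a::group_add) fprod \<Rightarrow> 'b::group_add)"
proof -
  have "\<forall>i. \<forall>v. f (letter i v) = g (letter i v)" unfolding forall_3 by (simp add: assms)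
  with assms(1,2) show ?thesis by (intro add_hom_fprod_eqI) blast+
qed

lemma neg_swap_comp [simp]:
  "neg1 (neg1 v) = v" "neg2 (neg2 v) = v" "swap (swap v) = v" "neg1 (swap v) = swap (neg2 v)" "neg2 (swap v) = swap (neg1 v)"
  "neg1 (neg2 v) = neg2 (neg1 v)"
  by (simp_all add: vec_eq_iff forall_2)

lemma rho_aut_rel:
  "rho_aut 1 \<circ> rho_aut 1 = id" "rho_aut 2 \<circ> rho_aut 2 = id" "rho_aut 3 \<circ> rho_aut 3 = id"
  "rho_aut 3 \<circ> rho_aut 1 = rho_aut 1 \<circ> rho_aut 3"
  "rho_aut 1 \<circ> (rho_aut 2 \<circ> rho_aut 1) = rho_aut 2 \<circ> (rho_aut 1 \<circ> rho_aut 2)"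
  "rho_aut 2 \<circ> (rho_aut 3 \<circ> rho_aut 2) = rho_aut 3 \<circ> (rho_aut 2 \<circ> rho_aut 3)"
  by (rule add_hom_fprod_eqI_3; auto intro!: add_hom_comp simp: rho_aut_letter simp del: One_nat_def)+

text \<open>The semidirect product of \<open>F\<close> with its automorphisms, realised by affine
  maps of \<open>F\<close>, so that its multiplication is composition of functions.\<close>

definition affine :: "F \<Rightarrow> (F \<Rightarrow> F) \<Rightarrow> F \<Rightarrow> F" where
  "affine a h z = a + h z"

lemma affine_comp: "add_hom h \<Longrightarrow> affine a h \<circ> affine b k = affine (a + h b) (h \<circ> k)"
  by (simp add: affine_def fun_eq_iff add_hom_add add.assoc)

lemma affine_id [simp]: "affine 0 id = id"
  by (simp add: affine_def fun_eq_iff)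

definition VT4_gen :: "vt_gen \<Rightarrow> F \<Rightarrow> F" where
  "VT4_gen a = (case a of TwinGen k \<Rightarrow> affine (s_shift k) (rho_aut k) | RhoGen k \<Rightarrow> affine 0 (rho_aut k))"

text \<open>The translation parts of the defining relations of \<open>VT 4\<close>; the linear parts
  are \<open>rho_aut_rel\<close>.\<close>

lemma s_shift_rel:
  "s_shift 1 + rho_aut 1 (s_shift 1) = 0" "s_shift 2 + rho_aut 2 (s_shift 2) = 0" "s_shift 3 + rho_aut 3 (s_shift 3) = 0"
  "s_shift 3 + s_shift 1 = s_shift 1 + s_shift 3"
  "rho_aut 1 (s_shift 3) = s_shift 3" "rho_aut 3 (s_shift 1) = s_shift 1"
  "rho_aut 1 (rho_aut 2 (s_shift 1)) = s_shift 2" "rho_aut 2 (rho_aut 3 (s_shift 2)) = s_shift 3"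
  by (simp_all add: s_shift_def rho_aut_letter letter_eq_iff vec_eq_iff forall_2
      flip: letter_add del: One_nat_def)

lemma VT4_gen_rel:
  assumes "(l, r) \<in> VT_rels 4"
  shows "word_eval perm_group VT4_gen l = word_eval perm_group VT4_gen r"
proof -
  have k: "i \<in> {1..<4} \<longleftrightarrow> i = 1 \<or> i = 2 \<or> i = 3" for i :: nat by auto
  have k': "1 \<le> i \<and> i + 2 \<le> 4 \<longleftrightarrow> i = 1 \<or> i = 2" for i :: nat by auto
  note simps = VT4_gen_def affine_comp add_hom_simps[OF add_hom_rho_aut] rho_aut_rel s_shift_rel add_hom_comp
  show ?thesis
    using assms unfolding VT_rels_def k k'
    by (auto simp: simps simp del: One_nat_def)
qed

lemma VT4_gen_bij: "a \<in> VT_gens 4 \<Longrightarrow> VT4_gen a \<in> carrier perm_group"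
proof -
  assume "a \<in> VT_gens 4"
  then have "VT4_gen a \<circ> VT4_gen a = id"
    by (cases a) (auto simp: VT_gens_4 VT4_gen_def affine_comp add_hom_simps[OF add_hom_rho_aut] rho_aut_rel s_shift_rel simp del: One_nat_def)
  then show ?thesis by (simp add: o_bij)
qed

definition VT4_action :: "vt_gen word set \<Rightarrow> F \<Rightarrow> F" where
  "VT4_action = pres_lift perm_group VT4_gen"

lemma VT4_action_hom: "VT4_action \<in> hom (VT 4) perm_group"
  unfolding VT4_action_def VT_def by (rule pres_lift_hom) (auto simp: VT4_gen_bij[simplified] VT4_gen_rel)

lemma VT4_action_mult:
  "x \<in> carrier (VT 4) \<Longrightarrow> y \<in> carrier (VT 4) \<Longrightarrow> VT4_action (x \<otimes>\<^bsub>VT 4\<^esub> y) = VT4_action x \<circ> VT4_action y"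
  using hom_mult[OF VT4_action_hom] by simp

lemma VT4_action_gen: "a \<in> VT_gens 4 \<Longrightarrow> VT4_action (VT4_class [(a, True)]) = VT4_gen a"
  unfolding VT4_action_def by (subst pres_lift_class) (auto simp: VT4_gen_bij[simplified] VT4_gen_rel)

text \<open>Elements of \<open>PVT 4\<close> act as translations, and the image of 0 is the
  translation vector.\<close>

definition PVT4_to_fprod :: "vt_gen word set \<Rightarrow> F" where
  "PVT4_to_fprod x = VT4_action x 0"

lemma VT4_action_L:
  "VT4_action VT4.L12 = affine (letter 1 e1) id" "VT4_action VT4.L34 = affine (letter 1 e2) id"
  "VT4_action VT4.L13 = affine (letter 2 e1) id" "VT4_action VT4.L24 = affine (letter 2 e2) id"
  "VT4_action VT4.L14 = affine (letter 3 e1) id" "VT4_action VT4.L23 = affine (letter 3 e2) id"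
proof -
  have r: "VT4_action (VT4_class [\<rho>_let (Suc 0)]) = affine 0 (rho_aut 1)" "VT4_action (VT4_class [\<rho>_let 2]) = affine 0 (rho_aut 2)"
    "VT4_action (VT4_class [\<rho>_let 3]) = affine 0 (rho_aut 3)"
    by (simp_all add: VT4_action_gen VT_gens_4 VT4_gen_def)
  have s: "VT4_action (VT4_class [s_let (Suc 0)]) = affine (letter 1 e1) (rho_aut 1)"
    "VT4_action (VT4_class [s_let 2]) = affine (letter 3 e2) (rho_aut 2)" "VT4_action (VT4_class [s_let 3]) = affine (letter 1 e2) (rho_aut 3)"
    by (simp_all add: VT4_action_gen VT_gens_4 VT4_gen_def s_shift_def)
  note simps = VT4_action_mult r s affine_comp add_hom_zero rho_aut_rel
  show 1: "VT4_action VT4.L12 = affine (letter 1 e1) id" "VT4_action VT4.L34 = affine (letter 1 e2) id"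
    "VT4_action VT4.L23 = affine (letter 3 e2) id"
    by (simp_all add: VT4.L_defs simps del: One_nat_def)
  show 2: "VT4_action VT4.L13 = affine (letter 2 e1) id" "VT4_action VT4.L24 = affine (letter 2 e2) id"
    unfolding VT4.conj_r2(1,3)[symmetric] by (simp_all add: simps 1 rho_aut_letter del: One_nat_def)
  show "VT4_action VT4.L14 = affine (letter 3 e1) id"
    unfolding VT4.conj_r3(3)[symmetric] by (simp_all add: simps 2 rho_aut_letter del: One_nat_def)
qed

lemma PVT4_carrier_VT: "x \<in> carrier (PVT 4) \<Longrightarrow> x \<in> carrier (VT 4)"
  by (auto simp: PVT_def kernel_def)

lemma mult_PVT [simp]: "monoid.mult (PVT n) = monoid.mult (VT n)"
  and one_PVT [simp]: "one (PVT n) = one (VT n)"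
  by (simp_all add: PVT_def)

lemma subgroup_PVT: "subgroup (carrier (PVT 4)) (VT 4)"
  using subgroup_kernel_VT by (simp add: PVT_def)

text \<open>The elements acting by translations form a subgroup, and by \<open>VT4_action_L\<close>
  it contains the generators of \<open>PVT 4\<close>.\<close>

lemma VT4_action_translation:
  assumes "x \<in> carrier (PVT 4)"
  shows "VT4_action x = affine (PVT4_to_fprod x) id"
proof -
  let ?H = "{x \<in> carrier (VT 4). \<exists>a. VT4_action x = affine a id}"
  have "subgroup ?H (VT 4)"
  proof (rule VT4.subgroupI)
    have "VT4.L12 \<in> ?H" using VT4_action_L by auto
    then show "?H \<noteq> {}" by blast
  next
    fix x assume "x \<in> ?H"
    then obtain a where a: "x \<in> carrier (VT 4)" "VT4_action x = affine a id" by blast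
    have "VT4_action \<one>\<^bsub>VT 4\<^esub> = id" using hom_one[OF VT4_action_hom] by simp
    then have "VT4_action x \<circ> VT4_action (inv\<^bsub>VT 4\<^esub> x) = id"
      using a(1) by (simp flip: VT4_action_mult)
    then have "VT4_action (inv\<^bsub>VT 4\<^esub> x) = affine (- a) id"
      unfolding a(2) by (auto simp: fun_eq_iff affine_def eq_neg_iff_add_eq_0 add_eq_0_iff) (metis add_minus_cancel minus_add_cancel)
    then show "inv\<^bsub>VT 4\<^esub> x \<in> ?H" using a by auto
  next
    fix x y assume "x \<in> ?H" "y \<in> ?H"
    then show "x \<otimes>\<^bsub>VT 4\<^esub> y \<in> ?H" by (auto simp: VT4_action_mult affine_comp)
  qed auto
  moreover have "VT4.Ls \<subseteq> ?H" using VT4_action_L by (auto simp: VT4.Ls_def)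
  ultimately have "carrier (PVT 4) \<subseteq> ?H"
    unfolding carrier_PVT by (intro VT4.generate_subgroup_incl)
  then obtain a where "VT4_action x = affine a id" using assms by blast
  then show ?thesis by (simp add: PVT4_to_fprod_def affine_def)
qed

lemma PVT4_to_fprod_hom: "PVT4_to_fprod \<in> hom (PVT 4) additive_group"
proof (rule homI)
  fix x y assume "x \<in> carrier (PVT 4)" "y \<in> carrier (PVT 4)"
  then show "PVT4_to_fprod (x \<otimes>\<^bsub>PVT 4\<^esub> y) = PVT4_to_fprod x \<otimes>\<^bsub>additive_group\<^esub> PVT4_to_fprod y"
    using fun_cong[OF VT4_action_translation[of x], of "VT4_action y 0"]
    by (simp add: PVT4_to_fprod_def VT4_action_mult PVT4_carrier_VT affine_def)
qed simp

definition x_gen :: "3 \<Rightarrow> vt_gen word set" where "x_gen i = lam 4 (x_vert (index3 i))"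
definition y_gen :: "3 \<Rightarrow> vt_gen word set" where "y_gen i = lam 4 (y_vert (index3 i))"

lemma x_y_gen: "x_gen 1 = VT4.L12" "x_gen 2 = VT4.L13" "x_gen 3 = VT4.L14"
  "y_gen 1 = VT4.L34" "y_gen 2 = VT4.L24" "y_gen 3 = VT4.L23"
  by (simp_all add: x_gen_def y_gen_def x_vert_def y_vert_def index3_def lam_4 del: One_nat_def)

lemma Ls_PVT: "VT4.Ls \<subseteq> carrier (PVT 4)"
  unfolding carrier_PVT by (auto intro: generate.incl)

lemma x_y_gen_carrier [simp]: "x_gen i \<in> carrier (PVT 4)" "y_gen i \<in> carrier (PVT 4)"
  using Ls_PVT exhaust_3[of i] by (auto simp: VT4.Ls_def x_y_gen)

lemma PVT4_to_fprod_gen: "PVT4_to_fprod (x_gen i) = letter i e1" "PVT4_to_fprod (y_gen i) = letter i e2"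
  using exhaust_3[of i] by (auto simp: PVT4_to_fprod_def x_y_gen VT4_action_L affine_def)

lemma x_y_gen_commute: "x_gen i \<otimes>\<^bsub>PVT 4\<^esub> y_gen i = y_gen i \<otimes>\<^bsub>PVT 4\<^esub> x_gen i"
  using exhaust_3[of i] VT4.L_commute by (auto simp: x_y_gen)

interpretation PVT4: group "PVT 4" by (rule group_PVT)

lemma int_pow_additive_letter: "letter (i::'a) v [^]\<^bsub>additive_group\<^esub> (n::int) = letter i (n *s (v :: int^2))"
proof -
  interpret A: group "additive_group :: ('a, int^2) fprod monoid" by (rule group_additive_group)
  show ?thesis
  proof (induction n rule: int_induct[of _ 0])
    case (step1 n)
    have "letter i v [^]\<^bsub>additive_group\<^esub> (n + 1) = letter i v [^]\<^bsub>additive_group\<^esub> n + letter i v"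
      using A.int_pow_mult[of "letter i v" n 1] A.int_pow_1[of "letter i v"] by simp
    then show ?case by (simp add: step1 distrib_right vector_sadd_rdistrib flip: letter_add)
  next
    case (step2 n)
    have "letter i v [^]\<^bsub>additive_group\<^esub> (n - 1) = letter i v [^]\<^bsub>additive_group\<^esub> n + - letter i v"
      using A.int_pow_mult[of "letter i v" n "- 1"] A.int_pow_neg[of "letter i v" 1] A.int_pow_1[of "letter i v"] by simp
    then show ?case by (simp add: step2 vector_ssub_ldistrib vec_eq_iff letter_eq_iff algebra_simps flip: letter_add letter_minus)
  qed simp
qed

lemma PVT4_iso: "PVT4_to_fprod \<in> iso (PVT 4) additive_group"
proof -
  define f where "f i v = x_gen i [^]\<^bsub>PVT 4\<^esub> (v $ 1) \<otimes>\<^bsub>PVT 4\<^esub> y_gen i [^]\<^bsub>PVT 4\<^esub> (v $ 2)" for i and v :: "int^2"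
  have fc: "f i v \<in> carrier (PVT 4)" for i v
    unfolding f_def by (intro PVT4.m_closed PVT4.int_pow_closed) simp_all
  have f1: "f i e1 = x_gen i" and f2: "f i e2 = y_gen i" for i
    unfolding f_def by (simp_all add: PVT4.int_pow_1 del: mult_PVT one_PVT)
  have comm: "y_gen i [^]\<^bsub>PVT 4\<^esub> (n::int) \<otimes>\<^bsub>PVT 4\<^esub> x_gen i [^]\<^bsub>PVT 4\<^esub> (m::int)
      = x_gen i [^]\<^bsub>PVT 4\<^esub> m \<otimes>\<^bsub>PVT 4\<^esub> y_gen i [^]\<^bsub>PVT 4\<^esub> n" for i n m
  proof -
    \<comment> \<open>Conjugation by \<open>a\<close> is an endomorphism that fixes
      \<open>b\<close>, so it fixes the integer powers of \<open>b\<close>.\<close>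
    have pw: "b [^]\<^bsub>PVT 4\<^esub> (k::int) \<otimes>\<^bsub>PVT 4\<^esub> a = a \<otimes>\<^bsub>PVT 4\<^esub> b [^]\<^bsub>PVT 4\<^esub> k"
      if "a \<in> carrier (PVT 4)" "b \<in> carrier (PVT 4)" "b \<otimes>\<^bsub>PVT 4\<^esub> a = a \<otimes>\<^bsub>PVT 4\<^esub> b" for a b k
    proof -
      have "a \<otimes>\<^bsub>PVT 4\<^esub> b \<otimes>\<^bsub>PVT 4\<^esub> inv\<^bsub>PVT 4\<^esub> a = b"
        using that by (metis PVT4.inv_solve_right PVT4.m_closed)
      moreover have "(\<lambda>z. a \<otimes>\<^bsub>PVT 4\<^esub> z \<otimes>\<^bsub>PVT 4\<^esub> inv\<^bsub>PVT 4\<^esub> a) \<in> hom (PVT 4) (PVT 4)"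
        using that by (intro homI) (simp_all add: PVT4.m_assoc PVT4.inv_solve_left del: mult_PVT)
      from hom_int_pow[OF this that(2) group_PVT group_PVT]
      have "a \<otimes>\<^bsub>PVT 4\<^esub> b [^]\<^bsub>PVT 4\<^esub> k \<otimes>\<^bsub>PVT 4\<^esub> inv\<^bsub>PVT 4\<^esub> a = (a \<otimes>\<^bsub>PVT 4\<^esub> b \<otimes>\<^bsub>PVT 4\<^esub> inv\<^bsub>PVT 4\<^esub> a) [^]\<^bsub>PVT 4\<^esub> k" .
      ultimately show ?thesis
        using that by (metis PVT4.int_pow_closed PVT4.inv_solve_right' PVT4.m_closed)
    qed
    show ?thesis by (intro pw pw[symmetric]) (simp_all add: x_y_gen_commute del: mult_PVT)
  qed
  show ?thesis
  proof (rule iso_fprodI[where f = f])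
    show "f i \<in> hom additive_group (PVT 4)" for i
    proof (rule homI)
      show "f i (v \<otimes>\<^bsub>additive_group\<^esub> w) = f i v \<otimes>\<^bsub>PVT 4\<^esub> f i w" for v w
        using comm[of i "v $ 2" "w $ 1"]
        by (simp add: f_def PVT4.int_pow_mult PVT4.m_assoc del: mult_PVT) (simp flip: PVT4.m_assoc del: mult_PVT)
    qed (rule fc)
    show "PVT4_to_fprod (f i v) = letter i v" for i v
    proof -
      have "PVT4_to_fprod (f i v) = letter i ((v $ 1) *s e1) + letter i ((v $ 2) *s e2)"
        using hom_mult[OF PVT4_to_fprod_hom, of "x_gen i [^]\<^bsub>PVT 4\<^esub> (v $ 1)" "y_gen i [^]\<^bsub>PVT 4\<^esub> (v $ 2)"]
        by (simp add: f_def hom_int_pow[OF PVT4_to_fprod_hom] PVT4_to_fprod_gen int_pow_additive_letter del: mult_PVT)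
      also have "\<dots> = letter i v"
        by (simp add: letter_eq_iff vec_eq_iff forall_2 flip: letter_add)
      finally show ?thesis .
    qed
    fix H assume H: "subgroup H (PVT 4)" "\<And>i v. f i v \<in> H"
    have "x_gen i \<in> H" "y_gen i \<in> H" for i using H(2)[of i e1] H(2)[of i e2] by (simp_all add: f1 f2)
    then have "VT4.Ls \<subseteq> H"
      by (metis (no_types) VT4.Ls_def empty_subsetI insert_subset x_y_gen)
    moreover have "subgroup H (VT 4)"
      using H(1) subgroup_PVT VT4.incl_subgroup by (simp add: PVT_def)
    ultimately show "carrier (PVT 4) \<subseteq> H"
      unfolding carrier_PVT by (rule VT4.generate_subgroup_incl)
  qed (simp_all add: PVT4_to_fprod_hom)
qed

section \<open>Generators of \<open>GL\<^sub>2(\<int>)\<close>\<close>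

lemma int2_eq: "(v :: int^2) = (v $ 1) *s e1 + (v $ 2) *s e2"
  by (simp add: vec_eq_iff forall_2)

lemma int2_induct [case_names e1 e2 add minus]:
  fixes v :: "int^2"
  assumes "P e1" "P e2" "\<And>a b. P a \<Longrightarrow> P b \<Longrightarrow> P (a + b)" "\<And>a. P a \<Longrightarrow> P (- a)"
  shows "P v"
proof -
  have 0: "P 0" using assms(3)[OF assms(1) assms(4)[OF assms(1)]] by simp
  have "P (n *s e)" if "P e" for n and e :: "int^2"
  proof (induction n rule: int_induct[of _ 0])
    case (step1 n)
    have "(n + 1) *s e = n *s e + e" by (simp add: vec_eq_iff algebra_simps)
    then show ?case using assms(3)[OF step1(2) that] by simp
  next
    case (step2 n)
    have "(n - 1) *s e = n *s e + - e" by (simp add: vec_eq_iff algebra_simps)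
    then show ?case using assms(3)[OF step2(2) assms(4)[OF that]] by simp
  qed (use 0 in simp)
  then show ?thesis using assms(1,2,3) by (subst int2_eq) blast
qed

lemma add_hom_int2_eqI:
  assumes "add_hom f" "add_hom g" "f e1 = g e1" "f e2 = g e2"
  shows "f = (g :: int^2 \<Rightarrow> 'a::group_add)"
proof
  fix v show "f v = g v"
    by (induction v rule: int2_induct) (use assms in \<open>simp_all add: add_hom_simps\<close>)
qed

lemma int2_nontrivial: "\<exists>u::int^2. u \<noteq> 0"
  by (rule exI[of _ e1]) (simp add: vec_eq_iff forall_2)

lemma nmul_component: "nmul n (v :: int^2) $ i = int n * v $ i"
  by (induction n) (simp_all add: nmul_Suc algebra_simps)

text \<open>Take the basis vector complementary to a nonzero coordinate of \<open>u\<close>. That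
  coordinate of the equation forces \<open>k = l\<close>, and then the other one forces
  \<open>d = 0\<close>.\<close>

lemma int2_rank2: "\<exists>v. \<forall>d k l. 0 < d \<longrightarrow> nmul d v + nmul k u \<noteq> nmul l u" if "u \<noteq> 0" for u :: "int^2"
proof -
  have *: "\<forall>d k l. 0 < d \<longrightarrow> nmul d v + nmul k u \<noteq> nmul l u" if "v $ i = 0" "v $ j = 1" "u $ i \<noteq> 0" for v i j
  proof (intro allI impI notI)
    fix d k l :: nat assume d: "0 < d" and eq: "nmul d v + nmul k u = nmul l u"
    have comp: "int d * v $ m + int k * u $ m = int l * u $ m" for m
      using arg_cong[OF eq, of "\<lambda>w. w $ m"] by (simp add: nmul_component)
    from comp[of i] comp[of j] that d show False by simp
  qed
  have "u $ 1 \<noteq> 0 \<or> u $ 2 \<noteq> 0" using that by (simp add: vec_eq_iff forall_2)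
  then show ?thesis
  proof
    assume "u $ 1 \<noteq> 0"
    then show ?thesis by (intro exI[of _ e2] *[of e2 1 2]) simp_all
  next
    assume "u $ 2 \<noteq> 0"
    then show ?thesis by (intro exI[of _ e1] *[of e1 2 1]) simp_all
  qed
qed

text \<open>It sends \<open>e1\<close> to \<open>e1 + e2\<close> and fixes \<open>e2\<close>, the
  transvection of x_i by y_i; \<open>shear2\<close> is the transvection of y_i by x_i.\<close>

definition shear1 :: "int^2 \<Rightarrow> int^2" where "shear1 v = vector [v $ 1, v $ 2 + v $ 1]"
definition shear2 :: "int^2 \<Rightarrow> int^2" where "shear2 v = vector [v $ 1 + v $ 2, v $ 2]"

definition unitriangular :: "int \<Rightarrow> int^2 \<Rightarrow> int^2" where
  "unitriangular n v = vector [v $ 1 + n * v $ 2, v $ 2]"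

lemma unitriangular_simps [simp]: "unitriangular n v $ 1 = v $ 1 + n * v $ 2" "unitriangular n v $ 2 = v $ 2"
  by (simp_all add: unitriangular_def)

lemma shear_simps [simp]: "shear1 v $ 1 = v $ 1" "shear1 v $ 2 = v $ 2 + v $ 1"
  "shear2 v $ 1 = v $ 1 + v $ 2" "shear2 v $ 2 = v $ 2"
  by (simp_all add: shear1_def shear2_def)

lemma shear_aut: "shear1 \<in> carrier aut_group" "shear2 \<in> carrier aut_group"
proof -
  have "add_hom shear1" "add_hom shear2" by (simp_all add: add_hom_def vec_eq_iff forall_2)
  moreover have "add_hom (\<lambda>v. vector [v $ 1, v $ 2 - v $ 1] :: int^2)" "add_hom (\<lambda>v. vector [v $ 1 - v $ 2, v $ 2] :: int^2)"
    by (simp_all add: add_hom_def vec_eq_iff forall_2)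
  ultimately show "shear1 \<in> carrier aut_group" "shear2 \<in> carrier aut_group"
    by (auto intro!: aut_groupI[of shear1 "\<lambda>v. vector [v $ 1, v $ 2 - v $ 1]"]
        aut_groupI[of shear2 "\<lambda>v. vector [v $ 1 - v $ 2, v $ 2]"] simp: fun_eq_iff vec_eq_iff forall_2)
qed

lemma neg_aut: "neg1 \<in> carrier aut_group" "neg2 \<in> carrier aut_group"
  by (auto intro!: aut_groupI[of neg1 neg1] aut_groupI[of neg2 neg2] simp: fun_eq_iff)

lemma add_hom_int2_expand:
  assumes "add_hom (A :: int^2 \<Rightarrow> int^2)"
  shows "A v $ i = v $ 1 * A e1 $ i + v $ 2 * A e2 $ i"
proof -
  have "A = (\<lambda>v. (v $ 1) *s A e1 + (v $ 2) *s A e2)"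
    by (rule add_hom_int2_eqI[OF assms]) (simp_all add: add_hom_def vec_eq_iff algebra_simps)
  then have "A v = (v $ 1) *s A e1 + (v $ 2) *s A e2" by (rule fun_cong)
  then show ?thesis by simp
qed

context
  fixes H :: "(int^2 \<Rightarrow> int^2) set"
  assumes H: "subgroup H aut_group" and gens: "shear1 \<in> H" "shear2 \<in> H" "neg1 \<in> H" "neg2 \<in> H"
begin

lemma H_comp: "f \<in> H \<Longrightarrow> g \<in> H \<Longrightarrow> f \<circ> g \<in> H"
  using subgroup.m_closed[OF H] by simp

lemma H_inv: "f \<in> H \<Longrightarrow> inv_into UNIV f \<in> H"
  using subgroup.m_inv_closed[OF H, of f] subgroup.mem_carrier[OF H, of f] by (simp add: inv_aut_group)

lemma H_cancel:
  assumes "t \<in> H" "t \<circ> A \<in> H" shows "A \<in> H"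
proof -
  have "inv_into UNIV t \<circ> (t \<circ> A) = A"
    using subgroup.mem_carrier[OF H assms(1)] by (simp add: carrier_aut_group bij_is_inj flip: comp_assoc)
  then show ?thesis using H_comp[OF H_inv[OF assms(1)] assms(2)] by simp
qed

lemma upper_unitriangular_in: "unitriangular n \<in> H"
proof (induction n rule: int_induct[of _ 0])
  case base
  have "unitriangular 0 = id" by (simp add: fun_eq_iff vec_eq_iff forall_2)
  then show ?case using subgroup.one_closed[OF H] by (simp only: one_aut_group)
next
  case (step1 n)
  have "unitriangular (n + 1) = shear2 \<circ> unitriangular n"
    by (simp add: fun_eq_iff vec_eq_iff forall_2 algebra_simps)
  then show ?case using H_comp[OF gens(2) step1(2)] by (simp only:)
next
  case (step2 n)
  have "shear2 \<circ> unitriangular (n - 1) = unitriangular n"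
    by (simp add: fun_eq_iff vec_eq_iff forall_2 algebra_simps)
  then show ?case using H_cancel[OF gens(2)] step2(2) by (simp only:)
qed

text \<open>Surjectivity makes both diagonal entries divisors of 1, so they are signs, and the
  matrix is a diagonal sign matrix times a power of a shear.\<close>

lemma upper_triangular_in:
  assumes "A \<in> carrier aut_group" "A e1 $ 2 = 0"
  shows "A \<in> H"
proof -
  have A: "add_hom A" "surj A" using assms(1) by (auto simp: carrier_aut_group bij_is_surj)
  note ex = add_hom_int2_expand[OF A(1)]
  define a b d where "a = A e1 $ 1" and "b = A e2 $ 1" and "d = A e2 $ 2"
  obtain v where v: "A v = e1" using A(2) by (metis surjD)
  obtain w where w: "A w = e2" using A(2) by (metis surjD)
  have "w $ 2 * d = 1" using ex[of w 2] by (simp add: w assms(2) d_def)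
  then have d: "d = 1 \<or> d = - 1" by (metis dvd_triv_right zdvd1_eq abs_eq_iff' )
  have "v $ 2 * d = 0" using ex[of v 2] by (simp add: v assms(2) d_def)
  with d have "v $ 2 = 0" by auto
  then have "v $ 1 * a = 1" using ex[of v 1] by (simp add: v a_def)
  then have a: "a = 1 \<or> a = - 1" by (metis dvd_triv_right zdvd1_eq abs_eq_iff')
  \<comment> \<open>The exponent is \<open>a * b\<close> because the diagonal factor multiplies the
    first coordinate by \<open>a\<close>, and \<open>a * a = 1\<close>.\<close>
  define U where "U = unitriangular (a * b)"
  have U: "U \<in> H" unfolding U_def by (rule upper_unitriangular_in)
  have AU: "A = (\<lambda>v. vector [a * v $ 1, d * v $ 2]) \<circ> U"
  proof
    fix v
    have aa: "a * (a * t) = t" for t using a by auto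
    have "A v $ 1 = v $ 1 * a + v $ 2 * b" "A v $ 2 = v $ 2 * d"
      using ex[of v 1] ex[of v 2] by (simp_all add: assms(2) a_def b_def d_def)
    then show "A v = ((\<lambda>v. vector [a * v $ 1, d * v $ 2]) \<circ> U) v"
      by (simp add: vec_eq_iff forall_2 U_def distrib_left aa mult.assoc mult.commute)
  qed
  have "(\<lambda>v. vector [a * v $ 1, d * v $ 2] :: int^2) \<in> {id, neg1, neg2, neg1 \<circ> neg2}"
    using a d by (auto simp: fun_eq_iff vec_eq_iff forall_2)
  moreover have "{id, neg1, neg2, neg1 \<circ> neg2} \<subseteq> H"
    using subgroup.one_closed[OF H] gens H_comp by simp
  ultimately have "(\<lambda>v. vector [a * v $ 1, d * v $ 2] :: int^2) \<in> H" by blast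
  then show ?thesis using H_comp U AU by simp
qed

text \<open>The Euclidean algorithm on the first column: adding or subtracting the entry of smaller
  absolute value from the other lowers the sum of absolute values, until an entry is zero.\<close>

lemma shear_neg_generate: "carrier aut_group \<subseteq> H"
proof
  fix A :: "int^2 \<Rightarrow> int^2" assume "A \<in> carrier aut_group"
  then show "A \<in> H"
  proof (induction "nat (\<bar>A e1 $ 1\<bar> + \<bar>A e1 $ 2\<bar>)" arbitrary: A rule: less_induct)
    case less
    define a c where "a = A e1 $ 1" and "c = A e1 $ 2"
    have step: "A \<in> H" if "t \<in> H" "\<bar>t (A e1) $ 1\<bar> + \<bar>t (A e1) $ 2\<bar> < \<bar>a\<bar> + \<bar>c\<bar>" for t
    proof (rule H_cancel[OF that(1)])
      have "t \<circ> A \<in> carrier aut_group"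
        using less(2) subgroup.mem_carrier[OF H that(1)] by (simp add: carrier_aut_group bij_comp add_hom_comp)
      then show "t \<circ> A \<in> H" using that(2) by (intro less(1)) (simp_all add: a_def c_def)
    qed
    have inv1: "inv_into UNIV shear1 v = vector [v $ 1, v $ 2 - v $ 1]" for v
      using shear_aut(1) by (intro inv_f_eq) (auto simp: carrier_aut_group bij_is_inj vec_eq_iff forall_2)
    have inv2: "inv_into UNIV shear2 v = vector [v $ 1 - v $ 2, v $ 2]" for v
      using shear_aut(2) by (intro inv_f_eq) (auto simp: carrier_aut_group bij_is_inj vec_eq_iff forall_2)
    consider "c = 0" | "a = 0" | "a \<noteq> 0" "c \<noteq> 0" "\<bar>c\<bar> \<le> \<bar>a\<bar>" | "a \<noteq> 0" "c \<noteq> 0" "\<bar>a\<bar> < \<bar>c\<bar>" by linarith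
    then show ?case
    proof cases
      case 1
      then show ?thesis using upper_triangular_in less(2) by (simp add: c_def)
    next
      case 2
      \<comment> \<open>It maps a first column (0, c) first to (c, c) and then to (c, 0), which
        makes the matrix upper triangular.\<close>
      let ?t = "inv_into UNIV shear1 \<circ> shear2"
      have t: "?t \<in> H" using H_comp H_inv gens by blast
      have "?t \<circ> A \<in> carrier aut_group"
        using less(2) subgroup.mem_carrier[OF H t] by (simp add: carrier_aut_group bij_comp add_hom_comp)
      moreover have "(?t \<circ> A) e1 $ 2 = 0" using 2 by (simp add: inv1 a_def)
      ultimately have "?t \<circ> A \<in> H" by (rule upper_triangular_in)
      with t show ?thesis by (rule H_cancel)
    next
      case 3
      show ?thesis
      proof (cases "0 < a \<longleftrightarrow> 0 < c")
        case True
        with 3 show ?thesis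
          by (intro step[OF H_inv[OF gens(2)]]) (auto simp: inv2 simp flip: a_def c_def)
      next
        case False
        with 3 show ?thesis by (intro step[OF gens(2)]) (auto simp flip: a_def c_def)
      qed
    next
      case 4
      show ?thesis
      proof (cases "0 < a \<longleftrightarrow> 0 < c")
        case True
        with 4 show ?thesis
          by (intro step[OF H_inv[OF gens(1)]]) (auto simp: inv1 simp flip: a_def c_def)
      next
        case False
        with 4 show ?thesis by (intro step[OF gens(1)]) (auto simp flip: a_def c_def)
      qed
    qed
  qed
qed

end

section \<open>The generating sets\<close>

definition xv :: "3 \<Rightarrow> nat \<times> nat" where "xv i = x_vert (index3 i)"
definition yv :: "3 \<Rightarrow> nat \<times> nat" where "yv i = y_vert (index3 i)"

lemma xv_yv_eq [simp]: "xv i = xv j \<longleftrightarrow> i = j" "yv i = yv j \<longleftrightarrow> i = j" "xv i \<noteq> yv j" "yv i \<noteq> xv j"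
  using exhaust_3[of i] exhaust_3[of j] by (auto simp: xv_def yv_def x_vert_def y_vert_def index3_def)

lemma range_index3: "{1..3} = range index3"
proof
  show "{1..3} \<subseteq> range index3" by (metis index3_of_nat rangeI subsetI)
qed auto

lemma verts4_xv_yv: "verts4 = range xv \<union> range yv"
  unfolding verts4_def comp4_def range_index3 by (auto simp: xv_def yv_def)

lemma edges4_xv_yv: "edges4 = range (\<lambda>i. {xv i, yv i})"
  unfolding edges4_def range_index3 by (auto simp: xv_def yv_def)

definition vert_letter :: "nat \<times> nat \<Rightarrow> F" where
  "vert_letter v = PVT4_to_fprod (lam 4 v)"

lemma vert_letter [simp]: "vert_letter (xv i) = letter i e1" "vert_letter (yv i) = letter i e2"
  using PVT4_to_fprod_gen[of i] by (simp_all add: vert_letter_def xv_def yv_def x_gen_def y_gen_def)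

text \<open>The counterpart of \<open>auts_with_images\<close> on the free product;
  \<open>auts_with_images_transport\<close> connects the two.\<close>

definition with_images :: "(nat \<times> nat \<Rightarrow> F) \<Rightarrow> (F \<Rightarrow> F) set" where
  "with_images f = {\<phi> \<in> carrier aut_group. \<forall>v\<in>verts4. \<phi> (vert_letter v) = f v}"

lemma with_images_iff:
  "\<phi> \<in> with_images f \<longleftrightarrow> \<phi> \<in> carrier aut_group \<and> (\<forall>i. \<phi> (letter i e1) = f (xv i) \<and> \<phi> (letter i e2) = f (yv i))"
  by (simp add: with_images_def verts4_xv_yv ball_Un all_conj_distrib)

text \<open>If both basis letters of each factor go to a common factor, additivity extends this to
  all letters, and \<open>factor_autsI\<close> applies.\<close>

lemma factor_auts_with_images:
  assumes "\<phi> \<in> carrier aut_group" "\<And>i. \<exists>j u v. \<phi> (letter i e1) = letter j u \<and> \<phi> (letter i e2) = letter j v"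
  shows "\<phi> \<in> (factor_auts :: (F \<Rightarrow> F) set)"
proof (rule factor_autsI[OF int2_nontrivial int2_rank2 assms(1)])
  fix i
  have \<phi>: "add_hom \<phi>" using assms(1) by (simp add: carrier_aut_group)
  obtain j u v where "\<phi> (letter i e1) = letter j u" "\<phi> (letter i e2) = letter j v" using assms(2) by blast
  then have "\<exists>b. \<phi> (letter i a) = letter j b" for a
  proof (induction a rule: int2_induct)
    case (add a b)
    then obtain x y where "\<phi> (letter i a) = letter j x" "\<phi> (letter i b) = letter j y" by blast
    then show ?case by (intro exI[of _ "x + y"]) (simp add: letter_add add_hom_add[OF \<phi>])
  next
    case (minus a)
    then obtain x where "\<phi> (letter i a) = letter j x" by blast
    then show ?case by (intro exI[of _ "- x"]) (simp add: letter_minus add_hom_minus[OF \<phi>])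
  qed auto
  then show "\<exists>j. \<forall>a. \<exists>b. \<phi> (letter i a) = letter j b" by blast
qed

lemma add_hom_F_eqI:
  assumes "add_hom \<phi>" "add_hom \<psi>" "\<And>i. \<phi> (letter i e1) = \<psi> (letter i e1)" "\<And>i. \<phi> (letter i e2) = \<psi> (letter i e2)"
  shows "\<phi> = (\<psi> :: F \<Rightarrow> F)"
proof (rule add_hom_fprod_eqI[OF assms(1,2)])
  show "\<phi> (letter i a) = \<psi> (letter i a)" for i a
    using add_hom_int2_eqI[of "\<phi> \<circ> letter i" "\<psi> \<circ> letter i"] assms add_hom_comp[OF _ add_hom_letter]
    by (metis comp_apply)
qed

definition gr_gens :: "(F \<Rightarrow> F) set" where
  "gr_gens = (\<Union>\<sigma>\<in>graph_auts4. with_images (\<lambda>v. vert_letter (\<sigma> v)))"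

definition inv_gens :: "(F \<Rightarrow> F) set" where
  "inv_gens = (\<Union>a\<in>verts4. with_images (\<lambda>v. if v = a then - vert_letter a else vert_letter v))"

definition tr_gens :: "(F \<Rightarrow> F) set" where
  "tr_gens = (\<Union>i. with_images (\<lambda>v. if v = xv i then letter i e1 + letter i e2 else vert_letter v) \<union>
      with_images (\<lambda>v. if v = yv i then letter i e2 + letter i e1 else vert_letter v))"

definition pc_gens :: "(F \<Rightarrow> F) set" where
  "pc_gens = (\<Union>i. \<Union>b\<in>{xv i, yv i}. \<Union>J\<in>Pow (UNIV - {i}).
     with_images (\<lambda>v. if v \<in> xv ` J \<union> yv ` J then - vert_letter b + vert_letter v + vert_letter b else vert_letter v))"

lemma gr_gens_factor: "gr_gens \<subseteq> factor_auts"
proof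
  fix \<phi> assume "\<phi> \<in> gr_gens"
  then obtain \<sigma> where \<sigma>: "\<sigma> \<in> graph_auts4" "\<phi> \<in> with_images (\<lambda>v. vert_letter (\<sigma> v))" by (auto simp: gr_gens_def)
  have "\<exists>j u v. \<phi> (letter i e1) = letter j u \<and> \<phi> (letter i e2) = letter j v" for i
  proof -
    have "{\<sigma> (xv i), \<sigma> (yv i)} \<in> edges4"
      using \<sigma>(1) by (auto simp: graph_auts4_def verts4_xv_yv edges4_xv_yv)
    then obtain j where "\<sigma> (xv i) = xv j \<and> \<sigma> (yv i) = yv j \<or> \<sigma> (xv i) = yv j \<and> \<sigma> (yv i) = xv j"
      by (auto simp: edges4_xv_yv doubleton_eq_iff)
    then have "\<phi> (letter i e1) = letter j e1 \<and> \<phi> (letter i e2) = letter j e2 \<or>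
        \<phi> (letter i e1) = letter j e2 \<and> \<phi> (letter i e2) = letter j e1"
      using \<sigma>(2) by (auto simp: with_images_iff)
    then show ?thesis by blast
  qed
  moreover have "\<phi> \<in> carrier aut_group" using \<sigma>(2) by (simp add: with_images_iff)
  ultimately show "\<phi> \<in> factor_auts" by (intro factor_auts_with_images)
qed

lemma inv_tr_gens_factor: "inv_gens \<subseteq> factor_auts" "tr_gens \<subseteq> factor_auts"
proof -
  show "inv_gens \<subseteq> factor_auts"
  proof
    fix \<phi> assume "\<phi> \<in> inv_gens"
    then obtain a where a: "\<phi> \<in> with_images (\<lambda>v. if v = a then - vert_letter a else vert_letter v)"
      by (auto simp: inv_gens_def)
    have "\<exists>j u v. \<phi> (letter i e1) = letter j u \<and> \<phi> (letter i e2) = letter j v" for i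
      using a by (intro exI[of _ i]) (auto simp: with_images_iff simp flip: letter_minus)
    then show "\<phi> \<in> factor_auts" using a by (intro factor_auts_with_images) (auto simp: with_images_iff)
  qed
  show "tr_gens \<subseteq> factor_auts"
  proof
    fix \<phi> assume \<phi>: "\<phi> \<in> tr_gens"
    have "\<exists>j u v. \<phi> (letter i e1) = letter j u \<and> \<phi> (letter i e2) = letter j v" for i
      using \<phi> by (intro exI[of _ i]) (auto simp: tr_gens_def with_images_iff simp flip: letter_add)
    then show "\<phi> \<in> factor_auts" using \<phi> by (intro factor_auts_with_images) (auto simp: tr_gens_def with_images_iff)
  qed
qed

lemma fprod_map_gr_gens:
  assumes s: "bij s"
  shows "fprod_map s (\<lambda>_. id) \<in> gr_gens"
proof -
  define \<sigma> where "\<sigma> v = (if v \<in> range xv then xv (s (inv_into UNIV xv v)) else yv (s (inv_into UNIV yv v)))" for v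
  have inj: "inj xv" "inj yv" by (auto intro: injI)
  then have \<sigma>: "\<sigma> (xv i) = xv (s i)" "\<sigma> (yv i) = yv (s i)" for i by (auto simp: \<sigma>_def)
  have s': "s i = s j \<longleftrightarrow> i = j" for i j using s by (simp add: bij_is_inj inj_eq)
  have rs: "range s = UNIV" using s by (simp add: bij_is_surj)
  have "bij_betw \<sigma> verts4 verts4"
    unfolding bij_betw_def
  proof
    show "inj_on \<sigma> verts4"
      unfolding verts4_xv_yv by (rule inj_onI) (elim UnE rangeE; simp add: \<sigma> s')
    have "\<sigma> ` verts4 = xv ` range s \<union> yv ` range s" by (simp add: verts4_xv_yv image_Un image_image \<sigma>)
    then show "\<sigma> ` verts4 = verts4" by (simp add: rs verts4_xv_yv)
  qed
  moreover have "{\<sigma> a, \<sigma> b} \<in> edges4 \<longleftrightarrow> {a, b} \<in> edges4" if "a \<in> verts4" "b \<in> verts4" for a b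
    using that by (auto simp: verts4_xv_yv edges4_xv_yv \<sigma> doubleton_eq_iff image_iff s')
  ultimately have "\<sigma> \<in> graph_auts4" by (simp add: graph_auts4_def)
  moreover have "fprod_map s (\<lambda>_. id) \<in> with_images (\<lambda>v. vert_letter (\<sigma> v))"
    using fprod_map_aut[OF s, of "\<lambda>_. id"] monoid.one_closed[OF group.is_monoid[OF group_aut_group]]
    by (simp add: with_images_iff fprod_map_letter \<sigma>)
  ultimately show ?thesis by (auto simp: gr_gens_def)
qed

definition single_map :: "3 \<Rightarrow> (int^2 \<Rightarrow> int^2) \<Rightarrow> F \<Rightarrow> F" where
  "single_map i A = fprod_map id (\<lambda>j. if j = i then A else id)"

lemma single_map_letter: "add_hom A \<Longrightarrow> single_map i A (letter j v) = (if j = i then letter i (A v) else letter j v)"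
  unfolding single_map_def by (subst fprod_map_letter) auto

lemma single_map_aut: "A \<in> carrier aut_group \<Longrightarrow> single_map i A \<in> carrier aut_group"
  unfolding single_map_def using monoid.one_closed[OF group.is_monoid[OF group_aut_group]]
  by (intro fprod_map_aut) auto

lemma single_map_hom: "single_map i \<in> hom aut_group aut_group"
proof (rule homI)
  fix A B :: "int^2 \<Rightarrow> int^2" assume "A \<in> carrier aut_group" "B \<in> carrier aut_group"
  then have AB: "add_hom A" "add_hom B" by (simp_all add: carrier_aut_group)
  have "single_map i (A \<circ> B) = single_map i A \<circ> single_map i B"
    unfolding single_map_def using AB by (subst fprod_map_comp) (auto intro!: arg_cong[of _ _ "fprod_map id"])
  then show "single_map i (A \<otimes>\<^bsub>aut_group\<^esub> B) = single_map i A \<otimes>\<^bsub>aut_group\<^esub> single_map i B" by simp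
qed (rule single_map_aut)

lemma single_map_gens:
  "single_map i neg1 \<in> inv_gens" "single_map i neg2 \<in> inv_gens"
  "single_map i shear1 \<in> tr_gens" "single_map i shear2 \<in> tr_gens"
proof -
  have sh: "add_hom shear1" "add_hom shear2" using shear_aut by (auto simp: carrier_aut_group)
  have e: "neg1 e1 = - e1" "neg1 e2 = e2" "neg2 e1 = e1" "neg2 e2 = - e2"
    "shear1 e1 = e1 + e2" "shear1 e2 = e2" "shear2 e1 = e1" "shear2 e2 = e2 + e1"
    by (simp_all add: vec_eq_iff forall_2)
  have "single_map i neg1 \<in> with_images (\<lambda>v. if v = xv i then - vert_letter (xv i) else vert_letter v)"
    "single_map i neg2 \<in> with_images (\<lambda>v. if v = yv i then - vert_letter (yv i) else vert_letter v)"
    by (auto simp: with_images_iff single_map_aut neg_aut single_map_letter e letter_minus)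
  then show "single_map i neg1 \<in> inv_gens" "single_map i neg2 \<in> inv_gens"
    unfolding inv_gens_def verts4_xv_yv by blast+
  have "single_map i shear1 \<in> with_images (\<lambda>v. if v = xv i then letter i e1 + letter i e2 else vert_letter v)"
    "single_map i shear2 \<in> with_images (\<lambda>v. if v = yv i then letter i e2 + letter i e1 else vert_letter v)"
    by (auto simp: with_images_iff single_map_aut shear_aut single_map_letter sh e letter_add)
  then show "single_map i shear1 \<in> tr_gens" "single_map i shear2 \<in> tr_gens"
    unfolding tr_gens_def by blast+
qed

interpretation AutF: group "aut_group :: (F \<Rightarrow> F) monoid" by (rule group_aut_group)

text \<open>A factor automorphism is a permutation of the factors composed with three automorphisms
  of single factors. The permutation is a graph automorphism, and the single ones come from
  inversions and transvections because these give generators of GL_2(Z).\<close>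

lemma generate_gr_inv_tr: "generate aut_group (gr_gens \<union> inv_gens \<union> tr_gens) = factor_auts"
proof
  let ?K = "generate aut_group (gr_gens \<union> inv_gens \<union> tr_gens)"
  show "?K \<subseteq> factor_auts"
    using gr_gens_factor inv_tr_gens_factor by (intro AutF.generate_subgroup_incl subgroup_factor_auts) auto
  have K: "subgroup ?K aut_group"
    using gr_gens_factor inv_tr_gens_factor subgroup.subset[OF subgroup_factor_auts]
    by (intro AutF.generate_is_subgroup) blast
  have single: "single_map i A \<in> ?K" if "A \<in> carrier aut_group" for i A
  proof -
    \<comment> \<open>Pulling the subgroup back along \<open>single_map i\<close> reduces the claim
      to generators of the automorphism group of one factor.\<close>
    let ?H = "{A \<in> carrier aut_group. single_map i A \<in> ?K}"
    interpret group_hom aut_group aut_group "single_map i"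
      by (simp add: group_hom_def group_hom_axioms_def single_map_hom)
    have "subgroup ?H aut_group"
    proof (rule G.subgroupI)
      show "?H \<noteq> {}" using G.one_closed subgroup.one_closed[OF K] hom_one by fastforce
      show "inv\<^bsub>aut_group\<^esub> a \<in> ?H" if "a \<in> ?H" for a
        using that subgroup.m_inv_closed[OF K] by (simp add: hom_inv)
      show "a \<otimes>\<^bsub>aut_group\<^esub> b \<in> ?H" if "a \<in> ?H" "b \<in> ?H" for a b
        using that subgroup.m_closed[OF K] G.m_closed hom_mult by (simp del: mult_aut_group)
    qed auto
    moreover have "shear1 \<in> ?H" "shear2 \<in> ?H" "neg1 \<in> ?H" "neg2 \<in> ?H"
      using shear_aut neg_aut single_map_gens by (auto intro: generate.incl)
    ultimately have "carrier aut_group \<subseteq> ?H" by (rule shear_neg_generate)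
    with that show ?thesis by blast
  qed
  show "factor_auts \<subseteq> ?K"
  proof
    fix \<phi> :: "F \<Rightarrow> F" assume "\<phi> \<in> factor_auts"
    then obtain s A where \<phi>: "\<phi> = fprod_map s A" "bij s" "\<And>i. A i \<in> carrier aut_group"
      unfolding factor_auts_def by blast
    have A: "add_hom (A i)" for i using \<phi>(3) by (simp add: carrier_aut_group)
    let ?\<psi> = "fprod_map s (\<lambda>_. id) \<circ> (single_map 1 (A 1) \<circ> (single_map 2 (A 2) \<circ> single_map 3 (A 3)))"
    have "\<phi> = ?\<psi>"
    proof (rule add_hom_fprod_eqI_3)
      show "add_hom ?\<psi>"
        using single_map_aut[OF \<phi>(3)] by (intro add_hom_comp add_hom_fprod_map) (auto simp: carrier_aut_group)
    qed (simp_all add: \<phi>(1) A add_hom_fprod_map fprod_map_letter single_map_letter)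
    moreover have "?\<psi> \<in> ?K"
      using fprod_map_gr_gens[OF \<phi>(2)] single[OF \<phi>(3)] subgroup.m_closed[OF K]
      by (simp add: generate.incl)
    ultimately show "\<phi> \<in> ?K" by simp
  qed
qed

lemma pconj_pure_conj: "j \<notin> J \<Longrightarrow> pconj (letter j a) J \<in> pure_conj" for a :: "'a::ab_group_add"
proof -
  assume "j \<notin> J"
  have "\<exists>g. \<forall>b. pconj (letter j a) J (letter i b) = g + letter i b - g" for i
    by (cases "i \<in> J") (auto simp: pconj_letter intro: exI[of _ "letter j a"] exI[of _ 0])
  then show ?thesis using pconj_aut[OF \<open>j \<notin> J\<close>] by (simp add: pure_conj_def)
qed

text \<open>A partial conjugation is defined by a -> b^-1 a b, whereas \<open>pconj\<close>
  conjugates by c + x - c; hence the sign of \<open>e\<close>. The set is a singleton because images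
  of the basis letters determine a homomorphism.\<close>

lemma pconj_with_images:
  assumes "i \<notin> J" "b = xv i \<and> e = e1 \<or> b = yv i \<and> e = e2"
  shows "with_images (\<lambda>v. if v \<in> xv ` J \<union> yv ` J then - vert_letter b + vert_letter v + vert_letter b else vert_letter v)
    = {pconj (letter i (- e)) J}"
proof -
  have b: "vert_letter b = letter i e" using assms(2) by auto
  have "pconj (letter i (- e)) J \<in> with_images
    (\<lambda>v. if v \<in> xv ` J \<union> yv ` J then - vert_letter b + vert_letter v + vert_letter b else vert_letter v)"
    using assms(1) pconj_aut[OF assms(1), of "- e"] by (auto simp: with_images_iff pconj_letter b letter_minus)
  moreover have "\<phi> = \<psi>" if "\<phi> \<in> with_images f" "\<psi> \<in> with_images f" for \<phi> \<psi> f
    using that by (intro add_hom_F_eqI) (auto simp: with_images_iff carrier_aut_group)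
  ultimately show ?thesis by blast
qed

text \<open>The generators from \<open>pure_conj_generated\<close> conjugate one factor by an
  arbitrary letter. They depend additively on that letter, so the letters of \<open>e1\<close> and
  \<open>e2\<close> and their inverses suffice.\<close>

lemma generate_pc: "generate aut_group pc_gens = pure_conj"
proof
  have sub: "pc_gens \<subseteq> pure_conj"
  proof
    fix \<phi> assume "\<phi> \<in> pc_gens"
    then obtain i b J where *: "b \<in> {xv i, yv i}" "J \<subseteq> UNIV - {i}"
      "\<phi> \<in> with_images (\<lambda>v. if v \<in> xv ` J \<union> yv ` J then - vert_letter b + vert_letter v + vert_letter b else vert_letter v)"
      unfolding pc_gens_def by blast
    then obtain e where "b = xv i \<and> e = e1 \<or> b = yv i \<and> e = e2" by blast
    moreover have i: "i \<notin> J" using *(2) by blast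
    ultimately have "\<phi> = pconj (letter i (- e)) J"
      using pconj_with_images[of i J b e] *(3) by blast
    with pconj_pure_conj[OF i] show "\<phi> \<in> pure_conj" by simp
  qed
  then show "generate aut_group pc_gens \<subseteq> pure_conj"
    by (rule AutF.generate_subgroup_incl[OF _ subgroup_pure_conj])
  have K: "subgroup (generate aut_group pc_gens) aut_group"
    using sub subgroup.subset[OF subgroup_pure_conj] by (intro AutF.generate_is_subgroup) blast
  have "pconj (letter i a) {j} \<in> generate aut_group pc_gens" if "i \<noteq> j" for i j and a :: "int^2"
  proof -
    have gen: "pconj (letter i (- e)) {j} \<in> generate aut_group pc_gens" if "b = xv i \<and> e = e1 \<or> b = yv i \<and> e = e2" for b e
    proof (rule generate.incl)
      have "{j} \<in> Pow (UNIV - {i})" "b \<in> {xv i, yv i}" using \<open>i \<noteq> j\<close> that by auto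
      moreover have "pconj (letter i (- e)) {j} \<in> with_images
        (\<lambda>v. if v \<in> xv ` {j} \<union> yv ` {j} then - vert_letter b + vert_letter v + vert_letter b else vert_letter v)"
        using pconj_with_images[OF _ that, of "{j}"] \<open>i \<noteq> j\<close> by auto
      ultimately show "pconj (letter i (- e)) {j} \<in> pc_gens" unfolding pc_gens_def by blast
    qed
    have ij: "i \<notin> {j}" using that by simp
    have inv: "pconj (letter i (- a)) {j} \<in> generate aut_group pc_gens" if "pconj (letter i a) {j} \<in> generate aut_group pc_gens" for a :: "int^2"
    proof -
      have "pconj (letter i (- a)) {j} = inv\<^bsub>aut_group\<^esub> pconj (letter i a) {j}"
        by (rule AutF.inv_equality[symmetric]) (simp_all add: pconj_aut[OF ij] flip: pconj_add[OF ij])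
      then show ?thesis using subgroup.m_inv_closed[OF K that] by simp
    qed
    show ?thesis
    proof (induction a rule: int2_induct)
      case e1
      show ?case using inv[OF gen[of "xv i" e1]] by simp
    next
      case e2
      show ?case using inv[OF gen[of "yv i" e2]] by simp
    next
      case (add a b)
      then show ?case using subgroup.m_closed[OF K add] by (simp only: pconj_add[OF ij] mult_aut_group)
    qed (rule inv)
  qed
  then have "{pconj (letter i (a :: int^2)) {j} | i a j. i \<noteq> j} \<subseteq> generate aut_group pc_gens" by blast
  note gen = AutF.generate_subgroup_incl[OF this K]
  show "pure_conj \<subseteq> generate aut_group pc_gens"
  proof
    fix \<phi> :: "F \<Rightarrow> F" assume "\<phi> \<in> pure_conj"
    then obtain g where "\<phi> \<in> carrier aut_group" "\<And>i a. \<phi> (letter i a) = g i + letter i a - g i"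
      unfolding pure_conj_def by (auto simp: choice_iff)
    then have "\<phi> \<in> generate aut_group {pconj (letter i a) {j} | i a j. i \<noteq> j}"
      by (rule pure_conj_generated) (rule int2_nontrivial)
    then show "\<phi> \<in> generate aut_group pc_gens" using gen by blast
  qed
qed

section \<open>The group \<open>GL\<^sub>2(\<int>) \<wr> S\<^sub>3\<close>\<close>

lemma matrix_aut:
  assumes "invertible (M :: int^2^2)"
  shows "(*v) M \<in> carrier aut_group"
proof -
  obtain N where N: "M ** N = mat 1" "N ** M = mat 1" using assms by (auto simp: invertible_def)
  show ?thesis
    by (rule aut_groupI[of _ "(*v) N"])
      (simp_all add: add_hom_def matrix_vector_right_distrib fun_eq_iff matrix_vector_mul_assoc N)
qed

definition hom_matrix :: "(int^2 \<Rightarrow> int^2) \<Rightarrow> int^2^2" where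
  "hom_matrix A = vector [vector [A e1 $ 1, A e2 $ 1], vector [A e1 $ 2, A e2 $ 2]]"

lemma hom_matrix: "add_hom A \<Longrightarrow> hom_matrix A *v v = A v"
  using add_hom_int2_expand[of A v]
  by (simp add: vec_eq_iff forall_2 hom_matrix_def matrix_vector_mult_def sum_2 mult.commute)

lemma invertible_hom_matrix:
  assumes "A \<in> carrier aut_group" shows "invertible (hom_matrix A)"
proof -
  have A: "add_hom A" "bij A" using assms by (auto simp: carrier_aut_group)
  note B = add_hom_inv[OF A]
  have "hom_matrix A ** hom_matrix (inv_into UNIV A) = mat 1" "hom_matrix (inv_into UNIV A) ** hom_matrix A = mat 1"
    using A by (simp_all add: matrix_eq hom_matrix[OF A(1)] hom_matrix[OF B] bij_is_surj surj_f_inv_f bij_is_inj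
        flip: matrix_vector_mul_assoc)
  then show ?thesis by (auto simp: invertible_def)
qed

text \<open>The matrices are indexed by the target factor: first permute by \<open>p\<close>, then
  apply \<open>M\<close>. This matches the multiplication of the semidirect product, where
  \<open>p\<close> acts by precomposition with its inverse.\<close>

definition wreath_map :: "(nat \<Rightarrow> int^2^2) \<times> (nat \<Rightarrow> nat) \<Rightarrow> F \<Rightarrow> F" where
  "wreath_map = (\<lambda>(M, p). fprod_map (\<lambda>i. of_nat (p (index3 i))) (\<lambda>i. (*v) (M (p (index3 i)))))"

lemma carrier_GL2Z_cubed: "M \<in> carrier GL2Z_cubed \<longleftrightarrow> M \<in> extensional {1..3} \<and> (\<forall>k\<in>{1..3}. invertible (M k))"
  by (auto simp: GL2Z_cubed_def GL2Z_def PiE_def Pi_def)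

lemma index3_mem: "index3 i \<in> {1..3}"
  by simp

context
  fixes M :: "nat \<Rightarrow> int^2^2" and p :: "nat \<Rightarrow> nat"
  assumes M: "M \<in> carrier GL2Z_cubed" and p: "p permutes {1..3}"
begin

lemma p_index3: "p (index3 i) \<in> {1..3}"
  using p index3_mem by (simp only: permutes_in_image)

lemma wreath_matrix_aut: "(*v) (M (p (index3 i))) \<in> carrier aut_group"
  using M p_index3 by (intro matrix_aut) (simp only: carrier_GL2Z_cubed)

lemma wreath_matrix_hom: "add_hom ((*v) (M (p (index3 i))))"
  using wreath_matrix_aut by (simp add: carrier_aut_group)

lemma wreath_map_letter: "wreath_map (M, p) (letter i v) = letter (of_nat (p (index3 i))) (M (p (index3 i)) *v v)"
  unfolding wreath_map_def prod.case by (rule fprod_map_letter) (rule wreath_matrix_hom)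

lemma wreath_map_factor_auts: "wreath_map (M, p) \<in> factor_auts"
proof -
  have "bij (\<lambda>i. of_nat (p (index3 i)) :: 3)"
  proof (rule bijI)
    show "inj (\<lambda>i. of_nat (p (index3 i)) :: 3)"
    proof (rule injI)
      fix i j assume "of_nat (p (index3 i)) = (of_nat (p (index3 j)) :: 3)"
      then have "p (index3 i) = p (index3 j)" using index3_of_nat[OF p_index3] by metis
      then have "index3 i = index3 j" using p by (simp add: permutes_inj inj_eq)
      then show "i = j" by (metis of_nat_index3)
    qed
    then show "surj (\<lambda>i. of_nat (p (index3 i)) :: 3)" by (simp add: finite_UNIV_inj_surj)
  qed
  then show ?thesis
    unfolding factor_auts_def wreath_map_def prod.case using wreath_matrix_aut by blast
qed

end

lemma carrier_GL2Z_wr_S3: "carrier GL2Z_wr_S3 = {(M, p). M \<in> carrier GL2Z_cubed \<and> p permutes {1..3}}"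
  by (auto simp: GL2Z_wr_S3_def semidirect_def sym_group_def)

lemma mult_GL2Z_wr_S3:
  assumes "N \<in> carrier GL2Z_cubed"
  shows "(M, p) \<otimes>\<^bsub>GL2Z_wr_S3\<^esub> (N, q) = (\<lambda>k\<in>{1..3}. M k ** N (inv_into {1..3} p k), p \<circ> q)"
  using assms
  by (auto simp: GL2Z_wr_S3_def semidirect_def sym_group_def perm_action_def fun_eq_iff GL2Z_def
      simp flip: GL2Z_cubed_def) (auto simp: GL2Z_cubed_def GL2Z_def)

lemma mult_closed_GL2Z_wr_S3:
  assumes "x \<in> carrier GL2Z_wr_S3" "y \<in> carrier GL2Z_wr_S3"
  shows "x \<otimes>\<^bsub>GL2Z_wr_S3\<^esub> y \<in> carrier GL2Z_wr_S3"
proof -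
  obtain M p N q where x: "x = (M, p)" "M \<in> carrier GL2Z_cubed" "p permutes {1..3}"
    and y: "y = (N, q)" "N \<in> carrier GL2Z_cubed" "q permutes {1..3}"
    using assms by (auto simp: carrier_GL2Z_wr_S3)
  have "invertible (M k ** N (inv_into {1..3} p k))" if "k \<in> {1..3}" for k
  proof (rule invertible_mult)
    have "inv_into {1..3} p k \<in> {1..3}"
      using that x(3) by (intro inv_into_into) (simp only: permutes_image)
    then show "invertible (N (inv_into {1..3} p k))" using y(2) by (simp only: carrier_GL2Z_cubed)
    show "invertible (M k)" using that x(2) by (simp only: carrier_GL2Z_cubed)
  qed
  then show ?thesis
    using x y by (simp add: mult_GL2Z_wr_S3 carrier_GL2Z_wr_S3 carrier_GL2Z_cubed permutes_compose del: One_nat_def)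
qed

lemma wreath_map_iso: "wreath_map \<in> iso GL2Z_wr_S3 (aut_group\<lparr>carrier := factor_auts\<rparr>)"
  unfolding iso_iff
proof (intro conjI)
  show "wreath_map \<in> hom GL2Z_wr_S3 (aut_group\<lparr>carrier := factor_auts\<rparr>)"
  proof (rule homI)
    fix x assume "x \<in> carrier GL2Z_wr_S3"
    then show "wreath_map x \<in> carrier (aut_group\<lparr>carrier := factor_auts\<rparr>)"
      by (auto simp: carrier_GL2Z_wr_S3 wreath_map_factor_auts)
  next
    fix x y assume "x \<in> carrier GL2Z_wr_S3" "y \<in> carrier GL2Z_wr_S3"
    then obtain M p N q where x: "x = (M, p)" "M \<in> carrier GL2Z_cubed" "p permutes {1..3}"
      and y: "y = (N, q)" "N \<in> carrier GL2Z_cubed" "q permutes {1..3}"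
      by (auto simp: carrier_GL2Z_wr_S3)
    have "inj_on p {1..3}" using x(3) by (simp add: permutes_inj_on)
    \<comment> \<open>At the target p (q i), the action of \<open>p\<close> moves the second matrix
      back to the index q i, which is the factor reached by the second map.\<close>
    then have inv: "inv_into {1..3} p (p (q (index3 i))) = q (index3 i)" for i
      using p_index3[OF y(2,3)] by (intro inv_into_f_f)
    have pq: "p (q (index3 i)) \<in> {1..3}" for i
      using p_index3[OF y(2,3)] x(3) by (simp only: permutes_in_image)
    have "wreath_map (x \<otimes>\<^bsub>GL2Z_wr_S3\<^esub> y) =
      fprod_map (\<lambda>i. of_nat (p (q (index3 i)))) (\<lambda>i. (*v) (M (p (q (index3 i))) ** N (q (index3 i))))"
      using pq by (simp add: x(1) y(1) mult_GL2Z_wr_S3[OF y(2)] wreath_map_def inv del: atLeastAtMost_iff One_nat_def)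
    also have "\<dots> = wreath_map x \<circ> wreath_map y"
      unfolding x(1) y(1) wreath_map_def prod.case
      by (subst fprod_map_comp[OF wreath_matrix_hom[OF x(2,3)] wreath_matrix_hom[OF y(2,3)]])
        (simp add: comp_def index3_of_nat[OF p_index3[OF y(2,3)]] matrix_vector_mul_assoc)
    finally show "wreath_map (x \<otimes>\<^bsub>GL2Z_wr_S3\<^esub> y) = wreath_map x \<otimes>\<^bsub>aut_group\<lparr>carrier := factor_auts\<rparr>\<^esub> wreath_map y"
      by simp
  qed
  show "inj_on wreath_map (carrier GL2Z_wr_S3)"
  proof (rule inj_onI)
    fix x y assume "x \<in> carrier GL2Z_wr_S3" "y \<in> carrier GL2Z_wr_S3" and eq: "wreath_map x = wreath_map y"
    then obtain M p N q where x: "x = (M, p)" "M \<in> carrier GL2Z_cubed" "p permutes {1..3}"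
      and y: "y = (N, q)" "N \<in> carrier GL2Z_cubed" "q permutes {1..3}"
      by (auto simp: carrier_GL2Z_wr_S3)
    have l: "letter (of_nat (p (index3 i)) :: 3) (M (p (index3 i)) *v v) = letter (of_nat (q (index3 i))) (N (q (index3 i)) *v v)" for i v
      using fun_cong[OF eq, of "letter i v"] x y by (simp add: wreath_map_letter)
    have pq: "p (index3 i) = q (index3 i)" for i
    proof -
      \<comment> \<open>The zero letter does not remember its factor, so \<open>p\<close> can be
        recovered only from a nonzero image.\<close>
      have "M (p (index3 i)) *v e1 \<noteq> 0"
      proof
        assume "M (p (index3 i)) *v e1 = 0"
        then have "M (p (index3 i)) *v e1 = M (p (index3 i)) *v 0" by simp
        moreover have "inj ((*v) (M (p (index3 i))))"
          using wreath_matrix_aut[OF x(2,3)] by (simp add: carrier_aut_group bij_is_inj)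
        ultimately have "e1 = 0" by (rule injD[rotated])
        then show False by (simp add: vec_eq_iff forall_2)
      qed
      then have "of_nat (p (index3 i)) = (of_nat (q (index3 i)) :: 3)"
        using l[of i e1] by (simp add: letter_eq_iff)
      then show ?thesis using index3_of_nat[OF p_index3[OF x(2,3)]] index3_of_nat[OF p_index3[OF y(2,3)]] by metis
    qed
    have "p = q"
    proof
      fix k show "p k = q k"
      proof (cases "k \<in> {1..3}")
        case True
        then show ?thesis using pq[of "of_nat k"] by (simp only: index3_of_nat)
      next
        case False
        then show ?thesis using x(3) y(3) by (simp add: permutes_def)
      qed
    qed
    moreover have "M = N"
    proof (rule extensionalityI)
      show "M \<in> extensional {1..3}" "N \<in> extensional {1..3}" using x(2) y(2) by (simp_all only: carrier_GL2Z_cubed)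
      fix k :: nat assume "k \<in> {1..3}"
      then have "k \<in> p ` {1..3}" using x(3) by (simp only: permutes_image)
      then obtain i where k: "k = p (index3 i)" unfolding range_index3 by blast
      have "M k *v v = N k *v v" for v
        using l[of i v] by (simp add: letter_eq_iff flip: pq k)
      then show "M k = N k" by (simp add: matrix_eq)
    qed
    ultimately show "x = y" by (simp add: x y)
  qed
  show "wreath_map ` carrier GL2Z_wr_S3 = carrier (aut_group\<lparr>carrier := factor_auts\<rparr>)"
  proof
    show "wreath_map ` carrier GL2Z_wr_S3 \<subseteq> carrier (aut_group\<lparr>carrier := factor_auts\<rparr>)"
      by (auto simp: carrier_GL2Z_wr_S3 wreath_map_factor_auts)
    show "carrier (aut_group\<lparr>carrier := factor_auts\<rparr>) \<subseteq> wreath_map ` carrier GL2Z_wr_S3"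
    proof
      fix \<phi> assume "\<phi> \<in> carrier (aut_group\<lparr>carrier := factor_auts :: (F \<Rightarrow> F) set\<rparr>)"
      then obtain s A where \<phi>: "\<phi> = fprod_map s A" "bij s" "\<And>i. A i \<in> carrier aut_group"
        by (auto simp: factor_auts_def)
      define p where "p k = (if k \<in> {1..3} then index3 (s (of_nat k)) else k)" for k
      define M where "M = (\<lambda>k\<in>{1..3::nat}. hom_matrix (A (inv_into UNIV s (of_nat k))))"
      have p: "p permutes {1..3}"
      proof (rule bij_imp_permutes)
        have "inj_on p {1..3}"
        proof (rule inj_onI)
          fix k l assume kl: "k \<in> {1..3}" "l \<in> {1..3}" "p k = p l"
          then have "s (of_nat k) = s (of_nat l)" by (metis p_def of_nat_index3)
          then have "(of_nat k :: 3) = of_nat l" using \<phi>(2) by (simp add: bij_is_inj inj_eq)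
          then show "k = l" using index3_of_nat[OF kl(1)] index3_of_nat[OF kl(2)] by metis
        qed
        moreover have "p ` {1..3} \<subseteq> {1..3}" using index3_mem by (auto simp: p_def)
        ultimately show "bij_betw p {1..3} {1..3}" by (simp add: bij_betw_def endo_inj_surj)
      qed (auto simp: p_def)
      have M: "M \<in> carrier GL2Z_cubed"
        unfolding carrier_GL2Z_cubed by (auto simp: M_def intro: invertible_hom_matrix \<phi>(3))
      have pi: "p (index3 i) = index3 (s i)" for i by (simp add: p_def)
      have Mi: "M (p (index3 i)) *v v = A i v" for i v
        using \<phi>(2) \<phi>(3)[of i] by (simp add: pi M_def hom_matrix carrier_aut_group bij_is_inj)
      have "wreath_map (M, p) = \<phi>"
      proof -
        have "(\<lambda>i. of_nat (p (index3 i))) = s" by (simp add: pi)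
        moreover have "(\<lambda>i. (*v) (M (p (index3 i)))) = A" using Mi by (intro ext)
        ultimately show ?thesis by (simp only: wreath_map_def prod.case \<phi>(1))
      qed
      then show "\<phi> \<in> wreath_map ` carrier GL2Z_wr_S3"
        using M p by (force simp: carrier_GL2Z_wr_S3)
    qed
  qed
qed

section \<open>Semidirect products\<close>

lemma carrier_semidirect [simp]: "carrier (semidirect N H \<alpha>) = carrier N \<times> carrier H"
  and mult_semidirect [simp]: "(a, b) \<otimes>\<^bsub>semidirect N H \<alpha>\<^esub> (c, d) = (a \<otimes>\<^bsub>N\<^esub> \<alpha> b c, b \<otimes>\<^bsub>H\<^esub> d)"
  by (simp_all add: semidirect_def)

lemma AutoGroup_mult:
  assumes "f \<in> carrier (AutoGroup G)" "g \<in> carrier (AutoGroup G)"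
  shows "f \<otimes>\<^bsub>AutoGroup G\<^esub> g = compose (carrier G) f g"
  using assms by (simp add: AutoGroup_def BijGroup_def auto_def)

context
  fixes G :: "'a monoid" (structure)
  assumes group: "group G"
begin

interpretation group G by (rule group)

lemma internal_semidirect_unique:
  assumes "is_internal_semidirect G N H" and e: "n \<otimes> h = n' \<otimes> h'" and nh: "n \<in> N" "n' \<in> N" "h \<in> H" "h' \<in> H"
  shows "n = n'" "h = h'"
proof -
  have N: "subgroup N G" and H: "subgroup H G" and int: "N \<inter> H = {\<one>}"
    using assms(1) normal_imp_subgroup by (auto simp: is_internal_semidirect_def)
  have cl: "n \<in> carrier G" "n' \<in> carrier G" "h \<in> carrier G" "h' \<in> carrier G"
    using nh subgroup.mem_carrier[OF N] subgroup.mem_carrier[OF H] by auto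
  have "inv n' \<otimes> n = inv n' \<otimes> (n \<otimes> h) \<otimes> inv h" using cl by (simp add: m_assoc)
  also have "\<dots> = h' \<otimes> inv h" unfolding e using cl by (simp flip: m_assoc)
  finally have "h' \<otimes> inv h \<in> N"
    using subgroup.m_closed[OF N subgroup.m_inv_closed[OF N nh(2)] nh(1)] by simp
  moreover have "h' \<otimes> inv h \<in> H"
    using nh H by (intro subgroup.m_closed subgroup.m_inv_closed) auto
  ultimately have "h' \<otimes> inv h = \<one>" using int by blast
  then show "h = h'" using cl by (metis inv_solve_right l_one one_closed)
  with e cl show "n = n'" by simp
qed

text \<open>The action is conjugation inside \<open>G\<close>, read through \<open>f\<close> and
  \<open>g\<close>. Of \<open>A\<close> and \<open>B\<close> only closure under multiplication is
  assumed, the remaining group structure being visible in \<open>G\<close>; so iterated semidirect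
  products can be inserted directly.\<close>

lemma internal_semidirect_imp_external:
  assumes NH: "is_internal_semidirect G N H"
    and f: "f \<in> iso A (G\<lparr>carrier := N\<rparr>)" and g: "g \<in> iso B (G\<lparr>carrier := H\<rparr>)"
    and A: "\<And>x y. x \<in> carrier A \<Longrightarrow> y \<in> carrier A \<Longrightarrow> x \<otimes>\<^bsub>A\<^esub> y \<in> carrier A"
    and B: "\<And>x y. x \<in> carrier B \<Longrightarrow> y \<in> carrier B \<Longrightarrow> x \<otimes>\<^bsub>B\<^esub> y \<in> carrier B"
  shows "\<exists>\<alpha>\<in>hom B (AutoGroup A). (\<lambda>(u, v). f u \<otimes> g v) \<in> iso (semidirect A B \<alpha>) G"
proof -
  have N: "N \<lhd> G" "subgroup N G" and H: "subgroup H G" and prod: "N <#> H = carrier G"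
    using NH normal_imp_subgroup by (auto simp: is_internal_semidirect_def)
  have f': "inj_on f (carrier A)" "f ` carrier A = N" "\<And>x y. x \<in> carrier A \<Longrightarrow> y \<in> carrier A \<Longrightarrow> f (x \<otimes>\<^bsub>A\<^esub> y) = f x \<otimes> f y"
    using f by (auto simp: iso_iff hom_def)
  have g': "inj_on g (carrier B)" "g ` carrier B = H" "\<And>x y. x \<in> carrier B \<Longrightarrow> y \<in> carrier B \<Longrightarrow> g (x \<otimes>\<^bsub>B\<^esub> y) = g x \<otimes> g y"
    using g by (auto simp: iso_iff hom_def)
  have fN: "f x \<in> N" and fc: "f x \<in> carrier G" if "x \<in> carrier A" for x
    using f'(2) that subgroup.subset[OF N(2)] by auto
  have gH: "g x \<in> H" and gc: "g x \<in> carrier G" if "x \<in> carrier B" for x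
    using g'(2) that subgroup.subset[OF H] by auto
  \<comment> \<open>The restriction to the carrier makes the map extensional, as membership in
    \<open>AutoGroup\<close> demands.\<close>
  define \<alpha> where "\<alpha> v = (\<lambda>u\<in>carrier A. inv_into (carrier A) f (g v \<otimes> f u \<otimes> inv g v))" for v
  have conj_N: "g v \<otimes> n \<otimes> inv g v \<in> N" "inv g v \<otimes> n \<otimes> g v \<in> N"
    if "v \<in> carrier B" "n \<in> N" for n v
    using normal.inv_op_closed2[OF N(1) gc[OF that(1)] that(2)] normal.inv_op_closed1[OF N(1) gc[OF that(1)] that(2)] .
  have f\<alpha>: "f (\<alpha> v u) = g v \<otimes> f u \<otimes> inv g v" and \<alpha>c: "\<alpha> v u \<in> carrier A"
    if "v \<in> carrier B" "u \<in> carrier A" for u v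
  proof -
    have "g v \<otimes> f u \<otimes> inv g v \<in> f ` carrier A"
      using conj_N(1)[OF that(1) fN[OF that(2)]] f'(2) by simp
    then show "f (\<alpha> v u) = g v \<otimes> f u \<otimes> inv g v" "\<alpha> v u \<in> carrier A"
      using that by (simp_all add: \<alpha>_def f_inv_into_f inv_into_into)
  qed
  have f_eqI: "x = y" if "f x = f y" "x \<in> carrier A" "y \<in> carrier A" for x y
    using f'(1) that by (simp add: inj_on_eq_iff)
  have \<alpha>_auto: "\<alpha> v \<in> carrier (AutoGroup A)" if v: "v \<in> carrier B" for v
  proof -
    note gv = gc[OF v]
    have "inj_on (\<alpha> v) (carrier A)"
    proof (rule inj_onI)
      fix x y assume xy: "x \<in> carrier A" "y \<in> carrier A" "\<alpha> v x = \<alpha> v y"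
      then have "g v \<otimes> f x \<otimes> inv g v = g v \<otimes> f y \<otimes> inv g v"
        using f\<alpha>[OF v] by metis
      then have "f x = f y" using xy fc gv by simp
      then show "x = y" using xy by (intro f_eqI)
    qed
    moreover have "\<alpha> v ` carrier A = carrier A"
    proof
      show "\<alpha> v ` carrier A \<subseteq> carrier A" using \<alpha>c[OF v] by blast
      show "carrier A \<subseteq> \<alpha> v ` carrier A"
      proof
        fix w assume w: "w \<in> carrier A"
        obtain u where u: "u \<in> carrier A" "f u = inv g v \<otimes> f w \<otimes> g v"
          using conj_N(2)[OF v fN[OF w]] f'(2) by (metis imageE)
        have "f (\<alpha> v u) = f w"
          unfolding f\<alpha>[OF v u(1)] u(2) using fc[OF w] gv by (simp add: m_assoc) (simp flip: m_assoc)
        then have "\<alpha> v u = w" using \<alpha>c[OF v u(1)] w by (rule f_eqI)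
        then show "w \<in> \<alpha> v ` carrier A" using u(1) by blast
      qed
    qed
    moreover have "\<alpha> v \<in> hom A A"
    proof (rule homI)
      fix x y assume xy: "x \<in> carrier A" "y \<in> carrier A"
      have "f (\<alpha> v (x \<otimes>\<^bsub>A\<^esub> y)) = f (\<alpha> v x \<otimes>\<^bsub>A\<^esub> \<alpha> v y)"
        using xy fc gv by (simp add: f\<alpha>[OF v] \<alpha>c[OF v] f'(3) A m_assoc) (simp flip: m_assoc)
      then show "\<alpha> v (x \<otimes>\<^bsub>A\<^esub> y) = \<alpha> v x \<otimes>\<^bsub>A\<^esub> \<alpha> v y"
        using xy by (intro f_eqI) (simp_all add: \<alpha>c[OF v] A)
    qed (rule \<alpha>c[OF v])
    ultimately show ?thesis
      by (simp add: AutoGroup_def auto_def Bij_def bij_betw_def \<alpha>_def)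
  qed
  have "\<alpha> \<in> hom B (AutoGroup A)"
  proof (rule homI[OF \<alpha>_auto])
    fix v w assume vw: "v \<in> carrier B" "w \<in> carrier B"
    have vw': "v \<otimes>\<^bsub>B\<^esub> w \<in> carrier B" using vw by (rule B)
    show "\<alpha> (v \<otimes>\<^bsub>B\<^esub> w) = \<alpha> v \<otimes>\<^bsub>AutoGroup A\<^esub> \<alpha> w"
      unfolding AutoGroup_mult[OF \<alpha>_auto[OF vw(1)] \<alpha>_auto[OF vw(2)]]
    proof (rule extensionalityI[of _ "carrier A"])
      fix u assume u: "u \<in> carrier A"
      have "f (\<alpha> (v \<otimes>\<^bsub>B\<^esub> w) u) = f (\<alpha> v (\<alpha> w u))"
        using fc[OF u] gc[OF vw(1)] gc[OF vw(2)]
        by (simp add: f\<alpha>[OF vw'] f\<alpha> u vw \<alpha>c g'(3) m_assoc inv_mult_group)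
      then show "\<alpha> (v \<otimes>\<^bsub>B\<^esub> w) u = compose (carrier A) (\<alpha> v) (\<alpha> w) u"
        using u vw vw' by (simp add: compose_def) (intro f_eqI \<alpha>c)
    qed (simp_all add: \<alpha>_def)
  qed
  moreover have "(\<lambda>(u, v). f u \<otimes> g v) \<in> iso (semidirect A B \<alpha>) G"
    unfolding iso_iff
  proof (intro conjI)
    show "(\<lambda>(u, v). f u \<otimes> g v) \<in> hom (semidirect A B \<alpha>) G"
    proof (rule homI)
      fix x y assume "x \<in> carrier (semidirect A B \<alpha>)" "y \<in> carrier (semidirect A B \<alpha>)"
      then obtain u v u' v' where xy: "x = (u, v)" "y = (u', v')" and *: "u \<in> carrier A" "v \<in> carrier B" "u' \<in> carrier A" "v' \<in> carrier B"
        by auto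
      show "(case x \<otimes>\<^bsub>semidirect A B \<alpha>\<^esub> y of (u, v) \<Rightarrow> f u \<otimes> g v) =
          (case x of (u, v) \<Rightarrow> f u \<otimes> g v) \<otimes> (case y of (u, v) \<Rightarrow> f u \<otimes> g v)"
        using * fc gc by (simp add: xy f'(3) g'(3) \<alpha>c f\<alpha> m_assoc) (simp flip: m_assoc)
    qed (auto simp: fc gc)
    show "inj_on (\<lambda>(u, v). f u \<otimes> g v) (carrier (semidirect A B \<alpha>))"
    proof (rule inj_onI)
      fix x y assume "x \<in> carrier (semidirect A B \<alpha>)" "y \<in> carrier (semidirect A B \<alpha>)"
        and eq: "(case x of (u, v) \<Rightarrow> f u \<otimes> g v) = (case y of (u, v) \<Rightarrow> f u \<otimes> g v)"
      then obtain u v u' v' where xy: "x = (u, v)" "y = (u', v')" and *: "u \<in> carrier A" "v \<in> carrier B" "u' \<in> carrier A" "v' \<in> carrier B"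
        by auto
      have "f u = f u'" "g v = g v'"
        using internal_semidirect_unique[OF NH, of "f u" "g v" "f u'" "g v'"] eq * fN gH by (simp_all add: xy)
      moreover have "u = u'" if "f u = f u'" using that * by (intro f_eqI)
      moreover have "v = v'" if "g v = g v'" using that g'(1) * by (simp add: inj_on_eq_iff)
      ultimately show "x = y" by (simp add: xy)
    qed
    show "(\<lambda>(u, v). f u \<otimes> g v) ` carrier (semidirect A B \<alpha>) = carrier G"
      unfolding prod[symmetric] set_mult_def f'(2)[symmetric] g'(2)[symmetric] by auto
  qed
  ultimately show ?thesis by blast
qed

text \<open>The projection takes the factor in \<open>H\<close> of the unique decomposition; it is
  the identity on \<open>H\<close>, so the inclusion is a section.\<close>

lemma internal_semidirect_split_exact:
  assumes NH: "is_internal_semidirect G N H"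
  shows "\<exists>\<pi>. split_exact (G\<lparr>carrier := N\<rparr>) G (G\<lparr>carrier := H\<rparr>) id \<pi>"
proof -
  have N: "N \<lhd> G" "subgroup N G" and H: "subgroup H G" and prod: "N <#> H = carrier G"
    using NH normal_imp_subgroup by (auto simp: is_internal_semidirect_def)
  note Nc = subgroup.mem_carrier[OF N(2)] and Hc = subgroup.mem_carrier[OF H]
  note unique = internal_semidirect_unique[OF NH]
  define \<pi> where "\<pi> x = (THE h. h \<in> H \<and> (\<exists>n\<in>N. x = n \<otimes> h))" for x
  have \<pi>: "\<pi> (n \<otimes> h) = h" if "n \<in> N" "h \<in> H" for n h
    unfolding \<pi>_def using that unique by (intro the_equality) blast+
  have \<pi>H: "\<pi> h = h" if "h \<in> H" for h
    using \<pi>[OF subgroup.one_closed[OF N(2)] that] Hc[OF that] by simp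
  have decomp: "\<exists>n\<in>N. \<exists>h\<in>H. x = n \<otimes> h" if "x \<in> carrier G" for x
    using that unfolding prod[symmetric] set_mult_def by blast
  have hom: "\<pi> \<in> hom G (G\<lparr>carrier := H\<rparr>)"
  proof (rule homI)
    fix x assume "x \<in> carrier G"
    then show "\<pi> x \<in> carrier (G\<lparr>carrier := H\<rparr>)" using decomp \<pi> by fastforce
  next
    fix x y assume "x \<in> carrier G" "y \<in> carrier G"
    then obtain n h n' h' where nh: "n \<in> N" "h \<in> H" "n' \<in> N" "h' \<in> H" "x = n \<otimes> h" "y = n' \<otimes> h'"
      using decomp by metis
    note cl = Nc[OF nh(1)] Nc[OF nh(3)] Hc[OF nh(2)] Hc[OF nh(4)]
    \<comment> \<open>Normality of \<open>N\<close> allows \<open>n'\<close> to be moved to the left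
      of \<open>h\<close> at the price of a conjugation.\<close>
    have "x \<otimes> y = (n \<otimes> (h \<otimes> n' \<otimes> inv h)) \<otimes> (h \<otimes> h')"
      using cl by (simp add: nh(5,6) m_assoc) (simp flip: m_assoc)
    moreover have "n \<otimes> (h \<otimes> n' \<otimes> inv h) \<in> N"
      using normal.inv_op_closed2[OF N(1) cl(3) nh(3)] nh(1) by (rule subgroup.m_closed[OF N(2), rotated])
    ultimately have "\<pi> (x \<otimes> y) = h \<otimes> h'"
      using \<pi> subgroup.m_closed[OF H nh(2,4)] by simp
    then show "\<pi> (x \<otimes> y) = \<pi> x \<otimes>\<^bsub>G\<lparr>carrier := H\<rparr>\<^esub> \<pi> y"
      by (simp add: nh \<pi>)
  qed
  have groups: "group (G\<lparr>carrier := N\<rparr>)" "group (G\<lparr>carrier := H\<rparr>)"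
    using N(2) H group by (simp_all add: subgroup.subgroup_is_group)
  have kernel: "kernel G (G\<lparr>carrier := H\<rparr>) \<pi> = N"
  proof
    show "kernel G (G\<lparr>carrier := H\<rparr>) \<pi> \<subseteq> N"
    proof
      fix x assume "x \<in> kernel G (G\<lparr>carrier := H\<rparr>) \<pi>"
      then have x: "x \<in> carrier G" "\<pi> x = \<one>" by (auto simp: kernel_def)
      obtain n h where nh: "n \<in> N" "h \<in> H" "x = n \<otimes> h" using decomp[OF x(1)] by blast
      with x(2) have "h = \<one>" by (simp add: \<pi>)
      with nh show "x \<in> N" using Nc by simp
    qed
    show "N \<subseteq> kernel G (G\<lparr>carrier := H\<rparr>) \<pi>"
      using \<pi>[OF _ subgroup.one_closed[OF H]] Nc by (fastforce simp: kernel_def)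
  qed
  have "short_exact_sequence (G\<lparr>carrier := H\<rparr>) G (G\<lparr>carrier := N\<rparr>) \<pi> id"
    unfolding short_exact_sequence_iff
  proof (intro conjI)
    have id: "id \<in> hom (G\<lparr>carrier := N\<rparr>) G" using Nc by (intro homI) auto
    show "exact_seq ([G\<lparr>carrier := H\<rparr>, G, G\<lparr>carrier := N\<rparr>], [\<pi>, id])"
      using groups group hom id kernel by (simp add: group_hom_def group_hom_axioms_def)
    show "\<pi> \<in> epi G (G\<lparr>carrier := H\<rparr>)"
      using hom \<pi>H Hc by (auto simp: epi_def hom_def image_iff) (metis \<pi>H Hc)
    show "id \<in> mon (G\<lparr>carrier := N\<rparr>) G" using id by (simp add: mon_def)
  qed
  moreover have "id \<in> hom (G\<lparr>carrier := H\<rparr>) G" using Hc by (intro homI) auto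
  then have "\<exists>\<sigma>\<in>hom (G\<lparr>carrier := H\<rparr>) G. \<forall>q\<in>carrier (G\<lparr>carrier := H\<rparr>). \<pi> (\<sigma> q) = q"
    using \<pi>H by (intro bexI[of _ id]) auto
  ultimately show ?thesis unfolding split_exact_def by blast
qed

end

lemma internal_semidirect_iso_image:
  assumes "group G" "group G'" "h \<in> iso G G'" "is_internal_semidirect G N H"
  shows "is_internal_semidirect G' (h ` N) (h ` H)"
proof -
  have N: "N \<lhd> G" "subgroup N G" and H: "subgroup H G" and int: "N \<inter> H = {\<one>\<^bsub>G\<^esub>}" and prod: "N <#>\<^bsub>G\<^esub> H = carrier G"
    using assms(4) normal_imp_subgroup by (auto simp: is_internal_semidirect_def)
  have hom: "group_hom G G' h"
    using assms(1-3) by (simp add: group_hom_def group_hom_axioms_def iso_def)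
  have inj: "inj_on h (carrier G)" and surj: "h ` carrier G = carrier G'" using assms(3) by (auto simp: iso_iff)
  have sub: "N \<subseteq> carrier G" "H \<subseteq> carrier G" using N H by (auto dest: subgroup.subset)
  have "h ` N <#>\<^bsub>G'\<^esub> h ` H = h ` (N <#>\<^bsub>G\<^esub> H)"
  proof -
    have "h (n \<otimes>\<^bsub>G\<^esub> x) = h n \<otimes>\<^bsub>G'\<^esub> h x" if "n \<in> N" "x \<in> H" for n x
      using that sub by (intro hom_mult[OF group_hom.homh[OF hom]]) auto
    then show ?thesis by (auto simp: set_mult_def image_UN)
  qed
  then show ?thesis
    unfolding is_internal_semidirect_def
    using iso_normal_subgroup[OF assms(3,1,2) N(1)] group_hom.subgroup_img_is_subgroup[OF hom H] surj prod
      inj_on_image_Int[OF inj sub, symmetric] int group_hom.hom_one[OF hom] by simp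
qed

lemma iso_restrict_image:
  assumes "h \<in> iso G G'" "N \<subseteq> carrier G"
  shows "h \<in> iso (G\<lparr>carrier := N\<rparr>) (G'\<lparr>carrier := h ` N\<rparr>)"
  using assms by (auto simp: iso_iff hom_def Pi_def subset_iff inj_on_def)

section \<open>Transport to \<open>PVT 4\<close>\<close>

text \<open>Conjugation by the isomorphism from \<open>PVT 4\<close> to \<open>F\<close>, restricted
  to the carrier to match the extensional maps in \<open>Aut4\<close>.\<close>

definition transport :: "(F \<Rightarrow> F) \<Rightarrow> pvt_map" where
  "transport \<phi> = (\<lambda>x\<in>carrier (PVT 4). inv_into (carrier (PVT 4)) PVT4_to_fprod (\<phi> (PVT4_to_fprod x)))"

lemma PVT4_bij: "bij_betw PVT4_to_fprod (carrier (PVT 4)) UNIV"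
  using PVT4_iso by (simp add: iso_def)

lemma PVT4_to_fprod_inv [simp]: "PVT4_to_fprod (inv_into (carrier (PVT 4)) PVT4_to_fprod z) = z"
  using PVT4_bij by (simp add: bij_betw_def f_inv_into_f)

lemma PVT4_inv_carrier [simp]: "inv_into (carrier (PVT 4)) PVT4_to_fprod z \<in> carrier (PVT 4)"
  using PVT4_bij by (simp add: bij_betw_def inv_into_into)

lemma PVT4_to_fprod_eqI: "PVT4_to_fprod x = PVT4_to_fprod y \<Longrightarrow> x \<in> carrier (PVT 4) \<Longrightarrow> y \<in> carrier (PVT 4) \<Longrightarrow> x = y"
  using PVT4_bij by (auto simp: bij_betw_def inj_on_def)

lemma PVT4_to_fprod_mult:
  "x \<in> carrier (PVT 4) \<Longrightarrow> y \<in> carrier (PVT 4) \<Longrightarrow>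
    PVT4_to_fprod (x \<otimes>\<^bsub>PVT 4\<^esub> y) = PVT4_to_fprod x + PVT4_to_fprod y"
  using hom_mult[OF PVT4_to_fprod_hom] by simp

lemma PVT4_to_fprod_m_inv:
  "x \<in> carrier (PVT 4) \<Longrightarrow> PVT4_to_fprod (inv\<^bsub>PVT 4\<^esub> x) = - PVT4_to_fprod x"
  using group_hom.hom_inv[of "PVT 4" additive_group PVT4_to_fprod x]
  by (simp add: group_hom_def group_hom_axioms_def PVT4_to_fprod_hom)

lemma transport_to_fprod: "x \<in> carrier (PVT 4) \<Longrightarrow> PVT4_to_fprod (transport \<phi> x) = \<phi> (PVT4_to_fprod x)"
  by (simp add: transport_def)

lemma transport_carrier: "x \<in> carrier (PVT 4) \<Longrightarrow> transport \<phi> x \<in> carrier (PVT 4)"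
  by (simp add: transport_def)

lemma transport_inj: "transport \<phi> = transport \<psi> \<Longrightarrow> \<phi> = \<psi>"
proof
  fix z assume eq: "transport \<phi> = transport \<psi>"
  show "\<phi> z = \<psi> z"
    using transport_to_fprod[OF PVT4_inv_carrier, of \<phi> z] transport_to_fprod[OF PVT4_inv_carrier, of \<psi> z]
    by (simp add: eq)
qed

text \<open>The direction from right to left makes \<open>transport\<close> well defined on
  automorphisms; the other one is what surjectivity onto \<open>Aut4\<close> needs.\<close>

lemma transport_Aut4: "transport \<phi> \<in> carrier Aut4 \<longleftrightarrow> \<phi> \<in> carrier aut_group"
proof -
  let ?c = "carrier (PVT 4)"
  have hom: "transport \<phi> \<in> hom (PVT 4) (PVT 4) \<longleftrightarrow> add_hom \<phi>"
  proof
    assume h: "transport \<phi> \<in> hom (PVT 4) (PVT 4)"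
    show "add_hom \<phi>"
      unfolding add_hom_def
    proof (intro allI)
      fix z w
      obtain x y where xy: "x \<in> ?c" "y \<in> ?c" "z = PVT4_to_fprod x" "w = PVT4_to_fprod y"
        by (metis PVT4_to_fprod_inv PVT4_inv_carrier)
      have "\<phi> (z + w) = PVT4_to_fprod (transport \<phi> (x \<otimes>\<^bsub>PVT 4\<^esub> y))"
        using xy by (simp add: transport_to_fprod PVT4_to_fprod_mult PVT4.m_closed del: mult_PVT)
      also have "\<dots> = \<phi> z + \<phi> w"
        unfolding hom_mult[OF h xy(1,2)]
        using xy by (simp add: transport_to_fprod PVT4_to_fprod_mult transport_carrier del: mult_PVT)
      finally show "\<phi> (z + w) = \<phi> z + \<phi> w" .
    qed
  next
    assume h: "add_hom \<phi>"
    show "transport \<phi> \<in> hom (PVT 4) (PVT 4)"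
    proof (rule homI[OF transport_carrier])
      fix x y assume xy: "x \<in> ?c" "y \<in> ?c"
      show "transport \<phi> (x \<otimes>\<^bsub>PVT 4\<^esub> y) = transport \<phi> x \<otimes>\<^bsub>PVT 4\<^esub> transport \<phi> y"
        using xy by (intro PVT4_to_fprod_eqI)
          (simp_all add: transport_to_fprod PVT4_to_fprod_mult transport_carrier PVT4.m_closed add_hom_add[OF h] del: mult_PVT)
    qed
  qed
  have "bij_betw (transport \<phi>) ?c ?c \<longleftrightarrow> bij \<phi>"
  proof -
    have inv: "bij_betw (inv_into ?c PVT4_to_fprod) UNIV ?c" using PVT4_bij by (rule bij_betw_inv_into)
    have "bij_betw (transport \<phi>) ?c ?c \<longleftrightarrow> bij_betw (inv_into ?c PVT4_to_fprod \<circ> (\<phi> \<circ> PVT4_to_fprod)) ?c ?c"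
      by (intro bij_betw_cong) (simp add: transport_def)
    also have "\<dots> \<longleftrightarrow> bij_betw (\<phi> \<circ> PVT4_to_fprod) ?c UNIV"
      using bij_betw_comp_iff2[OF inv, of "\<phi> \<circ> PVT4_to_fprod" ?c] by simp
    also have "\<dots> \<longleftrightarrow> bij \<phi>"
      using bij_betw_comp_iff[OF PVT4_bij, of \<phi> UNIV] by simp
    finally show ?thesis .
  qed
  with hom show ?thesis
    by (auto simp: AutoGroup_def auto_def Bij_def carrier_aut_group transport_def)
qed

lemma transport_iso: "transport \<in> iso aut_group Aut4"
  unfolding iso_iff
proof (intro conjI)
  show "transport \<in> hom aut_group Aut4"
  proof (rule homI)
    fix \<phi> \<psi> :: "F \<Rightarrow> F" assume a: "\<phi> \<in> carrier aut_group" "\<psi> \<in> carrier aut_group"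
    then have "transport \<phi> \<in> carrier Aut4" "transport \<psi> \<in> carrier Aut4" by (simp_all add: transport_Aut4)
    then show "transport (\<phi> \<otimes>\<^bsub>aut_group\<^esub> \<psi>) = transport \<phi> \<otimes>\<^bsub>Aut4\<^esub> transport \<psi>"
      by (simp add: AutoGroup_mult transport_def compose_def restrict_def fun_eq_iff)
  qed (simp add: transport_Aut4)
  show "inj_on transport (carrier aut_group)" by (intro inj_onI) (rule transport_inj)
  show "transport ` carrier aut_group = carrier Aut4"
  proof
    show "transport ` carrier aut_group \<subseteq> carrier Aut4" by (auto simp: transport_Aut4)
    show "carrier Aut4 \<subseteq> transport ` carrier aut_group"
    proof
      fix f assume f: "f \<in> carrier Aut4"
      then have fe: "f \<in> extensional (carrier (PVT 4))" "\<And>x. x \<in> carrier (PVT 4) \<Longrightarrow> f x \<in> carrier (PVT 4)"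
        by (auto simp: AutoGroup_def auto_def Bij_def hom_def)
      define \<phi> where "\<phi> = PVT4_to_fprod \<circ> f \<circ> inv_into (carrier (PVT 4)) PVT4_to_fprod"
      have inv: "inv_into (carrier (PVT 4)) PVT4_to_fprod (PVT4_to_fprod x) = x" if "x \<in> carrier (PVT 4)" for x
        using PVT4_bij that by (simp add: bij_betw_def)
      have "transport \<phi> = f"
        by (rule extensionalityI[OF _ fe(1)]) (simp_all add: transport_def \<phi>_def inv fe(2))
      with f show "f \<in> transport ` carrier aut_group" using transport_Aut4[of \<phi>] by auto
    qed
  qed
qed

lemma group_Aut4: "group Aut4"
  by (rule PVT4.AutoGroup)

lemma lam_carrier: "v \<in> verts4 \<Longrightarrow> lam 4 v \<in> carrier (PVT 4)"
  using x_y_gen_carrier by (auto simp: verts4_xv_yv xv_def yv_def x_gen_def y_gen_def)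

lemma auts_with_images_transport:
  assumes "\<And>v. v \<in> verts4 \<Longrightarrow> g v \<in> carrier (PVT 4) \<and> PVT4_to_fprod (g v) = f v"
  shows "auts_with_images g = transport ` with_images f"
proof -
  have iff: "transport \<phi> (lam 4 v) = g v \<longleftrightarrow> \<phi> (vert_letter v) = f v" if "v \<in> verts4" for \<phi> v
  proof -
    have "transport \<phi> (lam 4 v) = g v \<longleftrightarrow> PVT4_to_fprod (transport \<phi> (lam 4 v)) = PVT4_to_fprod (g v)"
      using PVT4_to_fprod_eqI[OF _ transport_carrier[OF lam_carrier[OF that], of \<phi>], of "g v"] assms[OF that]
      by auto
    then show ?thesis
      using assms[OF that] by (simp add: transport_to_fprod lam_carrier that vert_letter_def)
  qed
  have "auts_with_images g = {\<phi> \<in> transport ` carrier aut_group. \<forall>v\<in>verts4. \<phi> (lam 4 v) = g v}"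
    using transport_iso by (simp add: auts_with_images_def iso_iff)
  also have "\<dots> = transport ` {\<phi> \<in> carrier aut_group. \<forall>v\<in>verts4. transport \<phi> (lam 4 v) = g v}"
    by blast
  also have "{\<phi> \<in> carrier aut_group. \<forall>v\<in>verts4. transport \<phi> (lam 4 v) = g v} = with_images f"
    by (simp add: with_images_def iff cong: ball_cong)
  finally show ?thesis .
qed

lemma gr_transport: "(\<Union>\<sigma>\<in>graph_auts4. auts_with_images (\<lambda>v. lam 4 (\<sigma> v))) = transport ` gr_gens"
proof -
  have "auts_with_images (\<lambda>v. lam 4 (\<sigma> v)) = transport ` with_images (\<lambda>v. vert_letter (\<sigma> v))" if "\<sigma> \<in> graph_auts4" for \<sigma>
  proof (rule auts_with_images_transport)
    fix v assume "v \<in> verts4"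
    then have "\<sigma> v \<in> verts4" using that by (auto simp: graph_auts4_def bij_betw_def)
    then show "lam 4 (\<sigma> v) \<in> carrier (PVT 4) \<and> PVT4_to_fprod (lam 4 (\<sigma> v)) = vert_letter (\<sigma> v)"
      by (simp add: lam_carrier vert_letter_def)
  qed
  then show ?thesis by (simp add: gr_gens_def image_UN)
qed

lemma inv_transport:
  "(\<Union>a\<in>verts4. auts_with_images (\<lambda>v. if v = a then inv\<^bsub>PVT 4\<^esub> (lam 4 a) else lam 4 v)) = transport ` inv_gens"
proof -
  have "auts_with_images (\<lambda>v. if v = a then inv\<^bsub>PVT 4\<^esub> (lam 4 a) else lam 4 v)
      = transport ` with_images (\<lambda>v. if v = a then - vert_letter a else vert_letter v)" if "a \<in> verts4" for a
    using that by (intro auts_with_images_transport) (simp add: lam_carrier vert_letter_def PVT4_to_fprod_m_inv)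
  then show ?thesis by (simp add: inv_gens_def image_UN)
qed

lemma tr_transport:
  "(\<Union>i\<in>{1..3}. transvections (x_vert i) (y_vert i) \<union> transvections (y_vert i) (x_vert i)) = transport ` tr_gens"
proof -
  have *: "transvections a b = transport ` with_images (\<lambda>v. if v = a then vert_letter a + vert_letter b else vert_letter v)"
    if "a \<in> verts4" "b \<in> verts4" for a b
    unfolding transvections_def using that
    by (intro auts_with_images_transport)
      (simp add: lam_carrier vert_letter_def PVT4_to_fprod_mult PVT4.m_closed del: mult_PVT)
  have "transvections (xv i) (yv i) \<union> transvections (yv i) (xv i) =
     transport ` (with_images (\<lambda>v. if v = xv i then letter i e1 + letter i e2 else vert_letter v) \<union>
      with_images (\<lambda>v. if v = yv i then letter i e2 + letter i e1 else vert_letter v))" for i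
    by (simp add: * verts4_xv_yv image_Un cong del: if_weak_cong)
  then show ?thesis
    unfolding tr_gens_def range_index3 by (simp add: image_UN xv_def yv_def)
qed

lemma pc_transport:
  "(\<Union>i\<in>{1..3}. \<Union>b\<in>comp4 i. \<Union>J\<in>Pow ({1..3} - {i}). partial_conjs b (\<Union>j\<in>J. comp4 j)) = transport ` pc_gens"
proof -
  have *: "partial_conjs b C = transport ` with_images (\<lambda>v. if v \<in> C then - vert_letter b + vert_letter v + vert_letter b else vert_letter v)"
    if "b \<in> verts4" for b C
    unfolding partial_conjs_def using that
    by (intro auts_with_images_transport)
      (simp add: lam_carrier vert_letter_def PVT4_to_fprod_mult PVT4_to_fprod_m_inv PVT4.m_closed del: mult_PVT)
  have c: "comp4 (index3 i) = {xv i, yv i}" for i by (simp add: comp4_def xv_def yv_def)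
  have inj: "inj index3" by (metis injI of_nat_index3)
  have P: "Pow (range index3 - {index3 i}) = (`) index3 ` Pow (UNIV - {i})" for i
  proof (rule image_Pow_surj[symmetric])
    show "index3 ` (UNIV - {i}) = range index3 - {index3 i}"
      using inj by (auto simp: inj_eq)
  qed
  have C: "(\<Union>j\<in>J. {xv j, yv j}) = xv ` J \<union> yv ` J" for J
    by auto
  have "(\<Union>b\<in>comp4 (index3 i). \<Union>J\<in>Pow (range index3 - {index3 i}). partial_conjs b (\<Union>j\<in>J. comp4 j)) =
    transport ` (\<Union>b\<in>{xv i, yv i}. \<Union>J\<in>Pow (UNIV - {i}).
      with_images (\<lambda>v. if v \<in> xv ` J \<union> yv ` J then - vert_letter b + vert_letter v + vert_letter b else vert_letter v))" for i
  proof -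
    have bv: "b \<in> verts4" if "b \<in> {xv i, yv i}" for b using that by (auto simp: verts4_xv_yv)
    show ?thesis
      unfolding P image_UN image_image c C by (rule SUP_cong[OF HOL.refl], rule SUP_cong[OF HOL.refl], rule *[OF bv])
  qed
  then show ?thesis
    unfolding pc_gens_def range_index3 by (simp add: image_UN)
qed

lemma transport_group_hom: "group_hom aut_group Aut4 transport"
  using transport_iso group_Aut4 by (simp add: group_hom_def group_hom_axioms_def iso_def)

lemma gens_aut: "gr_gens \<subseteq> carrier aut_group" "inv_gens \<subseteq> carrier aut_group" "tr_gens \<subseteq> carrier aut_group"
  "pc_gens \<subseteq> carrier aut_group"
  by (auto simp: gr_gens_def inv_gens_def tr_gens_def pc_gens_def with_images_def)

lemma carrier_generated_transport:
  assumes "S \<subseteq> carrier aut_group"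
  shows "carrier (subgroup_generated Aut4 (transport ` S)) = transport ` generate aut_group S"
proof -
  have "transport ` S \<subseteq> carrier Aut4" using assms by (auto simp: transport_Aut4)
  then show ?thesis
    using group_hom.generate_img[OF transport_group_hom assms]
    by (simp add: carrier_subgroup_generated Int_absorb1)
qed

lemma carrier_Aut_pc: "carrier Aut_pc = transport ` pure_conj"
  unfolding Aut_pc_def pc_transport carrier_generated_transport[OF gens_aut(4)] generate_pc ..

lemma carrier_Aut_gr_inv_tr: "carrier Aut_gr_inv_tr = transport ` factor_auts"
proof -
  interpret G: group Aut4 by (rule group_Aut4)
  let ?U = "transport ` (gr_gens \<union> inv_gens \<union> tr_gens)"
  have sub: "gr_gens \<union> inv_gens \<union> tr_gens \<subseteq> carrier aut_group" using gens_aut by blast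
  have U: "?U \<subseteq> carrier Aut4" using sub by (auto simp: transport_Aut4)
  have parts: "carrier Aut_gr = generate Aut4 (transport ` gr_gens)" "carrier Aut_inv = generate Aut4 (transport ` inv_gens)"
    "carrier Aut_tr = generate Aut4 (transport ` tr_gens)"
    unfolding Aut_gr_def Aut_inv_def Aut_tr_def gr_transport inv_transport tr_transport carrier_subgroup_generated
    using U by (simp_all add: Int_absorb1 image_Un)
  let ?V = "carrier Aut_gr \<union> carrier Aut_inv \<union> carrier Aut_tr"
  have "?V \<subseteq> generate Aut4 ?U"
    unfolding parts by (intro Un_least G.mono_generate) auto
  then have "generate Aut4 ?V \<subseteq> generate Aut4 ?U"
    by (rule G.generate_subgroup_incl[OF _ G.generate_is_subgroup[OF U]])
  moreover have "?U \<subseteq> ?V" unfolding parts by (auto intro: generate.incl)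
  then have "generate Aut4 ?U \<subseteq> generate Aut4 ?V" by (rule G.mono_generate)
  moreover have "?V \<subseteq> carrier Aut4"
    using \<open>?V \<subseteq> generate Aut4 ?U\<close> G.generate_incl[OF U] by blast
  ultimately have "carrier Aut_gr_inv_tr = generate Aut4 ?U"
    unfolding Aut_gr_inv_tr_def carrier_subgroup_generated by (simp add: Int_absorb1)
  then show ?thesis
    using group_hom.generate_img[OF transport_group_hom sub] by (simp add: generate_gr_inv_tr)
qed

lemma subgroup_generated_eq: "subgroup_generated G S = G\<lparr>carrier := carrier (subgroup_generated G S)\<rparr>"
  by (simp add: subgroup_generated_def)

lemma Aut_pc_eq: "Aut_pc = Aut4\<lparr>carrier := carrier Aut_pc\<rparr>"
  and Aut_gr_inv_tr_eq: "Aut_gr_inv_tr = Aut4\<lparr>carrier := carrier Aut_gr_inv_tr\<rparr>"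
  unfolding Aut_pc_def Aut_gr_inv_tr_def by (rule subgroup_generated_eq)+

lemma mult_closed_semidirect:
  assumes "group N" "group H" "\<alpha> \<in> hom H (AutoGroup N)"
    and "x \<in> carrier (semidirect N H \<alpha>)" "y \<in> carrier (semidirect N H \<alpha>)"
  shows "x \<otimes>\<^bsub>semidirect N H \<alpha>\<^esub> y \<in> carrier (semidirect N H \<alpha>)"
proof -
  obtain a b c d where xy: "x = (a, b)" "y = (c, d)" "a \<in> carrier N" "b \<in> carrier H" "c \<in> carrier N" "d \<in> carrier H"
    using assms(4,5) by auto
  have "\<alpha> b \<in> hom N N"
    using hom_in_carrier[OF assms(3) xy(4)] by (simp add: AutoGroup_def auto_def)
  then have "\<alpha> b c \<in> carrier N" using xy(5) by (rule hom_in_carrier)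
  then show ?thesis
    using xy assms(1,2) by (simp add: group.is_monoid monoid.m_closed)
qed

lemma Z2_free3_iso_image:
  assumes "h \<in> hom additive_group (G\<lparr>carrier := P\<rparr>)" "inj h"
  shows "h \<circ> Z2_free3_to_fprod \<in> iso Z2_free3 (G\<lparr>carrier := range h\<rparr>)"
proof (rule iso_set_trans[OF Z2_free3_iso])
  show "h \<in> iso additive_group (G\<lparr>carrier := range h\<rparr>)"
    using assms by (auto simp: iso_iff hom_def)
qed

theorem theorem5p13:
  shows "(\<exists>\<pi>. split_exact Aut_pc Aut4 Aut_gr_inv_tr id \<pi>)
    \<and> is_internal_semidirect Aut4 (carrier Aut_pc) (carrier Aut_gr_inv_tr)
    \<and> (\<exists>\<alpha> \<in> hom Z2_free3 (AutoGroup Z2_free3).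
        \<exists>\<gamma> \<in> hom GL2Z_wr_S3 (AutoGroup (semidirect Z2_free3 Z2_free3 \<alpha>)).
        \<exists>f \<in> iso (semidirect Z2_free3 Z2_free3 \<alpha>) Aut_pc.
        \<exists>g \<in> iso GL2Z_wr_S3 Aut_gr_inv_tr.
          (\<lambda>(u, v). f u \<otimes>\<^bsub>Aut4\<^esub> g v)
            \<in> iso (semidirect (semidirect Z2_free3 Z2_free3 \<alpha>) GL2Z_wr_S3 \<gamma>) Aut4)"
proof -
  let ?P = "Aut4\<lparr>carrier := carrier Aut_pc\<rparr>" and ?K = "Aut4\<lparr>carrier := carrier Aut_gr_inv_tr\<rparr>"
  let ?pc = "aut_group\<lparr>carrier := pure_conj :: (F \<Rightarrow> F) set\<rparr>"
  have sd: "is_internal_semidirect Aut4 (carrier Aut_pc) (carrier Aut_gr_inv_tr)"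
    unfolding carrier_Aut_pc carrier_Aut_gr_inv_tr
    by (rule internal_semidirect_iso_image[OF group_aut_group group_Aut4 transport_iso
          internal_semidirect_pure_conj[OF int2_nontrivial int2_rank2]])
  have split: "\<exists>\<pi>. split_exact ?P Aut4 ?K id \<pi>"
    by (rule internal_semidirect_split_exact[OF group_Aut4 sd])
  have pc: "subgroup (pure_conj :: (F \<Rightarrow> F) set) aut_group" "subgroup (carrier Aut_pc) Aut4"
    using subgroup_pure_conj sd normal_imp_subgroup by (auto simp: is_internal_semidirect_def)
  have groups: "group ?pc" "group ?P"
    using pc group_aut_group group_Aut4 by (simp_all add: subgroup.subgroup_is_group)
  have t: "transport \<in> iso ?pc ?P"
    unfolding carrier_Aut_pc by (rule iso_restrict_image[OF transport_iso subgroup.subset[OF pc(1)]])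
  \<comment> \<open>The first semidirect product inside \<open>Aut_pc\<close>: the inner
    automorphisms and the twists, each a copy of \<open>F\<close> and hence of
    \<open>Z2_free3\<close>.\<close>
  have inner_twists: "is_internal_semidirect ?P (transport ` range inner_aut) (transport ` range twists)"
    by (rule internal_semidirect_iso_image[OF groups t internal_semidirect_inner_twists[OF int2_nontrivial]])
  have pc_hom: "transport \<circ> h \<in> hom additive_group ?P" if "h \<in> hom additive_group aut_group" "range h \<subseteq> pure_conj" for h :: "F \<Rightarrow> F \<Rightarrow> F"
    by (rule hom_compose[of _ _ ?pc]) (use that t in \<open>auto simp: hom_def iso_def\<close>)
  have inj: "inj (transport \<circ> inner_aut)" "inj (transport \<circ> (twists :: F \<Rightarrow> _))"
    using inj_inner[OF int2_nontrivial] inj_twists[where 'a = "int^2"] injI[of transport, OF transport_inj] by (simp_all add: inj_compose)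
  have i1: "(transport \<circ> inner_aut) \<circ> Z2_free3_to_fprod \<in> iso Z2_free3 (?P\<lparr>carrier := transport ` range inner_aut\<rparr>)"
    using Z2_free3_iso_image[OF pc_hom[OF inner_hom] inj(1)] inner_pure_conj by (auto simp: image_comp)
  have i2: "(transport \<circ> twists) \<circ> Z2_free3_to_fprod \<in> iso Z2_free3 (?P\<lparr>carrier := transport ` range twists\<rparr>)"
    using Z2_free3_iso_image[OF pc_hom[OF twists_hom] inj(2)] twists_pure_conj by (auto simp: image_comp)
  interpret Z: group Z2_free3 by (rule group_Z2_free3)
  obtain \<alpha> f where \<alpha>: "\<alpha> \<in> hom Z2_free3 (AutoGroup Z2_free3)" and f: "f \<in> iso (semidirect Z2_free3 Z2_free3 \<alpha>) ?P"
    using internal_semidirect_imp_external[OF groups(2) inner_twists i1 i2 Z.m_closed Z.m_closed] by blast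
  have g: "transport \<circ> wreath_map \<in> iso GL2Z_wr_S3 ?K"
    unfolding carrier_Aut_gr_inv_tr
    by (rule iso_set_trans[OF wreath_map_iso iso_restrict_image[OF transport_iso subgroup.subset[OF subgroup_factor_auts]]])
  \<comment> \<open>The same \<open>f\<close> that identifies \<open>Aut_pc\<close> with the inner
    semidirect product is reused here, so the two levels fit together.\<close>
  obtain \<gamma> where \<gamma>: "\<gamma> \<in> hom GL2Z_wr_S3 (AutoGroup (semidirect Z2_free3 Z2_free3 \<alpha>))"
    "(\<lambda>(u, v). f u \<otimes>\<^bsub>Aut4\<^esub> (transport \<circ> wreath_map) v) \<in> iso (semidirect (semidirect Z2_free3 Z2_free3 \<alpha>) GL2Z_wr_S3 \<gamma>) Aut4"
    using internal_semidirect_imp_external[OF group_Aut4 sd f g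
        mult_closed_semidirect[OF group_Z2_free3 group_Z2_free3 \<alpha>] mult_closed_GL2Z_wr_S3] by blast
  show ?thesis
    using split sd \<alpha> f g \<gamma> unfolding Aut_pc_eq[symmetric] Aut_gr_inv_tr_eq[symmetric] by blast
qed

end
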